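(* Let $R$ be a discrete valuation domain of characteristic $0$ with maximal ideal $pR$ for some prime number $p$, let $G$ be a finite cyclic $p$-group, and let $\mathbf{X}$ be a cohomological $G$-Mackey functor with values in the category of $R$-lattices which is Hilbert$^{90}$. Then there exists a finite $G$-set $\Omega$ such that $\mathbf{X}\simeq\mathbf{h}^0(R[\Omega])$. In particular, $\mathbf{X}$ is projective (in the category of cohomological $G$-Mackey functors with values in $R$-modules).
   Context: A cohomological $G$-Mackey functor $\mathbf{X}$ with values in $R$-modules consists of $R$-modules $\mathbf{X}_U$ ($U\subseteq G$ a subgroup) and $R$-linear maps $i_{U,V}\colon\mathbf{X}_U\to\mathbf{X}_V$, $t_{V,U}\colon\mathbf{X}_V\to\mathbf{X}_U$ (for subgroups $V\subseteq U\subseteq G$) and $c_{g,U}\colon\mathbf{X}_U\to\mathbf{X}_{{}^gU}$ ($g\in G$, ${}^gU=gUg^{-1}$), such that for all subgroups $W\subseteq V\subseteq U$ and $g,h\in G$: (1) $i_{U,U}=t_{U,U}=c_{u,U}=\mathrm{id}$ for $u\in U$; (2) $i_{V,W}\circ i_{U,V}=i_{U,W}$ and $t_{V,U}\circ t_{W,V}=t_{W,U}$; (3) $c_{h,{}^gU}\circ c_{g,U}=c_{hg,U}$; (4) $i_{{}^gU,{}^gV}\circ c_{g,U}=c_{g,V}\circ i_{U,V}$; (5) $t_{{}^gV,{}^gU}\circ c_{g,V}=c_{g,U}\circ t_{V,U}$; (6) for arbitrary subgroups $V,W\subseteq U$: $i_{U,W}\circ t_{V,U}=\sum_{g\in W\backslash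 U/V}t_{{}^gV\cap W,W}\circ c_{g,V\cap W^g}\circ i_{V,V\cap W^g}$, where $W^g=g^{-1}Wg$; (7) $t_{V,U}\circ i_{U,V}=|U:V|\cdot\mathrm{id}$. Morphisms are families of $R$-linear maps $\phi_U\colon\mathbf{X}_U\to\mathbf{Y}_U$ commuting with all $i,t,c$; this gives an abelian category (kernels and cokernels computed subgroupwise). $\mathbf{X}_{\{1\}}$ is a left $R[G]$-module via the maps $c_{g,\{1\}}$. An $R$-lattice is a finitely generated projective $R$-module; $\mathbf{X}$ has values in $R$-lattices if every $\mathbf{X}_U$ is an $R$-lattice. For a left $R[G]$-module $M$, $\mathbf{h}^0(M)$ is the cohomological $G$-Mackey functor with $\mathbf{h}^0(M)_U=M^U$, $i_{U,V}$ the inclusion $M^U\subseteq M^V$, $t_{V,U}$ multiplication by $\sum_{r\in\mathcal{R}}r$ with $\mathcal{R}\subseteq U$ a set of representatives of $U/V$, and $c_{g,U}$ left multiplication by $g$. $\mathbf{X}$ is of type $H^0$ if the maps $i_{U,\{1\}}$ induce an isomorphism $\mathbf{X}\simeq\mathbf{h}^0(\mathbf{X}_{\{1\}})$, i.e. each $i_{U,\{1\}}$ is injective with image $(\mathbf{X}_{\{1\}})^U$. $\mathbf{X}$ is Hilbert$^{90}$ if it is of type $H^0$ and $H^1(U,\mathbf{X}_{\{1\}})=0$ for every subgroup $U$ of $G$. *)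

theory Defs
  imports
    "HOL-Computational_Algebra.Primes"
    "HOL-Algebra.Module"
    "HOL-Algebra.Ring_Divisibility"
    "HOL-Algebra.Elementary_Groups"
    "HOL-Algebra.Left_Coset"
    "HOL-Algebra.Group_Action"
begin

section \<open>Discrete valuation domains\<close>

definition discrete_valuation_domain :: "('r, 'a) ring_scheme \<Rightarrow> bool" where
  "discrete_valuation_domain R \<longleftrightarrow>
     principal_domain R \<and> \<not> field R \<and> (\<exists>!I. maximalideal I R)"

definition char_zero :: "('r, 'a) ring_scheme \<Rightarrow> bool" where
  "char_zero R \<longleftrightarrow> (\<forall>n::nat. 0 < n \<longrightarrow> [n] \<cdot>\<^bsub>R\<^esub> \<one>\<^bsub>R\<^esub> \<noteq> \<zero>\<^bsub>R\<^esub>)"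


section \<open>Modules, lattices and permutation modules\<close>

text \<open>As with \<^const>\<open>hom\<close>, only the values on the carrier matter.\<close>

definition linear_maps ::
    "('r, 'a) ring_scheme \<Rightarrow> ('r, 'm) module \<Rightarrow> ('r, 'n) module \<Rightarrow> ('m \<Rightarrow> 'n) set" where
  "linear_maps R M N =
     {f \<in> carrier M \<rightarrow> carrier N.
        (\<forall>x\<in>carrier M. \<forall>y\<in>carrier M. f (x \<oplus>\<^bsub>M\<^esub> y) = f x \<oplus>\<^bsub>N\<^esub> f y) \<and>
        (\<forall>r\<in>carrier R. \<forall>x\<in>carrier M. f (r \<odot>\<^bsub>M\<^esub> x) = r \<odot>\<^bsub>N\<^esub> f x)}"

definition finitely_generated_module ::
    "('r, 'a) ring_scheme \<Rightarrow> ('r, 'm) module \<Rightarrow> bool" where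
  "finitely_generated_module R M \<longleftrightarrow> module R M \<and>
     (\<exists>A. finite A \<and> A \<subseteq> carrier M \<and>
        (\<forall>x\<in>carrier M. \<exists>a\<in>A \<rightarrow> carrier R. x = (\<Oplus>\<^bsub>M\<^esub>s\<in>A. a s \<odot>\<^bsub>M\<^esub> s)))"

text \<open>
  The lifting property, for test modules whose elements are of the types
  \<open>'n\<close> and \<open>'l\<close>: a formula cannot quantify over types.
\<close>

definition projective_module ::
    "'n itself \<Rightarrow> 'l itself \<Rightarrow> ('r, 'a) ring_scheme \<Rightarrow> ('r, 'm) module \<Rightarrow> bool" where
  "projective_module _ _ R P \<longleftrightarrow> module R P \<and>
     (\<forall>(N :: ('r, 'n) module) (L :: ('r, 'l) module) q f.
        module R N \<and> module R L \<and> q \<in> linear_maps R N L \<and> q ` carrier N = carrier L \<and>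
        f \<in> linear_maps R P L \<longrightarrow>
        (\<exists>h\<in>linear_maps R P N. \<forall>x\<in>carrier P. q (h x) = f x))"

text \<open>
  The type \<open>nat \<Rightarrow> 'r\<close> contains the finite free modules, so for a finitely generated
  module the lifting property for the following two types already implies it for all
  types: see lemma \<open>R_lattice_projective\<close> below.
\<close>

definition R_lattice :: "('r, 'a) ring_scheme \<Rightarrow> ('r, 'm) module \<Rightarrow> bool" where
  "R_lattice R M \<longleftrightarrow> finitely_generated_module R M \<and>
     projective_module TYPE(nat \<Rightarrow> 'r) TYPE('m) R M"

text \<open>
  \<open>R[\<Omega>]\<close> for finite \<open>\<Omega>\<close>; the function \<open>f\<close> stands for the sum of the \<open>f \<omega> \<cdot> \<omega>\<close>.  The
  fields \<open>mult\<close> and \<open>one\<close> play no role for modules.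
\<close>

definition free_module_on ::
    "('r, 'a) ring_scheme \<Rightarrow> 'w set \<Rightarrow> ('r, 'w \<Rightarrow> 'r) module" where
  "free_module_on R \<Omega> =
     \<lparr>carrier = \<Omega> \<rightarrow>\<^sub>E carrier R, monoid.mult = undefined, one = undefined,
      ring.zero = (\<lambda>\<omega>\<in>\<Omega>. \<zero>\<^bsub>R\<^esub>), ring.add = (\<lambda>f g. \<lambda>\<omega>\<in>\<Omega>. f \<omega> \<oplus>\<^bsub>R\<^esub> g \<omega>),
      smult = (\<lambda>r f. \<lambda>\<omega>\<in>\<Omega>. r \<otimes>\<^bsub>R\<^esub> f \<omega>)\<rparr>"

text \<open>The linear extension of \<open>\<omega> \<mapsto> g\<omega>\<close>: the coefficient of \<open>\<omega>\<close> in \<open>g f\<close> is that of \<open>g\<^sup>-\<^sup>1\<omega>\<close> in \<open>f\<close>.\<close>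

definition permutation_action ::
    "('g, 'b) monoid_scheme \<Rightarrow> 'w set \<Rightarrow> ('g \<Rightarrow> 'w \<Rightarrow> 'w) \<Rightarrow> 'g \<Rightarrow> ('w \<Rightarrow> 'r) \<Rightarrow> 'w \<Rightarrow> 'r" where
  "permutation_action G \<Omega> \<phi> g f = (\<lambda>\<omega>\<in>\<Omega>. f (\<phi> (inv\<^bsub>G\<^esub> g) \<omega>))"


lemma linear_maps_finsum:
  assumes "module R M" and "module R N" and f: "f \<in> linear_maps R M N"
    and "finite A" and "g \<in> A \<rightarrow> carrier M"
  shows "f (\<Oplus>\<^bsub>M\<^esub>i\<in>A. g i) = (\<Oplus>\<^bsub>N\<^esub>i\<in>A. f (g i))"
proof -
  interpret M: module R M by fact
  interpret N: module R N by fact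
  have cl: "f x \<in> carrier N" if "x \<in> carrier M" for x
    using f that by (auto simp: linear_maps_def)
  have add: "f (x \<oplus>\<^bsub>M\<^esub> y) = f x \<oplus>\<^bsub>N\<^esub> f y" if "x \<in> carrier M" "y \<in> carrier M" for x y
    using f that by (auto simp: linear_maps_def)
  have "f \<zero>\<^bsub>M\<^esub> \<oplus>\<^bsub>N\<^esub> f \<zero>\<^bsub>M\<^esub> = f \<zero>\<^bsub>M\<^esub>"
    using add[of "\<zero>\<^bsub>M\<^esub>" "\<zero>\<^bsub>M\<^esub>"] by simp
  hence zero: "f \<zero>\<^bsub>M\<^esub> = \<zero>\<^bsub>N\<^esub>"
    using cl[of "\<zero>\<^bsub>M\<^esub>"] by (metis M.M.zero_closed N.M.add.l_cancel_one)
  show ?thesis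
    using \<open>finite A\<close> \<open>g \<in> A \<rightarrow> carrier M\<close>
  proof (induction A rule: finite_induct)
    case empty
    show ?case by (simp add: zero)
  next
    case (insert a A)
    have 1: "g \<in> A \<rightarrow> carrier M" "g a \<in> carrier M" using insert.prems by auto
    hence 2: "(\<lambda>i. f (g i)) \<in> A \<rightarrow> carrier N" using cl by auto
    show ?case
      using insert.hyps insert.IH[OF 1(1)] 1 2 cl
      by (simp add: M.M.finsum_insert N.M.finsum_insert add M.M.finsum_closed)
  qed
qed

lemma module_free_module_on:
  assumes "cring R"
  shows "module R (free_module_on R \<Omega>)"
proof -
  interpret cring R by fact
  show ?thesis
  proof (rule moduleI)
    show "abelian_group (free_module_on R \<Omega>)"
    proof (rule abelian_groupI)
      fix f assume f: "f \<in> carrier (free_module_on R \<Omega>)"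
      show "\<exists>g\<in>carrier (free_module_on R \<Omega>).
          g \<oplus>\<^bsub>free_module_on R \<Omega>\<^esub> f = \<zero>\<^bsub>free_module_on R \<Omega>\<^esub>"
        using f by (intro bexI[of _ "\<lambda>\<omega>\<in>\<Omega>. \<ominus>\<^bsub>R\<^esub> f \<omega>"])
          (auto simp: free_module_on_def PiE_iff l_neg intro!: restrict_ext)
      show "\<zero>\<^bsub>free_module_on R \<Omega>\<^esub> \<oplus>\<^bsub>free_module_on R \<Omega>\<^esub> f = f"
        using f by (auto simp: free_module_on_def PiE_iff extensional_def fun_eq_iff)
    qed (auto simp: free_module_on_def PiE_iff a_ac intro!: restrict_ext)
  qed (use \<open>cring R\<close> in \<open>auto simp: free_module_on_def PiE_iff l_distr r_distr m_assoc
        extensional_def fun_eq_iff\<close>)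
qed

lemma free_module_on_hom:
  assumes "module R N" and "finite \<Omega>" and y: "y \<in> \<Omega> \<rightarrow> carrier N"
  shows "(\<lambda>a. \<Oplus>\<^bsub>N\<^esub>\<omega>\<in>\<Omega>. a \<omega> \<odot>\<^bsub>N\<^esub> y \<omega>) \<in> linear_maps R (free_module_on R \<Omega>) N"
proof -
  interpret N: module R N by fact
  have cl: "(\<lambda>\<omega>. a \<omega> \<odot>\<^bsub>N\<^esub> y \<omega>) \<in> \<Omega> \<rightarrow> carrier N" if "a \<in> \<Omega> \<rightarrow>\<^sub>E carrier R" for a
    using that y by (auto simp: PiE_iff Pi_iff)
  have add: "(\<Oplus>\<^bsub>N\<^esub>\<omega>\<in>\<Omega>. (\<lambda>\<omega>\<in>\<Omega>. a \<omega> \<oplus>\<^bsub>R\<^esub> b \<omega>) \<omega> \<odot>\<^bsub>N\<^esub> y \<omega>) =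
      (\<Oplus>\<^bsub>N\<^esub>\<omega>\<in>\<Omega>. a \<omega> \<odot>\<^bsub>N\<^esub> y \<omega>) \<oplus>\<^bsub>N\<^esub> (\<Oplus>\<^bsub>N\<^esub>\<omega>\<in>\<Omega>. b \<omega> \<odot>\<^bsub>N\<^esub> y \<omega>)"
    if "a \<in> \<Omega> \<rightarrow>\<^sub>E carrier R" "b \<in> \<Omega> \<rightarrow>\<^sub>E carrier R" for a b
  proof -
    have "(\<Oplus>\<^bsub>N\<^esub>\<omega>\<in>\<Omega>. (\<lambda>\<omega>\<in>\<Omega>. a \<omega> \<oplus>\<^bsub>R\<^esub> b \<omega>) \<omega> \<odot>\<^bsub>N\<^esub> y \<omega>) =
        (\<Oplus>\<^bsub>N\<^esub>\<omega>\<in>\<Omega>. a \<omega> \<odot>\<^bsub>N\<^esub> y \<omega> \<oplus>\<^bsub>N\<^esub> b \<omega> \<odot>\<^bsub>N\<^esub> y \<omega>)"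
      using that y by (intro N.M.finsum_cong') (auto simp: PiE_iff Pi_iff N.smult_l_distr)
    thus ?thesis using cl that by (simp add: N.M.finsum_addf)
  qed
  have smult: "(\<Oplus>\<^bsub>N\<^esub>\<omega>\<in>\<Omega>. (\<lambda>\<omega>\<in>\<Omega>. r \<otimes>\<^bsub>R\<^esub> a \<omega>) \<omega> \<odot>\<^bsub>N\<^esub> y \<omega>) =
      r \<odot>\<^bsub>N\<^esub> (\<Oplus>\<^bsub>N\<^esub>\<omega>\<in>\<Omega>. a \<omega> \<odot>\<^bsub>N\<^esub> y \<omega>)"
    if "r \<in> carrier R" "a \<in> \<Omega> \<rightarrow>\<^sub>E carrier R" for r a
  proof -
    have "(\<lambda>x. r \<odot>\<^bsub>N\<^esub> x) \<in> linear_maps R N N"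
      using that by (auto simp: linear_maps_def N.smult_r_distr N.R.m_comm simp flip: N.smult_assoc1)
    from linear_maps_finsum[OF \<open>module R N\<close> \<open>module R N\<close> this \<open>finite \<Omega>\<close> cl[OF that(2)]]
    have "r \<odot>\<^bsub>N\<^esub> (\<Oplus>\<^bsub>N\<^esub>\<omega>\<in>\<Omega>. a \<omega> \<odot>\<^bsub>N\<^esub> y \<omega>) = (\<Oplus>\<^bsub>N\<^esub>\<omega>\<in>\<Omega>. r \<odot>\<^bsub>N\<^esub> (a \<omega> \<odot>\<^bsub>N\<^esub> y \<omega>))" .
    also have "\<dots> = (\<Oplus>\<^bsub>N\<^esub>\<omega>\<in>\<Omega>. (\<lambda>\<omega>\<in>\<Omega>. r \<otimes>\<^bsub>R\<^esub> a \<omega>) \<omega> \<odot>\<^bsub>N\<^esub> y \<omega>)"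
      using that y by (intro N.M.finsum_cong') (auto simp: PiE_iff Pi_iff N.smult_assoc1)
    finally show ?thesis by simp
  qed
  show ?thesis
    using cl add smult by (auto simp: linear_maps_def free_module_on_def N.M.finsum_closed)
qed

lemma R_lattice_projective:
  fixes R :: "('r, 'a) ring_scheme" and M :: "('r, 'm) module"
  assumes "R_lattice R M"
  shows "projective_module TYPE('n) TYPE('l) R M"
proof -
  have M: "module R M" and proj: "projective_module TYPE(nat \<Rightarrow> 'r) TYPE('m) R M"
    using assms by (auto simp: R_lattice_def projective_module_def)
  interpret M: module R M by fact
  obtain A where A: "finite A" "A \<subseteq> carrier M"
    and gen: "\<And>x. x \<in> carrier M \<Longrightarrow> \<exists>a\<in>A \<rightarrow> carrier R. x = (\<Oplus>\<^bsub>M\<^esub>s\<in>A. a s \<odot>\<^bsub>M\<^esub> s)"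
    using assms unfolding R_lattice_def finitely_generated_module_def by blast
  define \<Omega> where "\<Omega> = {..<card A}"
  obtain e where e: "bij_betw e \<Omega> A"
    using ex_bij_betw_nat_finite[OF A(1)] by (auto simp: \<Omega>_def atLeast0LessThan)
  have eA: "e ` \<Omega> = A" and inj: "inj_on e \<Omega>" using e by (auto simp: bij_betw_def)
  have eM: "e \<in> \<Omega> \<rightarrow> carrier M" using eA A(2) by auto
  have fin: "finite \<Omega>" by (simp add: \<Omega>_def)
  let ?F = "free_module_on R \<Omega>"
  have F: "module R ?F" by (rule module_free_module_on) (rule M.R.cring_axioms)
  define \<pi> where "\<pi> = (\<lambda>a. \<Oplus>\<^bsub>M\<^esub>\<omega>\<in>\<Omega>. a \<omega> \<odot>\<^bsub>M\<^esub> e \<omega>)"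
  have \<pi>: "\<pi> \<in> linear_maps R ?F M" unfolding \<pi>_def by (rule free_module_on_hom[OF M fin eM])
  have surj: "\<pi> ` carrier ?F = carrier M"
  proof
    show "\<pi> ` carrier ?F \<subseteq> carrier M" using \<pi> by (auto simp: linear_maps_def)
    show "carrier M \<subseteq> \<pi> ` carrier ?F"
    proof
      fix x assume "x \<in> carrier M"
      then obtain a where a: "a \<in> A \<rightarrow> carrier R" "x = (\<Oplus>\<^bsub>M\<^esub>s\<in>A. a s \<odot>\<^bsub>M\<^esub> s)"
        using gen by blast
      have aR: "a (e \<omega>) \<in> carrier R" if "\<omega> \<in> \<Omega>" for \<omega>
        using a(1) eA that by auto
      have cl: "a (e \<omega>) \<odot>\<^bsub>M\<^esub> e \<omega> \<in> carrier M" if "\<omega> \<in> \<Omega>" for \<omega>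
        using aR[OF that] eM that by auto
      have "x = (\<Oplus>\<^bsub>M\<^esub>\<omega>\<in>\<Omega>. a (e \<omega>) \<odot>\<^bsub>M\<^esub> e \<omega>)"
        unfolding a(2) eA[symmetric]
        by (intro M.M.finsum_reindex inj) (use cl in auto)
      also have "\<dots> = \<pi> (\<lambda>\<omega>\<in>\<Omega>. a (e \<omega>))"
        unfolding \<pi>_def by (intro M.M.finsum_cong') (use cl in auto)
      finally show "x \<in> \<pi> ` carrier ?F"
        using aR by (intro image_eqI[of _ _ "\<lambda>\<omega>\<in>\<Omega>. a (e \<omega>)"]) (auto simp: free_module_on_def)
    qed
  qed
  have "(\<lambda>x. x) \<in> linear_maps R M M" by (auto simp: linear_maps_def)
  with proj[unfolded projective_module_def, THEN conjunct2, rule_format, of ?F M \<pi> "\<lambda>x. x"]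
  have "\<exists>s\<in>linear_maps R M ?F. \<forall>x\<in>carrier M. \<pi> (s x) = x"
    using F M \<pi> surj by simp
  then obtain s where s: "s \<in> linear_maps R M ?F" and \<pi>s: "\<And>x. x \<in> carrier M \<Longrightarrow> \<pi> (s x) = x"
    by blast
  have sR: "s x \<in> \<Omega> \<rightarrow> carrier R" if "x \<in> carrier M" for x
    using s that by (auto simp: linear_maps_def free_module_on_def PiE_iff)
  show ?thesis
    unfolding projective_module_def
  proof (intro conjI allI impI M)
    fix N :: "('r, 'n) module" and L :: "('r, 'l) module" and q f
    assume "module R N \<and> module R L \<and> q \<in> linear_maps R N L \<and> q ` carrier N = carrier L \<and>
        f \<in> linear_maps R M L"
    hence N: "module R N" and L: "module R L" and q: "q \<in> linear_maps R N L"
      and qs: "q ` carrier N = carrier L" and f: "f \<in> linear_maps R M L" by auto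
    interpret N: module R N by fact
    interpret L: module R L by fact
    have "\<forall>\<omega>\<in>\<Omega>. \<exists>z\<in>carrier N. q z = f (e \<omega>)"
    proof
      fix \<omega> assume "\<omega> \<in> \<Omega>"
      hence "f (e \<omega>) \<in> q ` carrier N" using f eM qs by (auto simp: linear_maps_def)
      thus "\<exists>z\<in>carrier N. q z = f (e \<omega>)" by force
    qed
    then obtain y where y: "\<And>\<omega>. \<omega> \<in> \<Omega> \<Longrightarrow> y \<omega> \<in> carrier N" "\<And>\<omega>. \<omega> \<in> \<Omega> \<Longrightarrow> q (y \<omega>) = f (e \<omega>)"
      by metis
    define k where "k = (\<lambda>a. \<Oplus>\<^bsub>N\<^esub>\<omega>\<in>\<Omega>. a \<omega> \<odot>\<^bsub>N\<^esub> y \<omega>)"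
    have k: "k \<in> linear_maps R ?F N"
      unfolding k_def using y by (intro free_module_on_hom N fin) auto
    have "(\<lambda>x. k (s x)) \<in> linear_maps R M N"
      using k s by (auto simp: linear_maps_def Pi_iff)
    moreover have "q (k (s x)) = f x" if x: "x \<in> carrier M" for x
    proof -
      have "q (k (s x)) = (\<Oplus>\<^bsub>L\<^esub>\<omega>\<in>\<Omega>. q (s x \<omega> \<odot>\<^bsub>N\<^esub> y \<omega>))"
        unfolding k_def using sR[OF x] y
        by (intro linear_maps_finsum[OF N L q fin]) (auto simp: Pi_iff)
      also have "\<dots> = (\<Oplus>\<^bsub>L\<^esub>\<omega>\<in>\<Omega>. f (s x \<omega> \<odot>\<^bsub>M\<^esub> e \<omega>))"
        using sR[OF x] y eM q f
        by (intro L.M.finsum_cong') (auto simp: Pi_iff linear_maps_def)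
      also have "\<dots> = f (\<pi> (s x))"
        unfolding \<pi>_def using sR[OF x] eM
        by (subst linear_maps_finsum[OF M L f fin]) (auto simp: Pi_iff)
      finally show ?thesis using \<pi>s[OF x] by simp
    qed
    ultimately show "\<exists>h\<in>linear_maps R M N. \<forall>x\<in>carrier M. q (h x) = f x"
      by (intro bexI[of _ "\<lambda>x. k (s x)"] ballI)
  qed
qed


section \<open>Fixed points and first cohomology\<close>

text \<open>
  A left \<open>R[G]\<close>-module is given by an \<open>R\<close>-module \<open>M\<close> together with the action
  \<open>act :: 'g \<Rightarrow> 'm \<Rightarrow> 'm\<close> of the group elements.
\<close>

definition fixed_points :: "('r, 'm) module \<Rightarrow> ('g \<Rightarrow> 'm \<Rightarrow> 'm) \<Rightarrow> 'g set \<Rightarrow> 'm set" where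
  "fixed_points M act U = {x \<in> carrier M. \<forall>u\<in>U. act u x = x}"

definition crossed_homs ::
    "('g, 'b) monoid_scheme \<Rightarrow> ('r, 'm) module \<Rightarrow> ('g \<Rightarrow> 'm \<Rightarrow> 'm) \<Rightarrow> 'g set \<Rightarrow> ('g \<Rightarrow> 'm) monoid"
  where
  "crossed_homs G M act U =
     \<lparr>carrier = {f \<in> U \<rightarrow>\<^sub>E carrier M.
                   \<forall>u\<in>U. \<forall>v\<in>U. f (u \<otimes>\<^bsub>G\<^esub> v) = f u \<oplus>\<^bsub>M\<^esub> act u (f v)},
      monoid.mult = (\<lambda>f g. \<lambda>u\<in>U. f u \<oplus>\<^bsub>M\<^esub> g u),
      one = (\<lambda>u\<in>U. \<zero>\<^bsub>M\<^esub>)\<rparr>"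

definition principal_crossed_homs ::
    "('r, 'm) module \<Rightarrow> ('g \<Rightarrow> 'm \<Rightarrow> 'm) \<Rightarrow> 'g set \<Rightarrow> ('g \<Rightarrow> 'm) set" where
  "principal_crossed_homs M act U = (\<lambda>m. \<lambda>u\<in>U. act u m \<ominus>\<^bsub>M\<^esub> m) ` carrier M"

definition H1 ::
    "('g, 'b) monoid_scheme \<Rightarrow> ('r, 'm) module \<Rightarrow> ('g \<Rightarrow> 'm \<Rightarrow> 'm) \<Rightarrow> 'g set
       \<Rightarrow> ('g \<Rightarrow> 'm) set monoid" where
  "H1 G M act U = crossed_homs G M act U Mod principal_crossed_homs M act U"


section \<open>Cohomological Mackey functors\<close>

text \<open>
  For \<open>V \<subseteq> U\<close>, \<open>mf_res F U V\<close>, \<open>mf_tr F V U\<close> and \<open>mf_con F g U\<close> stand for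
  \<open>i\<^bsub>U,V\<^esub> : F\<^sub>U \<rightarrow> F\<^sub>V\<close>, \<open>t\<^bsub>V,U\<^esub> : F\<^sub>V \<rightarrow> F\<^sub>U\<close> and \<open>c\<^bsub>g,U\<^esub> : F\<^sub>U \<rightarrow> F\<^bsub>gUg\<^sup>-\<^sup>1\<^esub>\<close>.  All modules \<open>F\<^sub>U\<close> have
  their elements in one type, but their carriers are unrelated.
\<close>

record ('r, 'm, 'g) mackey_functor =
  mf_obj :: "'g set \<Rightarrow> ('r, 'm) module"
  mf_res :: "'g set \<Rightarrow> 'g set \<Rightarrow> 'm \<Rightarrow> 'm"
  mf_tr  :: "'g set \<Rightarrow> 'g set \<Rightarrow> 'm \<Rightarrow> 'm"
  mf_con :: "'g \<Rightarrow> 'g set \<Rightarrow> 'm \<Rightarrow> 'm"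

definition conj_set :: "('g, 'b) monoid_scheme \<Rightarrow> 'g \<Rightarrow> 'g set \<Rightarrow> 'g set" where
  "conj_set G g U = g <#\<^bsub>G\<^esub> U #>\<^bsub>G\<^esub> (inv\<^bsub>G\<^esub> g)"

definition double_coset_reps ::
    "('g, 'b) monoid_scheme \<Rightarrow> 'g set \<Rightarrow> 'g set \<Rightarrow> 'g set \<Rightarrow> 'g set \<Rightarrow> bool" where
  "double_coset_reps G W U V D \<longleftrightarrow>
     D \<subseteq> U \<and> (\<forall>u\<in>U. \<exists>!d. d \<in> D \<and> u \<in> W <#>\<^bsub>G\<^esub> (d <#\<^bsub>G\<^esub> V))"

text \<open>
  The sum over \<open>W\U/V\<close> in the double coset formula does not depend on the choice of
  representatives, by the other axioms; \<open>res_tr\<close> asserts it for every choice.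
\<close>

locale cohomological_mackey_functor = R: cring R + G: group G
  for R :: "('r, 'a) ring_scheme" and G :: "('g, 'b) monoid_scheme"
    and F :: "('r, 'm, 'g) mackey_functor" +
  assumes finite_G: "finite (carrier G)"
    and obj_module: "subgroup U G \<Longrightarrow> module R (mf_obj F U)"
    and res_hom: "\<lbrakk>subgroup U G; subgroup V G; V \<subseteq> U\<rbrakk> \<Longrightarrow>
      mf_res F U V \<in> linear_maps R (mf_obj F U) (mf_obj F V)"
    and tr_hom: "\<lbrakk>subgroup U G; subgroup V G; V \<subseteq> U\<rbrakk> \<Longrightarrow>
      mf_tr F V U \<in> linear_maps R (mf_obj F V) (mf_obj F U)"
    and con_hom: "\<lbrakk>subgroup U G; g \<in> carrier G\<rbrakk> \<Longrightarrow>
      mf_con F g U \<in> linear_maps R (mf_obj F U) (mf_obj F (conj_set G g U))"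
    and res_id: "\<lbrakk>subgroup U G; x \<in> carrier (mf_obj F U)\<rbrakk> \<Longrightarrow> mf_res F U U x = x"
    and tr_id: "\<lbrakk>subgroup U G; x \<in> carrier (mf_obj F U)\<rbrakk> \<Longrightarrow> mf_tr F U U x = x"
    and con_id: "\<lbrakk>subgroup U G; u \<in> U; x \<in> carrier (mf_obj F U)\<rbrakk> \<Longrightarrow> mf_con F u U x = x"
    and res_res: "\<lbrakk>subgroup U G; subgroup V G; subgroup W G; W \<subseteq> V; V \<subseteq> U;
      x \<in> carrier (mf_obj F U)\<rbrakk> \<Longrightarrow> mf_res F V W (mf_res F U V x) = mf_res F U W x"
    and tr_tr: "\<lbrakk>subgroup U G; subgroup V G; subgroup W G; W \<subseteq> V; V \<subseteq> U;
      x \<in> carrier (mf_obj F W)\<rbrakk> \<Longrightarrow> mf_tr F V U (mf_tr F W V x) = mf_tr F W U x"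
    and con_con: "\<lbrakk>subgroup U G; g \<in> carrier G; h \<in> carrier G; x \<in> carrier (mf_obj F U)\<rbrakk> \<Longrightarrow>
      mf_con F h (conj_set G g U) (mf_con F g U x) = mf_con F (h \<otimes>\<^bsub>G\<^esub> g) U x"
    and res_con: "\<lbrakk>subgroup U G; subgroup V G; V \<subseteq> U; g \<in> carrier G;
      x \<in> carrier (mf_obj F U)\<rbrakk> \<Longrightarrow>
      mf_res F (conj_set G g U) (conj_set G g V) (mf_con F g U x) = mf_con F g V (mf_res F U V x)"
    and tr_con: "\<lbrakk>subgroup U G; subgroup V G; V \<subseteq> U; g \<in> carrier G;
      x \<in> carrier (mf_obj F V)\<rbrakk> \<Longrightarrow>
      mf_tr F (conj_set G g V) (conj_set G g U) (mf_con F g V x) = mf_con F g U (mf_tr F V U x)"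
    and res_tr: "\<lbrakk>subgroup U G; subgroup V G; subgroup W G; V \<subseteq> U; W \<subseteq> U;
      double_coset_reps G W U V D; x \<in> carrier (mf_obj F V)\<rbrakk> \<Longrightarrow>
      mf_res F U W (mf_tr F V U x) =
      (\<Oplus>\<^bsub>mf_obj F W\<^esub>g\<in>D.
         mf_tr F (conj_set G g V \<inter> W) W
           (mf_con F g (V \<inter> conj_set G (inv\<^bsub>G\<^esub> g) W)
             (mf_res F V (V \<inter> conj_set G (inv\<^bsub>G\<^esub> g) W) x)))"
    and tr_res: "\<lbrakk>subgroup U G; subgroup V G; V \<subseteq> U; x \<in> carrier (mf_obj F U)\<rbrakk> \<Longrightarrow>
      mf_tr F V U (mf_res F U V x) =
      [card (lcosets\<^bsub>G\<lparr>carrier := U\<rparr>\<^esub> V)] \<cdot>\<^bsub>mf_obj F U\<^esub> x"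

definition mackey_hom ::
    "('r, 'a) ring_scheme \<Rightarrow> ('g, 'b) monoid_scheme \<Rightarrow> ('r, 'm, 'g) mackey_functor
       \<Rightarrow> ('r, 'n, 'g) mackey_functor \<Rightarrow> ('g set \<Rightarrow> 'm \<Rightarrow> 'n) set" where
  "mackey_hom R G F Y = {\<phi>.
     (\<forall>U. subgroup U G \<longrightarrow> \<phi> U \<in> linear_maps R (mf_obj F U) (mf_obj Y U)) \<and>
     (\<forall>U V. subgroup U G \<and> subgroup V G \<and> V \<subseteq> U \<longrightarrow>
        (\<forall>x\<in>carrier (mf_obj F U). \<phi> V (mf_res F U V x) = mf_res Y U V (\<phi> U x)) \<and>
        (\<forall>x\<in>carrier (mf_obj F V). \<phi> U (mf_tr F V U x) = mf_tr Y V U (\<phi> V x))) \<and>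
     (\<forall>U g. subgroup U G \<and> g \<in> carrier G \<longrightarrow>
        (\<forall>x\<in>carrier (mf_obj F U).
           \<phi> (conj_set G g U) (mf_con F g U x) = mf_con Y g U (\<phi> U x)))}"

definition mackey_iso ::
    "('r, 'a) ring_scheme \<Rightarrow> ('g, 'b) monoid_scheme \<Rightarrow> ('r, 'm, 'g) mackey_functor
       \<Rightarrow> ('r, 'n, 'g) mackey_functor \<Rightarrow> ('g set \<Rightarrow> 'm \<Rightarrow> 'n) set" where
  "mackey_iso R G F Y = {\<phi> \<in> mackey_hom R G F Y.
     \<forall>U. subgroup U G \<longrightarrow> bij_betw (\<phi> U) (carrier (mf_obj F U)) (carrier (mf_obj Y U))}"

text \<open>
  Projectivity in the category of cohomological Mackey functors with values in all
  \<open>R\<close>-modules, for test objects with elements of the types \<open>'y\<close> and \<open>'z\<close>.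
  Cokernels are computed subgroupwise, so the epimorphisms are the subgroupwise surjections.
\<close>

definition mackey_projective ::
    "'y itself \<Rightarrow> 'z itself \<Rightarrow> ('r, 'a) ring_scheme \<Rightarrow> ('g, 'b) monoid_scheme
       \<Rightarrow> ('r, 'm, 'g) mackey_functor \<Rightarrow> bool" where
  "mackey_projective _ _ R G F \<longleftrightarrow> cohomological_mackey_functor R G F \<and>
     (\<forall>(Y :: ('r, 'y, 'g) mackey_functor) (Z :: ('r, 'z, 'g) mackey_functor) q f.
        cohomological_mackey_functor R G Y \<and> cohomological_mackey_functor R G Z \<and>
        q \<in> mackey_hom R G Y Z \<and>
        (\<forall>U. subgroup U G \<longrightarrow> q U ` carrier (mf_obj Y U) = carrier (mf_obj Z U)) \<and>
        f \<in> mackey_hom R G F Z \<longrightarrow>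
        (\<exists>h\<in>mackey_hom R G F Y.
           \<forall>U. subgroup U G \<longrightarrow> (\<forall>x\<in>carrier (mf_obj F U). q U (h U x) = f U x)))"

text \<open>On \<open>M\<^sup>V\<close> the transfer does not depend on the chosen coset representatives.\<close>

definition h0 ::
    "('g, 'b) monoid_scheme \<Rightarrow> ('r, 'm) module \<Rightarrow> ('g \<Rightarrow> 'm \<Rightarrow> 'm)
       \<Rightarrow> ('r, 'm, 'g) mackey_functor" where
  "h0 G M act =
     \<lparr>mf_obj = (\<lambda>U. M\<lparr>carrier := fixed_points M act U\<rparr>),
      mf_res = (\<lambda>U V x. x),
      mf_tr = (\<lambda>V U x. \<Oplus>\<^bsub>M\<^esub>C\<in>lcosets\<^bsub>G\<lparr>carrier := U\<rparr>\<^esub> V. act (SOME r. r \<in> C) x),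
      mf_con = (\<lambda>g U. act g)\<rparr>"

definition type_H0 ::
    "('r, 'a) ring_scheme \<Rightarrow> ('g, 'b) monoid_scheme \<Rightarrow> ('r, 'm, 'g) mackey_functor \<Rightarrow> bool" where
  "type_H0 R G F \<longleftrightarrow>
     (\<lambda>U. mf_res F U {\<one>\<^bsub>G\<^esub>})
       \<in> mackey_iso R G F (h0 G (mf_obj F {\<one>\<^bsub>G\<^esub>}) (\<lambda>g. mf_con F g {\<one>\<^bsub>G\<^esub>}))"

definition hilbert90 ::
    "('r, 'a) ring_scheme \<Rightarrow> ('g, 'b) monoid_scheme \<Rightarrow> ('r, 'm, 'g) mackey_functor \<Rightarrow> bool" where
  "hilbert90 R G F \<longleftrightarrow> type_H0 R G F \<and>
     (\<forall>U. subgroup U G \<longrightarrow>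
        trivial_group (H1 G (mf_obj F {\<one>\<^bsub>G\<^esub>}) (\<lambda>g. mf_con F g {\<one>\<^bsub>G\<^esub>}) U))"

end

theory Submission
  imports
    "HOL-Computational_Algebra.Polynomial_Factorial"
    "HOL-Algebra.Multiplicative_Group"
    Defs
begin

text \<open>
  Let \<open>M = F\<^sub>1\<close>, let \<open>\<sigma>\<close> be the action on \<open>M\<close> of a generator of \<open>G\<close>, put \<open>X = \<sigma> - 1\<close>, and let \<open>M\<^sub>j\<close> be the fixed
  points of \<open>\<sigma>^(p^j)\<close>. As \<open>F\<close> is of type \<open>H\<^sup>0\<close>, it is \<open>h\<^sup>0(M)\<close>, and its values are the \<open>M\<^sub>j\<close>. The heart of the
  matter is that \<open>M\<close> has an \<open>R\<close>-basis that is permuted by \<open>\<sigma>\<close>.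

  Modulo \<open>p\<close> the operator \<open>X\<close> is nilpotent and \<open>M/pM\<close> is a sum of Jordan blocks. In a permutation module
  an orbit of length \<open>p^j\<close> contributes one block of size \<open>p^j\<close>, generated by an element of \<open>M\<^sub>j\<close>. Two
  facts show that every \<open>M\<close> as in the theorem has this shape modulo \<open>p\<close>. First, \<open>H\<^sup>1 = 0\<close> implies that
  every element of \<open>M/pM\<close> that is killed by \<open>X^(p^j)\<close> lifts to \<open>M\<^sub>j\<close> (\<open>Fix_lift_X\<close>). Second, \<open>M\<^sub>j\<^sub>+\<^sub>1/M\<^sub>j\<close> is a
  torsion-free module over \<open>R[\<zeta>]\<close> for a root of unity \<open>\<zeta>\<close> of order \<open>p^(j+1)\<close>; as \<open>p\<close> is a uniformizer of
  \<open>R\<close>, the cyclotomic polynomial is an Eisenstein polynomial in \<open>X\<close>, hence \<open>p\<close> is a unit times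
  \<open>X^(p^(j+1) - p^j)\<close> on that quotient (\<open>p_multiple_Fix_Suc\<close>). This leaves no room for a Jordan block
  of size strictly between \<open>p^j\<close> and \<open>p^(j+1)\<close> (\<open>socle_height\<close>).

  The Jordan decomposition itself is avoided. The socle of a block that is generated by \<open>v\<close> in \<open>M\<^sub>k\<close> is
  spanned by the trace of \<open>v\<close>, because \<open>1 + \<sigma> + \<dots> + \<sigma>^(p^k - 1)\<close> is \<open>X^(p^k - 1)\<close> modulo \<open>p\<close>. So one
  chooses, from large \<open>k\<close> to small, elements whose traces are a basis modulo \<open>p\<close> of all traces
  (\<open>select_generators\<close>). Their translates \<open>\<sigma>^c v\<close> with \<open>c < p^k\<close> span \<open>M\<close> by the two facts and Nakayama's
  lemma (\<open>stable_spanning\<close>), and they are independent because a relation modulo \<open>p\<close> can be pushed into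
  the socle (\<open>stable_in_pM\<close>, \<open>stable_basis\<close>).

  For projectivity let \<open>B\<close> be the permuted basis. An element \<open>b\<close> of \<open>B\<close> with stabilizer \<open>S\<close> comes from an
  element \<open>e\<^sub>b\<close> of \<open>F\<^sub>S\<close>, and \<open>F\<^sub>V\<close> is free on the elements \<open>t i e\<^sub>b\<close>, where \<open>i\<close> restricts from \<open>S\<close> to \<open>V \<inter> S\<close>, \<open>t\<close>
  transfers from \<open>V \<inter> S\<close> to \<open>V\<close>, and \<open>b\<close> runs over representatives of the \<open>V\<close>-orbits (\<open>expand\<close>). The
  structure maps act on elements of the form \<open>t i y\<close> by formulas that hold in every cohomological
  Mackey functor for an abelian group (\<open>con_spread\<close>, \<open>res_spread\<close>, \<open>tr_spread\<close>). Hence every equivariant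
  choice of images of the \<open>e\<^sub>b\<close> extends to a morphism (\<open>lift_mackey_hom\<close>), and the choice can be made
  inside the fibres of an epimorphism (\<open>equivariant_choice\<close>).
\<close>

section \<open>Integer polynomials in an element of \<open>p\<close>-power order\<close>

text \<open>
  Operators on \<open>M\<close> are written as polynomials in \<open>\<T>\<close>, which will act as \<open>\<sigma>\<close>, so that every identity
  between them can be proved in \<open>\<int>[\<T>]\<close>.
\<close>

definition polyT :: "int poly" ("\<T>") where "\<T> = [:0, 1:]"
definition polyX :: "int poly" ("\<X>") where "\<X> = \<T> - 1"

lemma X_pCons: "\<X> = [:-1, 1:]" by (simp add: polyX_def polyT_def one_pCons)
lemma poly_T [simp]: "poly \<T> x = x" by (simp add: polyT_def)
lemma poly_X [simp]: "poly \<X> x = x - 1" by (simp add: polyX_def)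

lemma prime_dvd_cancel_X:
  assumes p: "Factorial_Ring.prime (p::nat)" and d: "of_nat p dvd \<X> ^ k * f"
  shows "of_nat p dvd f"
proof -
  have c: "of_nat p = [:int p:]" by (simp add: of_nat_poly)
  have pe: "prime_elem [:int p:]" using p by (simp add: prime_elem_const_poly_iff)
  have nX: "\<not> [:int p:] dvd \<X>"
    using p unfolding X_pCons by (auto simp: const_poly_dvd_iff coeff_pCons split: nat.splits dest: spec[of _ 1] prime_gt_1_nat)
  have "\<not> [:int p:] dvd \<X> ^ k"
    using pe nX prime_elem_dvd_power by blast
  thus ?thesis using d pe c prime_elem_dvd_mult_iff by metis
qed

text \<open>
  Iterated Frobenius: raising a congruence \<open>f \<equiv> 1 + g\<close> modulo \<open>p\<close> to the \<open>p\<close>-th power gives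
  \<open>f ^ p \<equiv> 1 + g ^ p\<close>.
\<close>

lemma frobenius_poly:
  assumes p: "Factorial_Ring.prime (p::nat)"
  shows "of_nat p dvd (\<T> ^ (p ^ j) - 1) - \<X> ^ (p ^ j)"
proof (induction j)
  case 0
  show ?case by (simp add: polyX_def)
next
  case (Suc j)
  have step: "of_nat p dvd (f ^ p - 1) - (g ^ p)" if fg: "of_nat p dvd (f - 1) - g" for f g :: "int poly"
  proof -
    obtain h where h: "f - 1 - g = of_nat p * h" using fg by (auto elim: dvdE)
    have A: "of_nat p dvd (1 + y) ^ p - (1 + y ^ p)" for y :: "int poly"
    proof -
      have "(1 + y) ^ p = (\<Sum>k\<le>p. of_nat (p choose k) * y ^ k)"
        using binomial_ring[of y 1 p] by (simp add: add.commute)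
      also have "{..p} = insert 0 (insert p {0<..<p})" using prime_gt_0_nat[OF p] by auto
      finally have "(1 + y) ^ p - (1 + y ^ p) = (\<Sum>k\<in>{0<..<p}. of_nat (p choose k) * y ^ k)"
        using prime_gt_0_nat[OF p] by simp
      moreover have "of_nat p dvd (of_nat (p choose k) :: int poly)" if "k \<in> {0<..<p}" for k
      proof -
        have "k * (p choose k) = p * (p - 1 choose (k - 1))"
          using that by (simp add: times_binomial_minus1_eq)
        hence "p dvd k * (p choose k)" by simp
        hence "p dvd (p choose k)"
          using p that by (auto simp: prime_dvd_mult_iff dest: dvd_imp_le)
        thus ?thesis by (metis dvd_def of_nat_mult)
      qed
      ultimately show ?thesis by (auto intro!: dvd_sum dvd_mult2)
    qed
    have "of_nat p dvd f ^ p - (1 + g) ^ p"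
    proof -
      have "f - (1 + g) dvd f ^ p - (1 + g) ^ p" by (simp add: power_diff_sumr2)
      moreover have "of_nat p dvd f - (1 + g)" using fg by (simp add: algebra_simps)
      ultimately show ?thesis by (rule dvd_trans[rotated])
    qed
    from dvd_add[OF this A[of g]] show ?thesis by (simp add: algebra_simps)
  qed
  show ?case using step[OF Suc] by (simp add: power_mult[symmetric] mult.commute)
qed

text \<open>
  These are the traces of cyclic groups: \<open>Tr_poly k\<close> is the trace for a group of order \<open>k\<close> generated
  by \<open>\<sigma>\<close>, and \<open>norm_poly d k\<close> the one for a group of order \<open>k\<close> generated by \<open>\<sigma> ^ d\<close>.
\<close>

definition Tr_poly :: "nat \<Rightarrow> int poly" where "Tr_poly k = (\<Sum>c<k. \<T> ^ c)"
definition norm_poly :: "nat \<Rightarrow> nat \<Rightarrow> int poly" where "norm_poly d k = (\<Sum>c<k. (\<T> ^ d) ^ c)"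

lemma norm_poly_mult: "(\<T> ^ d - 1) * norm_poly d k = \<T> ^ (d * k) - 1"
  using power_diff_1_eq[of "\<T> ^ d" k] by (simp add: norm_poly_def power_mult)


lemma norm_poly_add: "norm_poly d (k + l) = norm_poly d k + \<T> ^ (d * k) * norm_poly d l"
  by (induction l) (simp_all add: norm_poly_def power_add power_mult algebra_simps)

lemma Tr_poly_eq: "Tr_poly k = norm_poly 1 k" by (simp add: Tr_poly_def norm_poly_def)

text \<open>
  Both sides become congruent after multiplication by \<open>\<X> ^ (p ^ i)\<close>, by \<open>frobenius_poly\<close> for the
  exponents \<open>i\<close> and \<open>i + j\<close>, and \<open>\<X>\<close> can be cancelled modulo \<open>p\<close>.
\<close>

lemma norm_poly_prime_power:
  assumes p: "Factorial_Ring.prime (p::nat)"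
  shows "of_nat p dvd norm_poly (p ^ i) (p ^ j) - \<X> ^ (p ^ (i + j) - p ^ i)"
proof (rule prime_dvd_cancel_X[OF p])
  obtain a where a: "\<T> ^ (p ^ i) - 1 = \<X> ^ (p ^ i) + of_nat p * a"
    using frobenius_poly[OF p, of i] by (metis add.commute diff_eq_eq dvdE)
  obtain b where b: "\<T> ^ (p ^ (i + j)) - 1 = \<X> ^ (p ^ (i + j)) + of_nat p * b"
    using frobenius_poly[OF p, of "i + j"] by (metis add.commute diff_eq_eq dvdE)
  have le: "p ^ i \<le> p ^ (i + j)" using prime_gt_0_nat[OF p] by (simp add: power_add)
  have "(\<X> ^ (p ^ i) + of_nat p * a) * norm_poly (p ^ i) (p ^ j) = \<X> ^ (p ^ (i + j)) + of_nat p * b"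
    using norm_poly_mult[of "p ^ i" "p ^ j"] unfolding a power_add[symmetric] b .
  moreover have "\<X> ^ (p ^ i) * \<X> ^ (p ^ (i + j) - p ^ i) = \<X> ^ (p ^ (i + j))"
    using le by (simp flip: power_add)
  ultimately have "\<X> ^ (p ^ i) * (norm_poly (p ^ i) (p ^ j) - \<X> ^ (p ^ (i + j) - p ^ i)) =
      of_nat p * (b - a * norm_poly (p ^ i) (p ^ j))" by (simp add: algebra_simps)
  thus "of_nat p dvd \<X> ^ (p ^ i) * (norm_poly (p ^ i) (p ^ j) - \<X> ^ (p ^ (i + j) - p ^ i))" by simp
qed

lemma Tr_poly_prime_power:
  assumes p: "Factorial_Ring.prime (p::nat)"
  shows "\<exists>b. Tr_poly (p ^ j) = \<X> ^ (p ^ j - 1) + of_nat p * b"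
  using norm_poly_prime_power[OF p, of 0 j] unfolding Tr_poly_eq
  by (metis add_0 add.commute diff_eq_eq dvdE power_0)

text \<open>
  For \<open>j\<close> the left-hand side is the cyclotomic polynomial of order \<open>p ^ (j + 1)\<close>. In terms of \<open>\<X>\<close> it is
  an Eisenstein polynomial; moreover its constant term is exactly \<open>p\<close>, whence the factor \<open>1 + \<X> * h\<close>,
  which becomes invertible where \<open>\<X>\<close> is nilpotent modulo \<open>p\<close>.
\<close>

lemma cyclotomic_poly_eisenstein:
  assumes p: "Factorial_Ring.prime (p::nat)"
  shows "\<exists>h. norm_poly (p ^ j) p = \<X> ^ (p ^ Suc j - p ^ j) + of_nat p * (1 + \<X> * h)"
proof -
  obtain g where g: "norm_poly (p ^ j) p = \<X> ^ (p ^ Suc j - p ^ j) + of_nat p * g"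
    using norm_poly_prime_power[OF p, of j 1]
    by (metis add.commute diff_eq_eq dvdE One_nat_def add_Suc_right add_0_right power_one_right)
  have "p ^ j < p ^ Suc j" using prime_gt_1_nat[OF p] by simp
  hence "p ^ Suc j - p ^ j > 0" by simp
  \<comment> \<open>at \<open>\<T> = 1\<close> the left-hand side is \<open>p\<close> and the power of \<open>\<X>\<close> vanishes, so \<open>g(1) = 1\<close>\<close>
  with arg_cong[OF g, of "\<lambda>f. poly f 1"] have "int p = int p * poly g 1"
    by (simp add: norm_poly_def poly_sum zero_power)
  hence "poly (g - 1) 1 = 0" using prime_gt_0_nat[OF p] by simp
  then obtain h where "g - 1 = \<X> * h" unfolding poly_eq_0_iff_dvd dvd_def X_pCons by auto
  thus ?thesis using g by (metis add.commute diff_eq_eq)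
qed

section \<open>Linear maps and integer multiples\<close>

lemma linear_mapsD:
  assumes "f \<in> linear_maps R M N"
  shows "x \<in> carrier M \<Longrightarrow> f x \<in> carrier N"
    and "\<lbrakk>x \<in> carrier M; y \<in> carrier M\<rbrakk> \<Longrightarrow> f (x \<oplus>\<^bsub>M\<^esub> y) = f x \<oplus>\<^bsub>N\<^esub> f y"
    and "\<lbrakk>r \<in> carrier R; x \<in> carrier M\<rbrakk> \<Longrightarrow> f (r \<odot>\<^bsub>M\<^esub> x) = r \<odot>\<^bsub>N\<^esub> f x"
  using assms by (auto simp: linear_maps_def)

lemma linear_maps_abelian_group_hom:
  assumes "module R M" "module R N" "f \<in> linear_maps R M N"
  shows "abelian_group_hom M N f"
proof -
  interpret M: module R M by fact
  interpret N: module R N by fact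
  show ?thesis
    using linear_mapsD[OF assms(3)]
    by (intro abelian_group_homI M.abelian_group_axioms N.abelian_group_axioms
        group_hom.intro group_hom_axioms.intro M.M.a_group N.M.a_group) (auto simp: hom_def)
qed

lemma linear_maps_add_pow:
  assumes "module R M" "module R N" "f \<in> linear_maps R M N" "x \<in> carrier M"
  shows "f ([(k::int)] \<cdot>\<^bsub>M\<^esub> x) = [k] \<cdot>\<^bsub>N\<^esub> f x"
proof -
  interpret f: abelian_group_hom M N f by (rule linear_maps_abelian_group_hom[OF assms(1-3)])
  show ?thesis using group_hom.hom_int_pow[OF f.a_group_hom, of x k] assms(4) by (simp add: add_pow_def)
qed

lemma linear_maps_minus:
  assumes "module R M" "module R N" "f \<in> linear_maps R M N" "x \<in> carrier M" "y \<in> carrier M"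
  shows "f (x \<ominus>\<^bsub>M\<^esub> y) = f x \<ominus>\<^bsub>N\<^esub> f y"
proof -
  interpret f: abelian_group_hom M N f by (rule linear_maps_abelian_group_hom[OF assms(1-3)])
  show ?thesis using assms(4,5) by (simp add: a_minus_def)
qed

lemma linear_maps_zero:
  assumes "module R M" "module R N" "f \<in> linear_maps R M N"
  shows "f \<zero>\<^bsub>M\<^esub> = \<zero>\<^bsub>N\<^esub>"
proof -
  interpret f: abelian_group_hom M N f by (rule linear_maps_abelian_group_hom[OF assms(1-3)])
  show ?thesis by simp
qed

text \<open>
  The library locale \<open>module\<close> leaves the record type of \<open>M\<close> open, whereas \<open>linear_maps\<close> is about records
  of type \<open>module\<close>.
\<close>

locale module_over = module R M for R :: "('r, 'a) ring_scheme" and M :: "('r, 'm) module" (structure)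

lemma (in module_over) smult_linear: "r \<in> carrier R \<Longrightarrow> (\<lambda>x. r \<odot>\<^bsub>M\<^esub> x) \<in> linear_maps R M M"
  by (auto simp: linear_maps_def smult_r_distr R.m_comm simp flip: smult_assoc1)

context abelian_group begin

lemma zmul_closed [simp, intro]: "x \<in> carrier G \<Longrightarrow> [(k::int)] \<cdot> x \<in> carrier G"
  using group.int_pow_closed[OF a_group, of x k] by (simp add: add_pow_def)

lemma zmul_plus: "x \<in> carrier G \<Longrightarrow> [((k::int) + l)] \<cdot> x = [k] \<cdot> x \<oplus> [l] \<cdot> x"
  using group.int_pow_mult[OF a_group, of x k l] by (simp add: add_pow_def)

lemma zmul_mult: "x \<in> carrier G \<Longrightarrow> [((k::int) * l)] \<cdot> x = [k] \<cdot> ([l] \<cdot> x)"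
  using group.int_pow_pow[OF a_group, of x l k] by (simp add: add_pow_def mult.commute)

lemma zmul_add: "\<lbrakk>x \<in> carrier G; y \<in> carrier G\<rbrakk> \<Longrightarrow> [(k::int)] \<cdot> (x \<oplus> y) = [k] \<cdot> x \<oplus> [k] \<cdot> y"
  using comm_group.int_pow_distrib[OF a_comm_group, of x y k] by (simp add: add_pow_def)

lemma zmul_0 [simp]: "[(0::int)] \<cdot> x = \<zero>"
  by (simp add: add_pow_def int_pow_def)

lemma zmul_1 [simp]: "x \<in> carrier G \<Longrightarrow> [(1::int)] \<cdot> x = x"
  using group.int_pow_1[OF a_group, of x] by (simp add: add_pow_def)

lemma zmul_zero [simp]: "[(k::int)] \<cdot> \<zero> = \<zero>"
  using group.int_pow_one[OF a_group, of k] by (simp add: add_pow_def)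

lemma zmul_minus: "\<lbrakk>x \<in> carrier G; y \<in> carrier G\<rbrakk> \<Longrightarrow> [(k::int)] \<cdot> (x \<ominus> y) = [k] \<cdot> x \<ominus> [k] \<cdot> y"
  using zmul_add[of x "\<ominus> y"] group.int_pow_inv[OF a_group, of y k] 
  by (simp add: add_pow_def a_minus_def a_inv_def)

lemma zmul_int: "[int k] \<cdot> x = [k] \<cdot> x"
  by (simp add: add_pow_def int_pow_int)

lemma add_minus_cancel: "\<lbrakk>x \<in> carrier G; y \<in> carrier G\<rbrakk> \<Longrightarrow> (x \<ominus> y) \<oplus> y = x"
  by (simp add: a_minus_def a_assoc l_neg)

lemma minus_eq_iff: "\<lbrakk>x \<in> carrier G; y \<in> carrier G; z \<in> carrier G\<rbrakk> \<Longrightarrow> x \<ominus> y = z \<longleftrightarrow> x = z \<oplus> y"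
  by (metis add_minus_cancel a_minus_def add.inv_solve_right)

lemma minus_eq_zero_iff: "\<lbrakk>x \<in> carrier G; y \<in> carrier G\<rbrakk> \<Longrightarrow> x \<ominus> y = \<zero> \<longleftrightarrow> x = y"
  by (simp add: minus_eq_iff)

lemma add_minus_self: "\<lbrakk>x \<in> carrier G; y \<in> carrier G\<rbrakk> \<Longrightarrow> (x \<oplus> y) \<ominus> x = y"
  by (simp add: minus_eq_iff a_comm)

lemma minus_zero [simp]: "x \<in> carrier G \<Longrightarrow> x \<ominus> \<zero> = x"
  by (simp add: minus_eq_iff)

lemma minus_self [simp]: "x \<in> carrier G \<Longrightarrow> x \<ominus> x = \<zero>"
  by (simp add: minus_eq_zero_iff)

end

lemma (in module_over) smult_zmul: 
  "\<lbrakk>r \<in> carrier R; x \<in> carrier M\<rbrakk> \<Longrightarrow> r \<odot>\<^bsub>M\<^esub> ([(k::int)] \<cdot>\<^bsub>M\<^esub> x) = [k] \<cdot>\<^bsub>M\<^esub> (r \<odot>\<^bsub>M\<^esub> x)"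
  by (rule linear_maps_add_pow[OF module_axioms module_axioms smult_linear])

lemma (in module_over) regular_linear: "x \<in> carrier M \<Longrightarrow> (\<lambda>r. r \<odot>\<^bsub>M\<^esub> x) \<in> hom (add_monoid R) (add_monoid M)"
  by (auto simp: hom_def smult_l_distr)

lemma (in module_over) zmul_smult: 
  assumes "r \<in> carrier R" "x \<in> carrier M"
  shows "([(k::int)] \<cdot>\<^bsub>R\<^esub> r) \<odot>\<^bsub>M\<^esub> x = [k] \<cdot>\<^bsub>M\<^esub> (r \<odot>\<^bsub>M\<^esub> x)"
  using hom_int_pow[OF regular_linear[OF assms(2)], of r k] assms R.a_group M.a_group
  by (simp add: add_pow_def)

lemma (in module_over) submodule_zmul:
  assumes N: "submodule N R M" and "x \<in> N"
  shows "[(k::int)] \<cdot>\<^bsub>M\<^esub> x \<in> N"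
proof -
  have x: "x \<in> carrier M" using submoduleE(1)[OF N] assms(2) by blast
  have "([k] \<cdot>\<^bsub>R\<^esub> \<one>\<^bsub>R\<^esub>) \<odot>\<^bsub>M\<^esub> x \<in> N"
    using submoduleE(4)[OF N] assms(2) by (simp add: R.zmul_closed)
  thus ?thesis using x by (simp add: zmul_smult)
qed

lemma (in module_over) submoduleI_closed:
  assumes "H \<subseteq> carrier M" "\<zero>\<^bsub>M\<^esub> \<in> H"
    and "\<And>a b. \<lbrakk>a \<in> H; b \<in> H\<rbrakk> \<Longrightarrow> a \<oplus>\<^bsub>M\<^esub> b \<in> H"
    and sm: "\<And>a x. \<lbrakk>a \<in> carrier R; x \<in> H\<rbrakk> \<Longrightarrow> a \<odot>\<^bsub>M\<^esub> x \<in> H"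
  shows "submodule H R M"
proof (rule submoduleI)
  fix a assume a: "a \<in> H"
  hence "\<ominus>\<^bsub>M\<^esub> a = (\<ominus>\<^bsub>R\<^esub> \<one>\<^bsub>R\<^esub>) \<odot>\<^bsub>M\<^esub> a" using assms(1) by (auto simp: smult_l_minus)
  thus "\<ominus>\<^bsub>M\<^esub> a \<in> H" using sm[of "\<ominus>\<^bsub>R\<^esub> \<one>\<^bsub>R\<^esub>" a] a by simp
qed (use assms in auto)

lemma (in module_over) submodule_minus:
  "\<lbrakk>submodule N R M; x \<in> N; y \<in> N\<rbrakk> \<Longrightarrow> x \<ominus>\<^bsub>M\<^esub> y \<in> N"
  unfolding a_minus_def using submoduleE(3,5) by blast

lemma (in module_over) submodule_zero: "submodule N R M \<Longrightarrow> \<zero>\<^bsub>M\<^esub> \<in> N"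
  using submoduleE(2)[of N] submodule_minus[of N] submoduleE(1)[of N] M.minus_self by (metis all_not_in_conv subsetD)

lemma (in module_over) submodule_finsum:
  assumes N: "submodule N R M" and "finite A" "f \<in> A \<rightarrow> N"
  shows "(\<Oplus>\<^bsub>M\<^esub>i\<in>A. f i) \<in> N"
  using assms(2,3)
proof (induction A rule: finite_induct)
  case empty show ?case by (simp add: submodule_zero[OF N])
next
  case (insert a A)
  hence "f \<in> A \<rightarrow> carrier M" "f a \<in> carrier M" using submoduleE(1)[OF N] by auto
  thus ?case using insert submoduleE(5)[OF N] by (simp add: M.finsum_insert)
qed

section \<open>The action of \<open>\<int>[\<T>]\<close> on a module with an endomorphism\<close>

locale endo_module = module_over R M for R :: "('r, 'a) ring_scheme" and M :: "('r, 'm) module" (structure) +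
  fixes s :: "'m \<Rightarrow> 'm"
  assumes s_linear: "s \<in> linear_maps R M M"
begin

lemmas s_closed [simp, intro] = linear_mapsD(1)[OF s_linear]
lemmas s_add = linear_mapsD(2)[OF s_linear]
lemmas s_smult = linear_mapsD(3)[OF s_linear]
lemmas s_zmul = linear_maps_add_pow[OF module_axioms module_axioms s_linear]
lemmas s_zero [simp] = linear_maps_zero[OF module_axioms module_axioms s_linear]

definition poly_act :: "int poly \<Rightarrow> 'm \<Rightarrow> 'm" (infixr "\<star>" 75)
  where "f \<star> m = fold_coeffs (\<lambda>a y. [a] \<cdot> m \<oplus> s y) f \<zero>"

lemma poly_act_0 [simp]: "0 \<star> m = \<zero>" by (simp add: poly_act_def)

lemma poly_act_pCons: "m \<in> carrier M \<Longrightarrow> pCons a f \<star> m = [a] \<cdot> m \<oplus> s (f \<star> m)"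
  by (cases "f = 0"; cases "a = 0") (auto simp: poly_act_def)

lemma poly_act_closed [simp, intro]: "m \<in> carrier M \<Longrightarrow> f \<star> m \<in> carrier M"
  by (induction f) (auto simp: poly_act_pCons)

lemma poly_act_plus: "m \<in> carrier M \<Longrightarrow> (f + g) \<star> m = f \<star> m \<oplus> g \<star> m"
proof (induction f g rule: poly_induct2)
  case (pCons a f b g)
  thus ?case by (simp add: poly_act_pCons M.zmul_plus s_add M.a_ac)
qed simp

lemma poly_act_smult: "m \<in> carrier M \<Longrightarrow> Polynomial.smult a f \<star> m = [a] \<cdot> (f \<star> m)"
  by (induction f) (auto simp: poly_act_pCons M.zmul_add M.zmul_mult s_zmul)

lemma poly_act_mult: "m \<in> carrier M \<Longrightarrow> (f * g) \<star> m = f \<star> g \<star> m"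
  by (induction f) (auto simp: poly_act_pCons poly_act_plus poly_act_smult)

lemma poly_act_linear: "poly_act f \<in> linear_maps R M M"
proof -
  have "f \<star> (x \<oplus> y) = f \<star> x \<oplus> f \<star> y" if "x \<in> carrier M" "y \<in> carrier M" for x y
    using that by (induction f) (auto simp: poly_act_pCons M.zmul_add s_add M.a_ac)
  moreover have "f \<star> (r \<odot> x) = r \<odot> f \<star> x" if "x \<in> carrier M" "r \<in> carrier R" for x r
    using that by (induction f) (auto simp: poly_act_pCons smult_zmul s_smult smult_r_distr)
  ultimately show ?thesis by (auto simp: linear_maps_def)
qed

lemmas poly_act_add = linear_mapsD(2)[OF poly_act_linear]
lemmas poly_act_scalar = linear_mapsD(3)[OF poly_act_linear]
lemmas poly_act_zmul = linear_maps_add_pow[OF module_axioms module_axioms poly_act_linear]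
lemmas poly_act_zero [simp] = linear_maps_zero[OF module_axioms module_axioms poly_act_linear]
lemmas poly_act_minus = linear_maps_minus[OF module_axioms module_axioms poly_act_linear]

lemma poly_act_of_int: "m \<in> carrier M \<Longrightarrow> of_int k \<star> m = [k] \<cdot> m"
  by (simp add: of_int_poly poly_act_pCons)

lemma poly_act_of_nat: "m \<in> carrier M \<Longrightarrow> of_nat k \<star> m = [int k] \<cdot> m"
  using poly_act_of_int[of m "int k"] by simp

lemma poly_act_1 [simp]: "m \<in> carrier M \<Longrightarrow> 1 \<star> m = m"
  using poly_act_of_int[of m 1] by simp

lemma poly_act_T: "m \<in> carrier M \<Longrightarrow> \<T> \<star> m = s m"
  by (simp add: polyT_def poly_act_pCons)

lemma s_pow_closed [simp, intro]: "m \<in> carrier M \<Longrightarrow> (s ^^ k) m \<in> carrier M"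
  by (induction k) auto

lemma poly_act_T_power: "m \<in> carrier M \<Longrightarrow> \<T> ^ k \<star> m = (s ^^ k) m"
  by (induction k) (auto simp: poly_act_mult poly_act_T)

lemma poly_act_diff: "m \<in> carrier M \<Longrightarrow> (f - g) \<star> m = f \<star> m \<ominus> g \<star> m"
  using poly_act_plus[of m "f - g" g]
  by (metis M.minus_eq_iff diff_add_cancel poly_act_closed)

lemma poly_act_X: "m \<in> carrier M \<Longrightarrow> \<X> \<star> m = s m \<ominus> m"
  by (simp add: polyX_def poly_act_diff poly_act_T)

lemma poly_act_comm: "m \<in> carrier M \<Longrightarrow> f \<star> g \<star> m = g \<star> f \<star> m"
  by (simp flip: poly_act_mult add: mult.commute)

lemma poly_act_sum: 
  assumes "m \<in> carrier M" "finite A"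
  shows "(\<Sum>i\<in>A. f i) \<star> m = (\<Oplus>i\<in>A. f i \<star> m)"
  using assms(2,1)
proof (induction A rule: finite_induct)
  case (insert a A) 
  hence "(\<lambda>i. f i \<star> m) \<in> A \<rightarrow> carrier M" by auto
  thus ?case using insert by (simp add: M.finsum_insert poly_act_plus)
qed simp

text \<open>
  The \<open>R[\<T>]\<close>-submodules of \<open>M\<close>.
\<close>

definition stable :: "'m set \<Rightarrow> bool" where
  "stable N \<longleftrightarrow> submodule N R M \<and> (\<forall>x\<in>N. s x \<in> N)"

lemma stable_poly_act: 
  assumes N: "stable N" and x: "x \<in> N" shows "f \<star> x \<in> N"
proof -
  have sub: "submodule N R M" and st: "\<And>x. x \<in> N \<Longrightarrow> s x \<in> N" using N by (auto simp: stable_def)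
  have "x \<in> carrier M" using submoduleE(1)[OF sub] x by blast
  thus ?thesis
    using x by (induction f) (auto simp: poly_act_pCons submodule_zero[OF sub] intro!: submoduleE(5)[OF sub] submodule_zmul[OF sub] st)
qed

end

section \<open>Congruence modulo \<open>p\<close>\<close>

locale p_endo_module = endo_module R M s for R :: "('r, 'a) ring_scheme" and M :: "('r, 'm) module" (structure) and s +
  fixes p n :: nat
  assumes prime_p: "Factorial_Ring.prime p"
    and s_order: "m \<in> carrier M \<Longrightarrow> (s ^^ (p ^ n)) m = m"
begin

definition pM :: "'m set" where "pM = (\<lambda>x. [int p] \<cdot> x) ` carrier M"

lemma pM_I [intro]: "x \<in> carrier M \<Longrightarrow> [int p] \<cdot> x \<in> pM" by (auto simp: pM_def)

lemma stable_pM: "stable pM"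
  unfolding stable_def
proof (intro conjI ballI submoduleI_closed)
  show "\<zero> \<in> pM" using pM_I[of \<zero>] by simp
  fix x y assume "x \<in> pM" "y \<in> pM"
  then obtain a b where ab: "a \<in> carrier M" "b \<in> carrier M" "x = [int p] \<cdot> a" "y = [int p] \<cdot> b"
    by (auto simp: pM_def)
  thus "x \<oplus> y \<in> pM" using pM_I[of "a \<oplus> b"] by (simp add: M.zmul_add)
next
  fix r x assume r: "r \<in> carrier R" and "x \<in> pM"
  then obtain a where ab: "a \<in> carrier M" "x = [int p] \<cdot> a" by (auto simp: pM_def)
  thus "r \<odot> x \<in> pM" using pM_I[of "r \<odot> a"] r by (simp add: smult_zmul)
next
  fix x assume "x \<in> pM"
  then obtain a where ab: "a \<in> carrier M" "x = [int p] \<cdot> a" by (auto simp: pM_def)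
  thus "s x \<in> pM" using pM_I[of "s a"] by (simp add: s_zmul)
qed (auto simp: pM_def)

lemma submodule_pM: "submodule pM R M" using stable_pM by (simp add: stable_def)

lemma pM_closed: "x \<in> pM \<Longrightarrow> x \<in> carrier M" by (auto simp: pM_def)

definition congp :: "'m \<Rightarrow> 'm \<Rightarrow> bool" (infix "\<approx>" 50) where
  "x \<approx> y \<longleftrightarrow> x \<in> carrier M \<and> y \<in> carrier M \<and> x \<ominus> y \<in> pM"

lemma congp_closed: "x \<approx> y \<Longrightarrow> x \<in> carrier M" "x \<approx> y \<Longrightarrow> y \<in> carrier M"
  by (auto simp: congp_def)

lemma congp_iff: "x \<approx> y \<longleftrightarrow> y \<in> carrier M \<and> (\<exists>z\<in>carrier M. x = y \<oplus> [int p] \<cdot> z)"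
proof
  assume "x \<approx> y" thus "y \<in> carrier M \<and> (\<exists>z\<in>carrier M. x = y \<oplus> [int p] \<cdot> z)"
    by (auto simp: congp_def pM_def M.minus_eq_iff M.a_comm)
qed (auto simp: congp_def M.add_minus_self)

lemma congp_refl [simp]: "x \<in> carrier M \<Longrightarrow> x \<approx> x"
  by (simp add: congp_def submodule_zero[OF submodule_pM])

lemma congp_trans [trans]: "x \<approx> y \<Longrightarrow> y \<approx> z \<Longrightarrow> x \<approx> z"
proof -
  assume xy: "x \<approx> y" and yz: "y \<approx> z"
  obtain a b where "y \<in> carrier M" "z \<in> carrier M" "a \<in> carrier M" "b \<in> carrier M"
    "x = y \<oplus> [int p] \<cdot> a" "y = z \<oplus> [int p] \<cdot> b" using xy yz by (auto simp: congp_iff)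
  hence "x = z \<oplus> [int p] \<cdot> (b \<oplus> a)" by (simp add: M.zmul_add M.a_assoc)
  thus "x \<approx> z" using \<open>z \<in> carrier M\<close> \<open>a \<in> carrier M\<close> \<open>b \<in> carrier M\<close> unfolding congp_iff by blast
qed

lemma congp_sym: "x \<approx> y \<Longrightarrow> y \<approx> x"
  using submoduleE(3)[OF submodule_pM, of "x \<ominus> y"]
  by (auto simp: congp_def a_minus_def M.minus_add M.a_comm)

lemma congp_linear:
  assumes "x \<approx> y" "f \<in> linear_maps R M M" shows "f x \<approx> f y"
proof -
  obtain z where z: "y \<in> carrier M" "z \<in> carrier M" "x = y \<oplus> [int p] \<cdot> z" using assms(1) by (auto simp: congp_iff)
  have "f x = f y \<oplus> [int p] \<cdot> f z" 
    using z linear_mapsD[OF assms(2)] linear_maps_add_pow[OF module_axioms module_axioms assms(2)] by simp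
  thus ?thesis using z linear_mapsD(1)[OF assms(2)] unfolding congp_iff by blast
qed

lemmas congp_poly_act = congp_linear[OF _ poly_act_linear]
lemmas congp_smult = congp_linear[OF _ smult_linear]

lemma congp_add: assumes "x \<approx> y" "x' \<approx> y'" shows "x \<oplus> x' \<approx> y \<oplus> y'"
proof -
  obtain a b where ab: "y \<in> carrier M" "y' \<in> carrier M" "a \<in> carrier M" "b \<in> carrier M"
    "x = y \<oplus> [int p] \<cdot> a" "x' = y' \<oplus> [int p] \<cdot> b" using assms by (auto simp: congp_iff)
  hence "x \<oplus> x' = (y \<oplus> y') \<oplus> [int p] \<cdot> (a \<oplus> b)" by (simp add: M.zmul_add M.a_ac)
  thus ?thesis using ab unfolding congp_iff by blast
qed

lemma congp_uminus: "x \<approx> y \<Longrightarrow> \<ominus> x \<approx> \<ominus> y"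
proof -
  assume xy: "x \<approx> y"
  have "(- 1) \<star> m = \<ominus> m" if "m \<in> carrier M" for m
  proof -
    have "(0 - 1) \<star> m = 0 \<star> m \<ominus> 1 \<star> m" by (rule poly_act_diff[OF that])
    also have "\<dots> = \<ominus> m" using that by (simp only: poly_act_0 poly_act_1 a_minus_def M.a_inv_closed M.l_zero)
    finally show ?thesis by (simp only: diff_0)
  qed
  thus ?thesis using congp_poly_act[OF xy, of "- 1"] congp_closed[OF xy] by (simp only:)
qed

lemma congp_minus: "x \<approx> y \<Longrightarrow> x' \<approx> y' \<Longrightarrow> x \<ominus> x' \<approx> y \<ominus> y'"
  unfolding a_minus_def by (intro congp_add congp_uminus)

lemma congp_zero_iff: "x \<approx> \<zero> \<longleftrightarrow> x \<in> pM"
  using pM_closed[of x]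
  by (auto simp: congp_def)

lemma congp_poly: 
  assumes "of_nat p dvd f - g" "m \<in> carrier M" shows "f \<star> m \<approx> g \<star> m"
proof -
  obtain h where "f - g = of_nat p * h" using assms(1) by (auto simp: dvd_def)
  hence "f = g + of_nat p * h" by (simp add: algebra_simps)
  hence "f \<star> m = g \<star> m \<oplus> [int p] \<cdot> (h \<star> m)" using assms(2) by (simp add: poly_act_plus poly_act_mult poly_act_of_nat)
  thus ?thesis using assms(2) unfolding congp_iff by blast
qed

lemma congp_finsum:
  assumes "finite A" "\<And>i. i \<in> A \<Longrightarrow> f i \<approx> g i"
  shows "(\<Oplus>i\<in>A. f i) \<approx> (\<Oplus>i\<in>A. g i)"
  using assms
proof (induction A rule: finite_induct)
  case (insert a A)
  have "f \<in> A \<rightarrow> carrier M" "g \<in> A \<rightarrow> carrier M" "f a \<in> carrier M" "g a \<in> carrier M"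
    using congp_closed[OF insert.prems] by (simp_all add: Pi_iff)
  hence "(\<Oplus>i\<in>insert a A. f i) = f a \<oplus> (\<Oplus>i\<in>A. f i)" "(\<Oplus>i\<in>insert a A. g i) = g a \<oplus> (\<Oplus>i\<in>A. g i)"
    using insert.hyps by (simp_all add: M.finsum_insert)
  moreover have "(\<Oplus>i\<in>A. f i) \<approx> (\<Oplus>i\<in>A. g i)" "f a \<approx> g a" using insert.IH insert.prems by blast+
  ultimately show ?case using congp_add by simp
qed simp

text \<open>
  In the application \<open>s ^^ (p ^ j)\<close> is a generator of the subgroup of index \<open>p ^ j\<close>, and \<open>Fix j\<close> is the
  module of its fixed points. The defining equation is stated with an operator \<open>tau j\<close> in order to
  compute with polynomials.
\<close>

definition tau :: "nat \<Rightarrow> int poly" where "tau j = \<T> ^ (p ^ j) - 1"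
definition Fix :: "nat \<Rightarrow> 'm set" where "Fix j = {m \<in> carrier M. tau j \<star> m = \<zero>}"

lemma Fix_iff: "m \<in> Fix j \<longleftrightarrow> m \<in> carrier M \<and> (s ^^ (p ^ j)) m = m"
proof (cases "m \<in> carrier M")
  case True
  hence "tau j \<star> m = (s ^^ (p ^ j)) m \<ominus> m"
    unfolding tau_def by (simp only: poly_act_diff poly_act_T_power poly_act_1)
  thus ?thesis unfolding Fix_def using True M.minus_eq_zero_iff[of "(s ^^ (p ^ j)) m" m] by simp
qed (simp add: Fix_def)

lemma Fix_closed: "m \<in> Fix j \<Longrightarrow> m \<in> carrier M" by (simp add: Fix_def)
lemma tau_Fix: "m \<in> Fix j \<Longrightarrow> tau j \<star> m = \<zero>" by (simp add: Fix_def)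
lemma Fix_n: "Fix n = carrier M" by (auto simp: Fix_iff s_order)
lemma tau_n [simp]: "m \<in> carrier M \<Longrightarrow> tau n \<star> m = \<zero>"
  using tau_Fix[of m n] unfolding Fix_n by simp

lemma stable_Fix: "stable (Fix j)"
  unfolding stable_def
proof (intro conjI ballI submoduleI_closed)
  fix x assume "x \<in> Fix j"
  thus "s x \<in> Fix j" using poly_act_comm[of x "tau j" \<T>] by (simp add: Fix_def poly_act_T)
qed (auto simp: Fix_def poly_act_add poly_act_scalar)

lemma submodule_Fix: "submodule (Fix j) R M" using stable_Fix by (simp add: stable_def)

lemma tau_eq: "\<exists>a. tau j = \<X> ^ (p ^ j) + of_nat p * a"
proof -
  obtain a where "tau j - \<X> ^ (p ^ j) = of_nat p * a"
    using frobenius_poly[OF prime_p, of j] unfolding tau_def by (rule dvdE)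
  thus ?thesis by (intro exI[of _ a]) (simp add: algebra_simps)
qed

lemma tau_congp: "m \<in> carrier M \<Longrightarrow> tau j \<star> m \<approx> \<X> ^ (p ^ j) \<star> m"
  unfolding tau_def by (rule congp_poly[OF frobenius_poly[OF prime_p]])

lemma tau_norm: "tau (j + k) = norm_poly (p ^ j) (p ^ k) * tau j"
  using norm_poly_mult[of "p ^ j" "p ^ k"] by (simp add: tau_def power_add mult.commute)

lemma Fix_mono: assumes "j \<le> k" shows "Fix j \<subseteq> Fix k"
  using assms tau_norm[of j "k - j"] by (auto simp: Fix_def poly_act_mult)

lemma X_nilpotent: "m \<in> carrier M \<Longrightarrow> \<X> ^ (p ^ n) \<star> m \<approx> \<zero>"
  using congp_sym[OF tau_congp[of m n]] by simp

lemma X_power_Fix: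
  assumes "m \<in> Fix j" "p ^ j \<le> k" shows "\<X> ^ k \<star> m \<approx> \<zero>"
proof -
  have m: "m \<in> carrier M" using assms(1) by (rule Fix_closed)
  have "\<X> ^ k = \<X> ^ (k - p ^ j) * \<X> ^ (p ^ j)" using assms(2) by (simp flip: power_add)
  hence "\<X> ^ k \<star> m = \<X> ^ (k - p ^ j) \<star> \<X> ^ (p ^ j) \<star> m" using m by (simp add: poly_act_mult)
  also have "\<dots> \<approx> \<X> ^ (k - p ^ j) \<star> tau j \<star> m"
    using m by (intro congp_poly_act congp_sym[OF tau_congp]) simp
  finally show ?thesis using assms(1) by (simp add: tau_Fix)
qed

lemma Tr_congp: "m \<in> carrier M \<Longrightarrow> Tr_poly (p ^ j) \<star> m \<approx> \<X> ^ (p ^ j - 1) \<star> m"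
  using Tr_poly_prime_power[OF prime_p, of j] by (intro congp_poly) auto

text \<open>
  If \<open>x\<close> is in \<open>K\<close> but not in \<open>pM\<close>, then so is the last \<open>\<X> ^ k \<star> x\<close> that is not in \<open>pM\<close>, since \<open>\<X>\<close> is
  nilpotent modulo \<open>p\<close>; and that element is fixed modulo \<open>p\<close>. Thus a stable submodule that meets the
  socle of \<open>M/pM\<close> trivially vanishes in \<open>M/pM\<close>.
\<close>

lemma stable_in_pM:
  assumes K: "stable K" and soc: "\<And>x. x \<in> K \<Longrightarrow> s x \<approx> x \<Longrightarrow> x \<in> pM"
  shows "K \<subseteq> pM"
proof
  have cl: "x \<in> carrier M" if "x \<in> K" for x using K that submoduleE(1) by (auto simp: stable_def)
  have "x \<in> K \<Longrightarrow> \<X> ^ k \<star> x \<approx> \<zero> \<Longrightarrow> x \<in> pM" for x k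
  proof (induction k)
    case 0 thus ?case using cl by (simp add: congp_zero_iff)
  next
    case (Suc k)
    define y where "y = \<X> ^ k \<star> x"
    have y: "y \<in> K" unfolding y_def using K Suc.prems by (intro stable_poly_act)
    have "\<X> \<star> y \<approx> \<zero>" using Suc.prems cl by (simp add: y_def poly_act_mult)
    hence "s y \<ominus> y \<in> pM" using y cl by (simp add: poly_act_X congp_zero_iff)
    hence "s y \<approx> y" using y cl by (simp add: congp_def)
    hence "y \<approx> \<zero>" using soc[OF y] by (simp add: congp_zero_iff)
    thus ?case using Suc unfolding y_def by blast
  qed
  thus "x \<in> pM" if "x \<in> K" for x using that X_nilpotent[OF cl[OF that]] by blast
qed

end

section \<open>Lattices with vanishing first cohomology\<close>

definition generated_by :: "('r, 'a) ring_scheme \<Rightarrow> ('r, 'm) module \<Rightarrow> 'm set \<Rightarrow> 'm set \<Rightarrow> bool" where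
  "generated_by R M N A \<longleftrightarrow> finite A \<and> A \<subseteq> N \<and>
     (\<forall>x\<in>N. \<exists>a\<in>A \<rightarrow> carrier R. x = (\<Oplus>\<^bsub>M\<^esub>i\<in>A. a i \<odot>\<^bsub>M\<^esub> i))"

lemma (in module_over) generated_by_subset:
  assumes "generated_by R M N A" "submodule L R M" "A \<subseteq> L" shows "N \<subseteq> L"
proof
  fix x assume "x \<in> N"
  then obtain a where a: "a \<in> A \<rightarrow> carrier R" "x = (\<Oplus>i\<in>A. a i \<odot> i)"
    using assms(1) by (auto simp: generated_by_def)
  show "x \<in> L" unfolding a(2)
    using assms a(1) submoduleE(4)[OF assms(2)] by (intro submodule_finsum) (auto simp: generated_by_def)
qed

text \<open>
  The properties of \<open>M\<close> and \<open>R\<close> on which the construction of the basis rests. For a cyclic group the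
  first cohomology is the kernel of the norm modulo the image of a generator minus one, so
  \<open>hilbert90\<close> says that \<open>H\<^sup>1\<close> vanishes for the subgroup generated by \<open>s ^^ (p ^ j)\<close>. The ring \<open>R\<close> is local
  with maximal ideal \<open>pR\<close>, and \<open>p\<close>-adically separated.
\<close>

locale h90_lattice = p_endo_module R M s p n for R :: "('r, 'a) ring_scheme" and M :: "('r, 'm) module" (structure) and s p n +
  assumes torsion_free: "\<lbrakk>x \<in> carrier M; [int p] \<cdot> x = \<zero>\<rbrakk> \<Longrightarrow> x = \<zero>"
    and one_minus_unit: "a \<in> carrier R \<Longrightarrow> \<one>\<^bsub>R\<^esub> \<ominus>\<^bsub>R\<^esub> [int p] \<cdot>\<^bsub>R\<^esub> a \<in> Units R"
    and Fix_fg: "j \<le> n \<Longrightarrow> \<exists>A. generated_by R M (Fix j) A"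
    and hilbert90: "\<lbrakk>j \<le> n; m \<in> carrier M; norm_poly (p ^ j) (p ^ (n - j)) \<star> m = \<zero>\<rbrakk>
        \<Longrightarrow> \<exists>m'\<in>carrier M. m = tau j \<star> m'"
    and unit_or_p: "r \<in> carrier R \<Longrightarrow> r \<in> Units R \<or> (\<exists>c\<in>carrier R. r = [int p] \<cdot>\<^bsub>R\<^esub> c)"
    and p_separated: "\<lbrakk>r \<in> carrier R; \<And>k. \<exists>c\<in>carrier R. r = [(int p ^ k)] \<cdot>\<^bsub>R\<^esub> c\<rbrakk> \<Longrightarrow> r = \<zero>\<^bsub>R\<^esub>"
    and nontrivial: "\<one>\<^bsub>R\<^esub> \<noteq> \<zero>\<^bsub>R\<^esub>"
begin

lemma Fix_pure: "\<lbrakk>x \<in> carrier M; [int p] \<cdot> x \<in> Fix j\<rbrakk> \<Longrightarrow> x \<in> Fix j"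
  using torsion_free[of "tau j \<star> x"] by (auto simp: Fix_def poly_act_zmul)

text \<open>
  Nakayama's lemma, by induction on the number of generators. Let \<open>K\<close> contain \<open>N\<close> and all generators
  but \<open>b\<close>. Then \<open>L\<close> lies in \<open>K + R b\<close>, so \<open>b = t + p (k + r b)\<close> with \<open>t\<close> and \<open>k\<close> in \<open>K\<close>; as \<open>1 - p r\<close> is a unit, \<open>b\<close>
  is in \<open>K\<close>.
\<close>

lemma nakayama:
  assumes N: "submodule N R M" and L: "submodule L R M" and gen: "generated_by R M L A" 
    and LN: "\<And>m. m \<in> L \<Longrightarrow> \<exists>x\<in>N. \<exists>y\<in>L. m = x \<oplus> [int p] \<cdot> y"
  shows "L \<subseteq> N"
proof -
  have Lc: "x \<in> L \<Longrightarrow> x \<in> carrier M" for x using submoduleE(1)[OF L] by blast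
  have main: "L \<subseteq> N"
    if "finite A" "A \<subseteq> L" "\<And>K. \<lbrakk>submodule K R M; N \<subseteq> K; A \<subseteq> K\<rbrakk> \<Longrightarrow> L \<subseteq> K" for A
    using that
  proof (induction A rule: finite_induct)
    case empty
    thus ?case using N by blast
  next
    case (insert b A)
    have b: "b \<in> L" "b \<in> carrier M" using insert.prems Lc by auto
    have "L \<subseteq> K" if K: "submodule K R M" "N \<subseteq> K" "A \<subseteq> K" for K
    proof -
      note Kc = subsetD[OF submoduleE(1)[OF K(1)]]
      define K' where "K' = {k \<oplus> r \<odot> b |k r. k \<in> K \<and> r \<in> carrier R}"
      have K'I: "k \<oplus> r \<odot> b \<in> K'" if "k \<in> K" "r \<in> carrier R" for k r
        using that by (auto simp: K'_def)
      have KK': "K \<subseteq> K'"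
      proof
        fix k assume "k \<in> K"
        thus "k \<in> K'" using K'I[of k "\<zero>\<^bsub>R\<^esub>"] b Kc by simp
      qed
      have bK': "b \<in> K'" using K'I[of \<zero> "\<one>\<^bsub>R\<^esub>"] b submodule_zero[OF K(1)] by simp
      have sub: "submodule K' R M"
      proof (rule submoduleI_closed)
        show "K' \<subseteq> carrier M" using b Kc by (auto simp: K'_def)
        show "\<zero> \<in> K'" using KK' submodule_zero[OF K(1)] by blast
      next
        fix x y assume "x \<in> K'" "y \<in> K'"
        then obtain k r l q where *: "k \<in> K" "r \<in> carrier R" "x = k \<oplus> r \<odot> b"
          "l \<in> K" "q \<in> carrier R" "y = l \<oplus> q \<odot> b" unfolding K'_def by blast
        hence "x \<oplus> y = (k \<oplus> l) \<oplus> (r \<oplus>\<^bsub>R\<^esub> q) \<odot> b"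
          using b Kc by (simp add: smult_l_distr M.a_ac)
        thus "x \<oplus> y \<in> K'" using K'I[of "k \<oplus> l" "r \<oplus>\<^bsub>R\<^esub> q"] * submoduleE(5)[OF K(1)] by simp
      next
        fix q x assume q: "q \<in> carrier R" and "x \<in> K'"
        then obtain k r where *: "k \<in> K" "r \<in> carrier R" "x = k \<oplus> r \<odot> b" unfolding K'_def by blast
        hence "q \<odot> x = q \<odot> k \<oplus> (q \<otimes>\<^bsub>R\<^esub> r) \<odot> b"
          using b Kc q by (simp add: smult_r_distr smult_assoc1)
        thus "q \<odot> x \<in> K'" using K'I[of "q \<odot> k" "q \<otimes>\<^bsub>R\<^esub> r"] * q submoduleE(4)[OF K(1)] by simp
      qed
      obtain t y where t: "t \<in> N" "y \<in> L" "b = t \<oplus> [int p] \<cdot> y" using LN[OF b(1)] by blast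
      have "L \<subseteq> K'" using insert.prems(2)[OF sub] K KK' bK' by blast
      then obtain k r where k: "k \<in> K" "r \<in> carrier R" "y = k \<oplus> r \<odot> b"
        using t(2) unfolding K'_def by blast
      have tK: "t \<in> K" using t K by blast
      define u where "u = \<one>\<^bsub>R\<^esub> \<ominus>\<^bsub>R\<^esub> [int p] \<cdot>\<^bsub>R\<^esub> r"
      have u: "u \<in> Units R" "u \<in> carrier R" unfolding u_def using one_minus_unit[OF k(2)] by auto
      have beq: "b = (t \<oplus> [int p] \<cdot> k) \<oplus> [int p] \<cdot> (r \<odot> b)"
        using t(3) k b tK Kc by (simp add: M.zmul_add M.a_assoc)
      have "u \<odot> b = b \<ominus> [int p] \<cdot> (r \<odot> b)"
        unfolding u_def a_minus_def using k b by (simp add: smult_l_distr smult_l_minus zmul_smult R.zmul_closed)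
      also have "\<dots> = t \<oplus> [int p] \<cdot> k"
        using beq k b tK Kc by (subst M.minus_eq_iff) simp_all
      finally have "u \<odot> b \<in> K" using tK k submodule_zmul[OF K(1)] submoduleE(5)[OF K(1)] by simp
      hence "inv\<^bsub>R\<^esub> u \<odot> (u \<odot> b) \<in> K" using u submoduleE(4)[OF K(1)] by simp
      moreover have "inv\<^bsub>R\<^esub> u \<odot> (u \<odot> b) = b" using u b by (simp flip: smult_assoc1)
      ultimately have "b \<in> K" by simp
      thus ?thesis using insert.prems(2)[OF K(1,2)] K(3) by blast
    qed
    thus ?case using insert.IH insert.prems(1) by blast
  qed
  show ?thesis
    using main[of A] gen generated_by_subset[OF gen] by (auto simp: generated_by_def)
qed


section \<open>Jordan blocks modulo \<open>p\<close>\<close>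

text \<open>
  The long exact sequence of \<open>0 \<rightarrow> M \<rightarrow> M \<rightarrow> M/pM \<rightarrow> 0\<close> in concrete terms: \<open>tau j \<star> m = p m'\<close> makes the
  norm of \<open>m'\<close> vanish, so \<open>m' = tau j \<star> m''\<close>, and \<open>m - p m''\<close> is the required fixed point.
\<close>

lemma Fix_lift:
  assumes j: "j \<le> n" and m: "m \<in> carrier M" "tau j \<star> m \<approx> \<zero>"
  shows "\<exists>m1\<in>Fix j. m \<approx> m1"
proof -
  obtain m' where m': "m' \<in> carrier M" "tau j \<star> m = [int p] \<cdot> m'"
    using m(2) by (auto simp: congp_zero_iff pM_def)
  let ?N = "norm_poly (p ^ j) (p ^ (n - j))"
  have "[int p] \<cdot> (?N \<star> m') = ?N \<star> tau j \<star> m" using m' by (simp add: poly_act_zmul)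
  also have "\<dots> = tau n \<star> m" using tau_norm[of j "n - j"] j m by (simp flip: poly_act_mult)
  also have "\<dots> = \<zero>" using m by simp
  finally have "?N \<star> m' = \<zero>" by (rule torsion_free[OF poly_act_closed[OF m'(1)]])
  then obtain m'' where m'': "m'' \<in> carrier M" "m' = tau j \<star> m''" using hilbert90[OF j m'(1)] by blast
  define m1 where "m1 = m \<ominus> [int p] \<cdot> m''"
  have "tau j \<star> m1 = \<zero>" using m m' m'' by (simp add: m1_def poly_act_minus poly_act_zmul)
  moreover have c: "m1 \<in> carrier M" using m m'' by (simp add: m1_def)
  moreover have "m = m1 \<oplus> [int p] \<cdot> m''" using m m'' by (simp add: m1_def M.add_minus_cancel)
  ultimately show ?thesis using m'' by (auto simp: Fix_def congp_iff)
qed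

lemma Fix_lift_X:
  assumes "j \<le> n" "m \<in> carrier M" "\<X> ^ (p ^ j) \<star> m \<approx> \<zero>"
  shows "\<exists>m1\<in>Fix j. m \<approx> m1"
  using Fix_lift[OF assms(1,2)] congp_trans[OF tau_congp[OF assms(2)] assms(3)] by blast

text \<open>
  The transfer from \<open>Fix (j + 1)\<close> to \<open>Fix j\<close>, and at the same time the cyclotomic polynomial of order
  \<open>p ^ (j + 1)\<close>; it annihilates \<open>Fix (j + 1) / Fix j\<close>.
\<close>

abbreviation nu :: "nat \<Rightarrow> int poly" where "nu j \<equiv> norm_poly (p ^ j) p"

lemma tau_Suc: "tau (Suc j) = nu j * tau j"
  using tau_norm[of j 1] by simp

lemma nu_Fix: assumes "m \<in> Fix (Suc j)" shows "nu j \<star> m \<in> Fix j"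
proof -
  have m: "m \<in> carrier M" using assms by (rule Fix_closed)
  have "tau j \<star> nu j \<star> m = tau (Suc j) \<star> m"
    using m by (simp add: tau_Suc mult.commute flip: poly_act_mult)
  thus ?thesis using m tau_Fix[OF assms] by (simp add: Fix_def)
qed

text \<open>
  \<open>\<X>\<close> is injective on \<open>Fix (j + 1) / Fix j\<close>: there the image of \<open>nu j\<close> is zero, while on the kernel of \<open>\<X>\<close>
  it is multiplication by \<open>nu j\<close> at \<open>\<T> = 1\<close>, which is \<open>p\<close>.
\<close>

lemma X_injective:
  assumes d: "d \<in> Fix (Suc j)" and Xd: "\<X> \<star> d \<in> Fix j"
  shows "d \<in> Fix j"
proof -
  have dc: "d \<in> carrier M" using d by (rule Fix_closed)
  define e where "e = tau j \<star> d"
  have e: "e \<in> carrier M" using dc by (simp add: e_def)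
  have Xe: "\<X> \<star> e = \<zero>" using tau_Fix[OF Xd] poly_act_comm[OF dc, of \<X> "tau j"] by (simp add: e_def)
  have "poly (nu j - of_nat p) 1 = 0" by (simp add: norm_poly_def poly_sum)
  then obtain h where h: "nu j - of_nat p = \<X> * h"
    unfolding poly_eq_0_iff_dvd dvd_def X_pCons by auto
  hence "nu j = h * \<X> + of_nat p" by (simp add: algebra_simps)
  hence "nu j \<star> e = [int p] \<cdot> e" using e Xe by (simp add: poly_act_plus poly_act_mult poly_act_of_nat)
  moreover have "nu j \<star> e = tau (Suc j) \<star> d" using dc by (simp add: e_def tau_Suc poly_act_mult)
  ultimately have "[int p] \<cdot> e = \<zero>" using tau_Fix[OF d] by simp
  hence "e = \<zero>" using e by (rule torsion_free[rotated])
  thus ?thesis using dc by (simp add: Fix_def e_def)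
qed

lemma X_power_injective:
  assumes "d \<in> Fix (Suc j)" "\<X> ^ b \<star> d \<in> Fix j" shows "d \<in> Fix j"
  using assms(2)
proof (induction b)
  case 0 thus ?case using Fix_closed[OF assms(1)] by simp
next
  case (Suc b)
  have "\<X> ^ b \<star> d \<in> Fix (Suc j)" using stable_poly_act[OF stable_Fix assms(1)] .
  moreover have "\<X> \<star> \<X> ^ b \<star> d \<in> Fix j" using Suc.prems Fix_closed[OF assms(1)] by (simp add: poly_act_mult)
  ultimately show ?case using X_injective Suc.IH by blast
qed

text \<open>
  On \<open>Fix (j + 1) / Fix j\<close> the relation \<open>nu j = 0\<close> reads \<open>p (1 + \<X> h) = - \<X> ^ e\<close> with
  \<open>e = p ^ (j + 1) - p ^ j\<close>, and \<open>1 + \<X> h\<close> is surjective by Nakayama's lemma, since \<open>\<X>\<close> is nilpotent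
  modulo \<open>p\<close>.
\<close>

lemma p_multiple_Fix_Suc:
  assumes j: "Suc j \<le> n" and w: "w \<in> Fix (Suc j)"
  shows "\<exists>w1\<in>Fix (Suc j). \<exists>u\<in>Fix j. [int p] \<cdot> w = \<X> ^ (p ^ Suc j - p ^ j) \<star> w1 \<oplus> u"
proof -
  define e where "e = p ^ Suc j - p ^ j"
  define L where "L = Fix (Suc j)"
  note Lc = Fix_closed[of _ "Suc j", folded L_def]
  have subL: "submodule L R M" and stL: "stable L" unfolding L_def by (rule submodule_Fix stable_Fix)+
  define N where "N = {m \<in> L. \<exists>w1\<in>L. \<exists>u\<in>Fix j. [int p] \<cdot> m = \<X> ^ e \<star> w1 \<oplus> u}"
  obtain h where h: "nu j = \<X> ^ e + of_nat p * (1 + \<X> * h)"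
    using cyclotomic_poly_eisenstein[OF prime_p, of j] unfolding e_def by blast
  note Fc = Fix_closed[of _ j]
  have NI: "m \<in> N" if "m \<in> L" "w1 \<in> L" "u \<in> Fix j" "[int p] \<cdot> m = \<X> ^ e \<star> w1 \<oplus> u" for m w1 u
    using that unfolding N_def by blast
  have subN: "submodule N R M"
  proof (rule submoduleI_closed)
    show "N \<subseteq> carrier M" using Lc by (auto simp: N_def)
    show "\<zero> \<in> N" using submodule_zero[OF subL] submodule_zero[OF submodule_Fix, of j]
      by (intro NI[of \<zero> \<zero> \<zero>]) auto
  next
    fix a b assume "a \<in> N" "b \<in> N"
    then obtain w1 u w2 u2 where *: "a \<in> L" "b \<in> L" "w1 \<in> L" "w2 \<in> L" "u \<in> Fix j" "u2 \<in> Fix j"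
      "[int p] \<cdot> a = \<X> ^ e \<star> w1 \<oplus> u" "[int p] \<cdot> b = \<X> ^ e \<star> w2 \<oplus> u2" unfolding N_def by blast
    have cl: "a \<in> carrier M" "b \<in> carrier M" "w1 \<in> carrier M" "w2 \<in> carrier M" "u \<in> carrier M" "u2 \<in> carrier M"
      using * Lc Fc by auto
    show "a \<oplus> b \<in> N"
    proof (rule NI[of _ "w1 \<oplus> w2" "u \<oplus> u2"])
      show "[int p] \<cdot> (a \<oplus> b) = \<X> ^ e \<star> (w1 \<oplus> w2) \<oplus> (u \<oplus> u2)"
        using cl by (simp add: M.zmul_add *(7,8) poly_act_add M.a_ac)
    qed (use * submoduleE(5)[OF subL] submoduleE(5)[OF submodule_Fix] in auto)
  next
    fix r a assume r: "r \<in> carrier R" and "a \<in> N"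
    then obtain w1 u where *: "a \<in> L" "w1 \<in> L" "u \<in> Fix j" 
      "[int p] \<cdot> a = \<X> ^ e \<star> w1 \<oplus> u" unfolding N_def by blast
    have cl: "a \<in> carrier M" "w1 \<in> carrier M" "u \<in> carrier M"
      using * Lc Fc by auto
    show "r \<odot> a \<in> N"
    proof (rule NI[of _ "r \<odot> w1" "r \<odot> u"])
      show "[int p] \<cdot> (r \<odot> a) = \<X> ^ e \<star> (r \<odot> w1) \<oplus> r \<odot> u"
        using cl r smult_zmul[of r a "int p"] by (simp add: *(4) poly_act_scalar smult_r_distr)
    qed (use * r submoduleE(4)[OF subL] submoduleE(4)[OF submodule_Fix] in auto)
  qed
  \<comment> \<open>\<open>1 + \<X> h\<close> maps \<open>L\<close> into \<open>N\<close>, so \<open>L\<close> is contained in \<open>N + \<X>^k L\<close> for all \<open>k\<close>.\<close>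
  have gN: "(1 + \<X> * h) \<star> m \<in> N" if m: "m \<in> L" for m
  proof (rule NI[of _ "(- 1) \<star> m" "nu j \<star> m"])
    have mc: "m \<in> carrier M" using m by (rule Lc)
    have "of_nat p * (1 + \<X> * h) = \<X> ^ e * (- 1) + nu j" unfolding h by simp
    hence "(of_nat p * (1 + \<X> * h)) \<star> m = \<X> ^ e \<star> (- 1) \<star> m \<oplus> nu j \<star> m"
      using mc by (simp only: poly_act_plus poly_act_mult)
    thus "[int p] \<cdot> ((1 + \<X> * h) \<star> m) = \<X> ^ e \<star> (- 1) \<star> m \<oplus> nu j \<star> m"
      using mc by (simp add: poly_act_mult poly_act_of_nat)
    show "nu j \<star> m \<in> Fix j" using m nu_Fix by (simp add: L_def)
  qed (use m stable_poly_act[OF stL] in auto)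
  have iter: "\<exists>t\<in>N. m = t \<oplus> ((- \<X> * h) ^ k) \<star> m" if m: "m \<in> L" for m k
  proof (induction k)
    case 0 thus ?case using Lc[OF m] submodule_zero[OF subN] by (intro bexI[of _ \<zero>]) auto
  next
    case (Suc k)
    then obtain t where t: "t \<in> N" "m = t \<oplus> ((- \<X> * h) ^ k) \<star> m" by blast
    define y where "y = ((- \<X> * h) ^ k) \<star> m"
    have y: "y \<in> L" unfolding y_def using stable_poly_act[OF stL m] .
    have yc: "y \<in> carrier M" "m \<in> carrier M" "t \<in> carrier M" 
      using y Lc m t(1) submoduleE(1)[OF subN] by auto
    have "1 = (1 + \<X> * h) + (- \<X> * h)" by simp
    hence "1 \<star> y = (1 + \<X> * h) \<star> y \<oplus> (- \<X> * h) \<star> y" using poly_act_plus[OF yc(1)] by metis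
    hence "y = (1 + \<X> * h) \<star> y \<oplus> (- \<X> * h) \<star> y" using yc by simp
    moreover have "(- \<X> * h) \<star> y = ((- \<X> * h) ^ Suc k) \<star> m" 
      using yc unfolding y_def power_Suc by (simp only: poly_act_mult poly_act_closed)
    ultimately have "y = (1 + \<X> * h) \<star> y \<oplus> ((- \<X> * h) ^ Suc k) \<star> m" by simp
    hence "m = t \<oplus> ((1 + \<X> * h) \<star> y \<oplus> ((- \<X> * h) ^ Suc k) \<star> m)" using t(2) y_def by metis
    hence "m = (t \<oplus> (1 + \<X> * h) \<star> y) \<oplus> ((- \<X> * h) ^ Suc k) \<star> m" using yc by (simp only: M.a_assoc poly_act_closed)
    moreover have "t \<oplus> (1 + \<X> * h) \<star> y \<in> N" using t gN[OF y] submoduleE(5)[OF subN] by blast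
    ultimately show ?case by blast
  qed
  have "L \<subseteq> N"
  proof -
    obtain A where A: "generated_by R M L A" using Fix_fg[OF j] unfolding L_def by blast
    show ?thesis
    proof (rule nakayama[OF subN subL A])
      fix m assume m: "m \<in> L"
      have mc: "m \<in> carrier M" using m by (rule Lc)
      define q where "q = p ^ Suc j"
      obtain t where t: "t \<in> N" "m = t \<oplus> ((- \<X> * h) ^ q) \<star> m" using iter[OF m] by blast
      obtain a where a: "tau (Suc j) = \<X> ^ q + of_nat p * a" using tau_eq q_def by blast
      have "(- \<X> * h) ^ q = ((- h) ^ q) * (\<X> ^ q)" by (simp flip: power_mult_distrib add: mult.commute)
      also have "\<X> ^ q = tau (Suc j) - of_nat p * a" unfolding a by simp
      also have "(- h) ^ q * \<dots> = (- h) ^ q * tau (Suc j) - of_nat p * ((- h) ^ q * a)" by (simp add: algebra_simps)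
      finally have "((- \<X> * h) ^ q) \<star> m = ((- h) ^ q) \<star> tau (Suc j) \<star> m \<ominus> [int p] \<cdot> (((- h) ^ q * a) \<star> m)"
        using mc by (simp only: poly_act_diff poly_act_mult poly_act_of_nat poly_act_closed)
      also have "tau (Suc j) \<star> m = \<zero>" using tau_Fix m by (simp add: L_def)
      finally have "((- \<X> * h) ^ q) \<star> m = \<zero> \<ominus> [int p] \<cdot> (((- h) ^ q * a) \<star> m)" by simp
      also have "\<dots> = [int p] \<cdot> (\<zero> \<ominus> ((- h) ^ q * a) \<star> m)" using mc by (simp add: M.zmul_minus)
      finally have "m = t \<oplus> [int p] \<cdot> (\<zero> \<ominus> ((- h) ^ q * a) \<star> m)" using t(2) by simp
      moreover have "\<zero> \<ominus> ((- h) ^ q * a) \<star> m \<in> L"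
        using stable_poly_act[OF stL m] submodule_minus[OF subL submodule_zero[OF subL]] by blast
      ultimately show "\<exists>x\<in>N. \<exists>y\<in>L. m = x \<oplus> [int p] \<cdot> y" using t(1) by blast
    qed
  qed
  thus ?thesis using w unfolding N_def L_def e_def by blast
qed

text \<open>
  Let \<open>a = p ^ j + b\<close>. Up to \<open>pM\<close>, \<open>v\<close> lies in \<open>Fix (j + 1)\<close>, and \<open>\<X> ^ b \<star> v\<close> lies in \<open>Fix j\<close> because
  \<open>\<X> ^ (p ^ j)\<close> kills it modulo \<open>p\<close>. So \<open>\<X> ^ b \<star> v\<close> is divisible by \<open>p\<close> in \<open>Fix (j + 1) / Fix j\<close>, hence by
  \<open>\<X> ^ e\<close>, and \<open>\<X> ^ b\<close> can be cancelled: \<open>v\<close> is \<open>\<X> ^ (e - b) \<star> w\<close> up to an element of \<open>Fix j\<close>, which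
  \<open>\<X> ^ (a - 1)\<close> kills modulo \<open>p\<close>. In terms of Jordan blocks: the socle of a block of size at least \<open>a\<close>
  has height at least \<open>p ^ (j + 1) - 1\<close>.
\<close>

lemma socle_height:
  assumes j: "Suc j \<le> n" and a: "p ^ j < a" "a \<le> p ^ Suc j"
    and v: "v \<in> carrier M" "\<X> ^ a \<star> v \<approx> \<zero>"
  shows "\<exists>w\<in>Fix (Suc j). \<X> ^ (a - 1) \<star> v \<approx> \<X> ^ (p ^ Suc j - 1) \<star> w"
proof -
  define b where "b = a - p ^ j"
  define e where "e = p ^ Suc j - p ^ j"
  have p1: "p ^ j < p ^ Suc j" using prime_gt_1_nat[OF prime_p] by simp
  have b: "a = p ^ j + b" "1 \<le> b" "b \<le> e" using a by (auto simp: b_def e_def)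
  have "\<X> ^ (p ^ Suc j) \<star> v = \<X> ^ (p ^ Suc j - a) \<star> \<X> ^ a \<star> v"
    using a v by (simp flip: poly_act_mult power_add)
  also have "\<dots> \<approx> \<X> ^ (p ^ Suc j - a) \<star> \<zero>" by (rule congp_poly_act[OF v(2)])
  finally have "\<X> ^ (p ^ Suc j) \<star> v \<approx> \<zero>" by simp
  then obtain v1 where v1: "v1 \<in> Fix (Suc j)" "v \<approx> v1" using Fix_lift_X[OF j v(1)] by blast
  have v1c: "v1 \<in> carrier M" using v1 Fix_closed by blast
  have "\<X> ^ (p ^ j) \<star> \<X> ^ b \<star> v1 = \<X> ^ a \<star> v1" unfolding b(1) power_add using v1c by (simp add: poly_act_mult)
  also have "\<dots> \<approx> \<X> ^ a \<star> v" by (rule congp_poly_act[OF congp_sym[OF v1(2)]])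
  also note v(2)
  finally have "\<X> ^ (p ^ j) \<star> \<X> ^ b \<star> v1 \<approx> \<zero>" .
  then obtain u where u: "u \<in> Fix j" "\<X> ^ b \<star> v1 \<approx> u"
    using Fix_lift_X[of j "\<X> ^ b \<star> v1"] j v1c by auto
  have uc: "u \<in> carrier M" using u Fix_closed by blast
  obtain w where w: "w \<in> carrier M" "\<X> ^ b \<star> v1 = u \<oplus> [int p] \<cdot> w" using u(2) by (auto simp: congp_iff)
  have uS: "u \<in> Fix (Suc j)" using Fix_mono[of j "Suc j"] u(1) by auto
  have "[int p] \<cdot> w = \<X> ^ b \<star> v1 \<ominus> u" using w uc by (simp add: M.add_minus_self)
  moreover have "\<X> ^ b \<star> v1 \<ominus> u \<in> Fix (Suc j)"
    using stable_poly_act[OF stable_Fix v1(1)] submodule_minus[OF submodule_Fix _ uS] by blast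
  ultimately have wF: "w \<in> Fix (Suc j)" using Fix_pure[OF w(1)] by simp
  obtain w1 u1 where w1: "w1 \<in> Fix (Suc j)" "u1 \<in> Fix j" "[int p] \<cdot> w = \<X> ^ e \<star> w1 \<oplus> u1"
    using p_multiple_Fix_Suc[OF j wF] unfolding e_def by blast
  have w1c: "w1 \<in> carrier M" "u1 \<in> carrier M" using w1 Fix_closed by auto
  define d where "d = v1 \<ominus> \<X> ^ (e - b) \<star> w1"
  have dS: "d \<in> Fix (Suc j)" unfolding d_def
    using submodule_minus[OF submodule_Fix v1(1)] stable_poly_act[OF stable_Fix w1(1)] by blast
  have dc: "d \<in> carrier M" using dS Fix_closed by blast
  have "\<X> ^ b \<star> d = \<X> ^ b \<star> v1 \<ominus> \<X> ^ e \<star> w1"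
    using v1c w1c b(3) by (simp add: d_def poly_act_minus flip: poly_act_mult power_add)
  also have "\<dots> = u \<oplus> u1"
    using w(2) w1c uc v1c unfolding w1(3) by (simp add: M.minus_eq_iff M.a_ac)
  finally have "\<X> ^ b \<star> d \<in> Fix j" using u(1) w1(2) submoduleE(5)[OF submodule_Fix] by simp
  hence dj: "d \<in> Fix j" using X_power_injective[OF dS] by blast
  have v1d: "v1 = d \<oplus> \<X> ^ (e - b) \<star> w1" using v1c w1c by (simp add: d_def M.add_minus_cancel)
  have ex: "a - 1 + (e - b) = p ^ Suc j - 1" using b p1 by (simp add: e_def)
  have "\<X> ^ (a - 1) \<star> v \<approx> \<X> ^ (a - 1) \<star> v1" by (rule congp_poly_act[OF v1(2)])
  also have "\<dots> = \<X> ^ (a - 1) \<star> d \<oplus> \<X> ^ (p ^ Suc j - 1) \<star> w1"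
  proof -
    have "\<X> ^ (a - 1) \<star> \<X> ^ (e - b) \<star> w1 = \<X> ^ (p ^ Suc j - 1) \<star> w1"
      unfolding poly_act_mult[OF w1c(1), symmetric] power_add[symmetric] ex ..
    thus ?thesis unfolding v1d using dc w1c by (simp only: poly_act_add poly_act_closed)
  qed
  also have "\<dots> \<approx> \<zero> \<oplus> \<X> ^ (p ^ Suc j - 1) \<star> w1"
    using X_power_Fix[OF dj, of "a - 1"] a w1c by (intro congp_add) auto
  finally show ?thesis using w1 w1c by auto
qed

text \<open>
  Only the socle elements \<open>\<X> ^ (p ^ j - 1) \<star> w\<close> have to be reached by \<open>N\<close>. If \<open>\<X> ^ (a + 1)\<close> kills \<open>v\<close>
  modulo \<open>p\<close>, then by \<open>socle_height\<close> \<open>\<X> ^ a \<star> v\<close> is such an element with \<open>a < p ^ j\<close>, so it is \<open>\<X> ^ a \<star> z\<close>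
  modulo \<open>p\<close> for some \<open>z\<close> in \<open>N\<close>, and \<open>\<X> ^ a\<close> kills \<open>v - z\<close>.
\<close>

theorem stable_spanning:
  assumes N: "stable N"
    and E: "\<And>j w. \<lbrakk>j \<le> n; w \<in> Fix j\<rbrakk> \<Longrightarrow> \<exists>y\<in>N. \<X> ^ (p ^ j - 1) \<star> w \<approx> \<X> ^ (p ^ j - 1) \<star> y"
  shows "N = carrier M"
proof -
  have subN: "submodule N R M" using N by (simp add: stable_def)
  note Nc = subsetD[OF submoduleE(1)[OF subN]]
  have claim: "\<exists>y\<in>N. v \<approx> y" if "a \<le> p ^ n" "v \<in> carrier M" "\<X> ^ a \<star> v \<approx> \<zero>" for a v
    using that
  proof (induction a arbitrary: v)
    case 0
    thus ?case using submodule_zero[OF subN] by auto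
  next
    case (Suc a)
    have "\<exists>j\<le>n. \<exists>w\<in>Fix j. Suc a \<le> p ^ j \<and> \<X> ^ a \<star> v \<approx> \<X> ^ (p ^ j - 1) \<star> w"
    proof (cases "a = 0")
      case True
      then obtain w where "w \<in> Fix 0" "v \<approx> w" using Fix_lift_X[of 0 v] Suc.prems by auto
      moreover have "w \<in> carrier M" using \<open>w \<in> Fix 0\<close> by (rule Fix_closed)
      ultimately have "\<X> ^ a \<star> v \<approx> \<X> ^ (p ^ 0 - 1) \<star> w" using True Suc.prems by simp
      thus ?thesis using True \<open>w \<in> Fix 0\<close> by (intro exI[of _ 0]) auto
    next
      case False
      define k where "k = (LEAST k. Suc a \<le> p ^ k)"
      have k: "Suc a \<le> p ^ k" unfolding k_def by (rule LeastI[of _ n]) (use Suc.prems in auto)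
      have kn: "k \<le> n" unfolding k_def by (rule Least_le) (use Suc.prems in auto)
      have "k \<noteq> 0" using k False by (intro notI) simp
      then obtain j where j: "k = Suc j" by (cases k) auto
      have "\<not> Suc a \<le> p ^ j" using not_less_Least[of j "\<lambda>k. Suc a \<le> p ^ k"] j by (simp add: k_def)
      hence "\<exists>w\<in>Fix (Suc j). \<X> ^ (Suc a - 1) \<star> v \<approx> \<X> ^ (p ^ Suc j - 1) \<star> w"
        using k kn Suc.prems unfolding j by (intro socle_height) auto
      thus ?thesis using k kn unfolding j diff_Suc_1 by blast
    qed
    then obtain j w where w: "j \<le> n" "w \<in> Fix j" "Suc a \<le> p ^ j" "\<X> ^ a \<star> v \<approx> \<X> ^ (p ^ j - 1) \<star> w" by blast
    obtain y where y: "y \<in> N" "\<X> ^ (p ^ j - 1) \<star> w \<approx> \<X> ^ (p ^ j - 1) \<star> y" using E[OF w(1,2)] by blast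
    define z where "z = \<X> ^ (p ^ j - 1 - a) \<star> y"
    have z: "z \<in> N" unfolding z_def by (rule stable_poly_act[OF N y(1)])
    have zc: "z \<in> carrier M" "y \<in> carrier M" using z y Nc by auto
    have "\<X> ^ a \<star> z = \<X> ^ (p ^ j - 1) \<star> y" using zc w(3) by (simp add: z_def flip: poly_act_mult power_add)
    hence "\<X> ^ a \<star> v \<approx> \<X> ^ a \<star> z" using congp_trans[OF w(4) y(2)] by simp
    hence "\<X> ^ a \<star> v \<ominus> \<X> ^ a \<star> z \<approx> \<X> ^ a \<star> z \<ominus> \<X> ^ a \<star> z" using zc by (intro congp_minus) auto
    hence "\<X> ^ a \<star> (v \<ominus> z) \<approx> \<zero>" using zc Suc.prems by (simp add: poly_act_minus)
    then obtain y' where y': "y' \<in> N" "v \<ominus> z \<approx> y'" using Suc.IH[of "v \<ominus> z"] Suc.prems zc by auto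
    have "(v \<ominus> z) \<oplus> z \<approx> y' \<oplus> z" using y' zc by (intro congp_add) auto
    hence "v \<approx> y' \<oplus> z" using zc Suc.prems by (simp add: M.add_minus_cancel)
    thus ?case using y' z submoduleE(5)[OF subN] by blast
  qed
  obtain A where A: "generated_by R M (Fix n) A" using Fix_fg[of n] by blast
  have "carrier M \<subseteq> N"
  proof (rule nakayama[OF subN _ A[unfolded Fix_n]])
    show "submodule (carrier M) R M" by (rule carrier_is_submodule)
    fix m assume m: "m \<in> carrier M"
    then obtain y where "y \<in> N" "m \<approx> y" using claim[of "p ^ n" m] X_nilpotent by auto
    thus "\<exists>x\<in>N. \<exists>y\<in>carrier M. m = x \<oplus> [int p] \<cdot> y" by (auto simp: congp_iff)
  qed
  thus ?thesis using Nc by auto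
qed

end

section \<open>Choosing generators of the Jordan blocks\<close>

lemma (in abelian_monoid) finsum_Sigma:
  assumes "finite I" "\<And>i. i \<in> I \<Longrightarrow> finite (L i)" "g \<in> Sigma I L \<rightarrow> carrier G"
  shows "(\<Oplus>x\<in>Sigma I L. g x) = (\<Oplus>i\<in>I. \<Oplus>c\<in>L i. g (i, c))"
  using assms
proof (induction I rule: finite_induct)
  case (insert i I)
  have g: "g (i', c) \<in> carrier G" if "i' \<in> insert i I" "c \<in> L i'" for i' c using insert.prems(2) that by auto
  have S: "Sigma (insert i I) L = Pair i ` L i \<union> Sigma I L" by auto
  have "(\<Oplus>x\<in>Sigma (insert i I) L. g x) = (\<Oplus>x\<in>Pair i ` L i. g x) \<oplus> (\<Oplus>x\<in>Sigma I L. g x)"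
    unfolding S using insert.hyps insert.prems g by (intro finsum_Un_disjoint) auto
  also have "(\<Oplus>x\<in>Pair i ` L i. g x) = (\<Oplus>c\<in>L i. g (i, c))"
    using g by (intro finsum_reindex) (auto simp: inj_on_def)
  also have "(\<Oplus>x\<in>Sigma I L. g x) = (\<Oplus>i\<in>I. \<Oplus>c\<in>L i. g (i, c))"
    using insert.prems by (intro insert.IH) auto
  finally show ?case
    using insert.hyps g by (subst finsum_insert) (auto intro!: finsum_closed)
qed simp

lemma (in module_over) finsum_delta:
  assumes "finite A" "i \<in> A" "b \<in> A \<rightarrow> carrier M"
  shows "(\<Oplus>j\<in>A. (\<lambda>j\<in>A. if j = i then \<one>\<^bsub>R\<^esub> else \<zero>\<^bsub>R\<^esub>) j \<odot> b j) = b i"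
proof -
  have "(\<Oplus>j\<in>A. (\<lambda>j\<in>A. if j = i then \<one>\<^bsub>R\<^esub> else \<zero>\<^bsub>R\<^esub>) j \<odot> b j) = (\<Oplus>j\<in>A. if i = j then b j else \<zero>)"
    using assms(3) by (intro M.finsum_cong') (auto simp: Pi_iff)
  thus ?thesis using M.finsum_singleton[OF assms(2,1,3)] by simp
qed

lemma free_module_on_zmul:
  assumes "cring R" and f: "f \<in> carrier (free_module_on R \<Omega>)" and "\<omega> \<in> \<Omega>"
  shows "([(k::int)] \<cdot>\<^bsub>free_module_on R \<Omega>\<^esub> f) \<omega> = [k] \<cdot>\<^bsub>R\<^esub> (f \<omega>)"
proof -
  interpret module_over R "free_module_on R \<Omega>"
    using module_free_module_on[OF assms(1)] by (simp add: module_over_def)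
  have f\<omega>: "f \<omega> \<in> carrier R" using f assms(3) by (auto simp: free_module_on_def)
  have "[k] \<cdot>\<^bsub>free_module_on R \<Omega>\<^esub> f = ([k] \<cdot>\<^bsub>R\<^esub> \<one>\<^bsub>R\<^esub>) \<odot>\<^bsub>free_module_on R \<Omega>\<^esub> f"
    using f by (simp add: zmul_smult)
  hence "([k] \<cdot>\<^bsub>free_module_on R \<Omega>\<^esub> f) \<omega> = ([k] \<cdot>\<^bsub>R\<^esub> \<one>\<^bsub>R\<^esub>) \<otimes>\<^bsub>R\<^esub> f \<omega>"
    using assms(3) by (simp add: free_module_on_def)
  thus ?thesis using f\<omega> by (simp add: R.add_pow_ldistr_int)
qed

context h90_lattice begin

definition pR :: "'r set" where "pR = (\<lambda>c. [int p] \<cdot>\<^bsub>R\<^esub> c) ` carrier R"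

text \<open>
  Linear independence of the family \<open>w\<close> in \<open>M/pM\<close> over the residue field.
\<close>

definition indep :: "'i set \<Rightarrow> ('i \<Rightarrow> 'm) \<Rightarrow> bool" where
  "indep I w \<longleftrightarrow> (\<forall>f\<in>I \<rightarrow> carrier R. (\<Oplus>i\<in>I. f i \<odot> w i) \<in> pM \<longrightarrow> f ` I \<subseteq> pR)"

lemma pR_smult: "\<lbrakk>r \<in> pR; x \<in> carrier M\<rbrakk> \<Longrightarrow> r \<odot> x \<in> pM"
  by (auto simp: pR_def zmul_smult intro!: pM_I)

text \<open>
  A greedy choice over the residue field: a member of the family outside the span of the previous
  ones can be added. The span is described by the submodules that contain it, which makes its
  monotonicity trivial.
\<close>

lemma exists_mod_p_basis:
  assumes "finite I" "indep I w" "finite A" "w \<in> I \<union> A \<rightarrow> carrier M"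
  shows "\<exists>J. I \<subseteq> J \<and> J \<subseteq> I \<union> A \<and> indep J w \<and>
    (\<forall>a\<in>A. \<forall>K. submodule K R M \<longrightarrow> pM \<subseteq> K \<longrightarrow> w ` J \<subseteq> K \<longrightarrow> w a \<in> K)"
  using assms(3,4)
proof (induction A rule: finite_induct)
  case empty
  thus ?case using assms(2) by blast
next
  case (insert a A)
  then obtain J where J: "I \<subseteq> J" "J \<subseteq> I \<union> A" "indep J w" 
    and gen: "\<And>a K. \<lbrakk>a \<in> A; submodule K R M; pM \<subseteq> K; w ` J \<subseteq> K\<rbrakk> \<Longrightarrow> w a \<in> K" by auto
  show ?case
  proof (cases "\<forall>K. submodule K R M \<longrightarrow> pM \<subseteq> K \<longrightarrow> w ` J \<subseteq> K \<longrightarrow> w a \<in> K")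
    case True
    thus ?thesis using J gen by (intro exI[of _ J]) auto
  next
    case False
    then obtain K where K: "submodule K R M" "pM \<subseteq> K" "w ` J \<subseteq> K" "w a \<notin> K" by blast
    have aJ: "a \<notin> J" using K by blast
    have finJ: "finite J" using J(2) assms(1) insert.hyps(1) by (meson finite_Un rev_finite_subset)
    have wJ: "w \<in> J \<rightarrow> carrier M" "w a \<in> carrier M" using insert.prems J by auto
    have "indep (insert a J) w"
      unfolding indep_def
    proof (intro ballI impI)
      fix f assume f: "f \<in> insert a J \<rightarrow> carrier R" and z: "(\<Oplus>i\<in>insert a J. f i \<odot> w i) \<in> pM"
      have fa: "f a \<in> carrier R" and fJ: "f \<in> J \<rightarrow> carrier R" using f by auto
      define S where "S = (\<Oplus>i\<in>J. f i \<odot> w i)"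
      have cl: "(\<lambda>i. f i \<odot> w i) \<in> J \<rightarrow> carrier M" using fJ wJ by auto
      have S: "S \<in> carrier M" unfolding S_def by (rule M.finsum_closed[OF cl])
      have z': "f a \<odot> w a \<oplus> S \<in> pM"
        using z M.finsum_insert[OF finJ aJ cl] fa wJ(2) by (simp add: S_def)
      \<comment> \<open>otherwise \<open>f a\<close> is a unit and \<open>w a\<close> lies in the span after all\<close>
      have fap: "f a \<in> pR"
      proof (rule ccontr)
        assume "f a \<notin> pR"
        hence u: "f a \<in> Units R" using unit_or_p[OF fa] by (auto simp: pR_def)
        have "S \<in> K" unfolding S_def using K fJ
          by (intro submodule_finsum[OF K(1) finJ]) (auto simp: Pi_iff intro!: submoduleE(4)[OF K(1)])
        hence "(f a \<odot> w a \<oplus> S) \<ominus> S \<in> K" using z' K submodule_minus[OF K(1)] by blast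
        moreover have "(f a \<odot> w a \<oplus> S) \<ominus> S = f a \<odot> w a" using fa wJ S by (simp add: M.minus_eq_iff)
        ultimately have "inv\<^bsub>R\<^esub> (f a) \<odot> (f a \<odot> w a) \<in> K" using submoduleE(4)[OF K(1)] u by simp
        moreover have "inv\<^bsub>R\<^esub> (f a) \<odot> (f a \<odot> w a) = w a" using u fa wJ by (simp flip: smult_assoc1)
        ultimately show False using K(4) by simp
      qed
      have "(f a \<odot> w a \<oplus> S) \<ominus> f a \<odot> w a \<in> pM"
        using z' pR_smult[OF fap wJ(2)] submodule_minus[OF submodule_pM] by blast
      hence "S \<in> pM" using fa wJ S by (simp add: M.add_minus_self)
      hence "f ` J \<subseteq> pR" using J(3) fJ unfolding indep_def S_def by blast
      thus "f ` insert a J \<subseteq> pR" using fap by simp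
    qed
    moreover have "w a' \<in> L" if "a' \<in> insert a A" "submodule L R M" "pM \<subseteq> L" "w ` insert a J \<subseteq> L" for a' L
      using that gen[of a' L] by auto
    ultimately show ?thesis using J by (intro exI[of _ "insert a J"]) blast
  qed
qed

text \<open>
  A pair \<open>(k, v)\<close> with \<open>v\<close> in \<open>Fix k\<close> stands for a future orbit of length \<open>p ^ k\<close>, and \<open>trace (k, v)\<close> is the
  sum over that orbit.
\<close>

definition trace :: "nat \<times> 'm \<Rightarrow> 'm" where "trace i = Tr_poly (p ^ fst i) \<star> snd i"

text \<open>
  The traces of \<open>Fix m\<close> grow as \<open>m\<close> decreases, so an independent family for \<open>m + 1\<close> can be extended by
  traces of generators of \<open>Fix m\<close>. In this order a trace that is already in the span needs no new
  generator: the generators \<open>(k, v)\<close> in its expression have \<open>k \<ge> m\<close>, so \<open>trace (k, v)\<close> is congruent to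
  \<open>\<X> ^ (p ^ m - 1)\<close> applied to the element \<open>\<X> ^ (p ^ k - p ^ m) \<star> v\<close>.
\<close>

lemma select_generators:
  assumes "m \<le> Suc n"
  shows "\<exists>I. finite I \<and> (\<forall>(k, v)\<in>I. m \<le> k \<and> k \<le> n \<and> v \<in> Fix k) \<and> indep I trace \<and>
    (\<forall>j w N. m \<le> j \<longrightarrow> j \<le> n \<longrightarrow> w \<in> Fix j \<longrightarrow> stable N \<longrightarrow> snd ` I \<subseteq> N \<longrightarrow>
        (\<exists>y\<in>N. \<X> ^ (p ^ j - 1) \<star> w \<approx> \<X> ^ (p ^ j - 1) \<star> y))"
  using assms
proof (induction rule: inc_induct)
  case base
  show ?case by (intro exI[of _ "{}"]) (auto simp: indep_def)
next
  case (step m)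
  then obtain I where I: "finite I" "\<And>k v. (k, v) \<in> I \<Longrightarrow> Suc m \<le> k \<and> k \<le> n \<and> v \<in> Fix k" "indep I trace"
    and ex: "\<And>j w N. \<lbrakk>Suc m \<le> j; j \<le> n; w \<in> Fix j; stable N; snd ` I \<subseteq> N\<rbrakk> \<Longrightarrow>
        \<exists>y\<in>N. \<X> ^ (p ^ j - 1) \<star> w \<approx> \<X> ^ (p ^ j - 1) \<star> y" by fast
  have mn: "m \<le> n" using step.hyps by simp
  obtain A where A: "generated_by R M (Fix m) A" using Fix_fg[OF mn] by blast
  hence finA: "finite A" and AF: "A \<subseteq> Fix m" by (auto simp: generated_by_def)
  have tr: "trace \<in> I \<union> Pair m ` A \<rightarrow> carrier M"
    using I(2) AF Fix_closed by (fastforce simp: trace_def)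
  obtain J where J: "I \<subseteq> J" "J \<subseteq> I \<union> Pair m ` A" "indep J trace"
    and gen: "\<And>a K. \<lbrakk>a \<in> A; submodule K R M; pM \<subseteq> K; trace ` J \<subseteq> K\<rbrakk> \<Longrightarrow> trace (m, a) \<in> K"
    using exists_mod_p_basis[OF I(1,3) finite_imageI[OF finA] tr] by blast
  have J2: "m \<le> k \<and> k \<le> n \<and> v \<in> Fix k" if "(k, v) \<in> J" for k v
  proof (cases "(k, v) \<in> I")
    case True thus ?thesis using I(2)[of k v] by simp
  next
    case False
    hence "k = m" "v \<in> A" using that J(2) by auto
    thus ?thesis using AF mn by auto
  qed
  have "\<exists>y\<in>N. \<X> ^ (p ^ j - 1) \<star> w \<approx> \<X> ^ (p ^ j - 1) \<star> y"
    if j: "m \<le> j" "j \<le> n" "w \<in> Fix j" and N: "stable N" "snd ` J \<subseteq> N" for j w N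
  proof (cases "j = m")
    case False
    thus ?thesis using ex[of j w N] j N J(1) by auto
  next
    case jm: True
    have subN: "submodule N R M" using N by (simp add: stable_def)
    note Nc = subsetD[OF submoduleE(1)[OF subN]]
    define e where "e = p ^ m - 1"
    define K where "K = {x \<in> carrier M. \<exists>y\<in>N. x \<approx> \<X> ^ e \<star> y}"
    have subK: "submodule K R M"
    proof (rule submoduleI_closed)
      show "\<zero> \<in> K" using submodule_zero[OF subN] unfolding K_def by (auto intro!: bexI[of _ \<zero>])
    next
      fix a b assume "a \<in> K" "b \<in> K"
      then obtain y z where *: "y \<in> N" "z \<in> N" "a \<approx> \<X> ^ e \<star> y" "b \<approx> \<X> ^ e \<star> z" "a \<in> carrier M" "b \<in> carrier M"
        unfolding K_def by blast
      have "a \<oplus> b \<approx> \<X> ^ e \<star> (y \<oplus> z)" using congp_add[OF *(3,4)] * Nc by (simp add: poly_act_add)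
      thus "a \<oplus> b \<in> K" using * submoduleE(5)[OF subN] unfolding K_def by blast
    next
      fix r a assume r: "r \<in> carrier R" and "a \<in> K"
      then obtain y where *: "y \<in> N" "a \<approx> \<X> ^ e \<star> y" "a \<in> carrier M"
        unfolding K_def by blast
      have "r \<odot> a \<approx> \<X> ^ e \<star> (r \<odot> y)" using congp_smult[OF *(2) r] * Nc r by (simp add: poly_act_scalar)
      thus "r \<odot> a \<in> K" using * r submoduleE(4)[OF subN] unfolding K_def by blast
    qed (auto simp: K_def)
    have pK: "pM \<subseteq> K"
    proof
      fix x assume "x \<in> pM"
      hence "x \<in> carrier M" "x \<approx> \<X> ^ e \<star> \<zero>" using pM_closed by (auto simp: congp_zero_iff)
      thus "x \<in> K" unfolding K_def using submodule_zero[OF subN] by blast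
    qed
    have trK: "trace i \<in> K" if i: "i \<in> J" for i
    proof -
      obtain k v where kv: "i = (k, v)" by (cases i)
      have k: "m \<le> k" "v \<in> Fix k" using J2 i kv by auto
      have v: "v \<in> N" "v \<in> carrier M" using i N kv Nc by force+
      have le: "p ^ m \<le> p ^ k" using k(1) prime_gt_0_nat[OF prime_p] by (simp add: power_increasing)
      have "0 < p ^ m" using prime_gt_0_nat[OF prime_p] by simp
      hence ee: "p ^ k - 1 = e + (p ^ k - p ^ m)" using le unfolding e_def by linarith
      have "trace i \<approx> \<X> ^ (p ^ k - 1) \<star> v" unfolding trace_def kv using Tr_congp v by simp
      also have "\<dots> = \<X> ^ e \<star> \<X> ^ (p ^ k - p ^ m) \<star> v" unfolding ee power_add using v by (simp add: poly_act_mult)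
      finally show ?thesis using stable_poly_act[OF N(1) v(1)] congp_closed(1) unfolding K_def by blast
    qed
    have genA: "Tr_poly (p ^ m) \<star> a \<in> K" if "a \<in> A" for a
      using gen[OF that subK pK image_subsetI[OF trK]] by (simp add: trace_def)
    define L where "L = {x \<in> carrier M. Tr_poly (p ^ m) \<star> x \<in> K}"
    have "submodule L R M"
      by (rule submoduleI_closed) (auto simp: L_def submodule_zero[OF subK] poly_act_add poly_act_scalar
          intro: submoduleE(4,5)[OF subK])
    moreover have "A \<subseteq> L" using genA AF Fix_closed by (auto simp: L_def)
    ultimately have "Fix m \<subseteq> L" by (rule generated_by_subset[OF A])
    hence "Tr_poly (p ^ m) \<star> w \<in> K" using j jm by (auto simp: L_def)
    then obtain y where y: "y \<in> N" "Tr_poly (p ^ m) \<star> w \<approx> \<X> ^ e \<star> y" unfolding K_def by blast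
    have "\<X> ^ e \<star> w \<approx> \<X> ^ e \<star> y"
      using congp_trans[OF congp_sym[OF Tr_congp] y(2)] j Fix_closed unfolding e_def by blast
    thus ?thesis using y(1) jm unfolding e_def by blast
  qed
  moreover have "finite J" using J(2) I(1) finA by (meson finite_UnI finite_imageI rev_finite_subset)
  ultimately show ?case using J J2 by (intro exI[of _ J]) fast
qed

end

section \<open>The permuted basis\<close>

lemma (in module_over) free_basis_reindex:
  assumes inj: "inj_on b \<Omega>" and bM: "\<And>\<omega>. \<omega> \<in> \<Omega> \<Longrightarrow> b \<omega> \<in> carrier M"
    and bij: "bij_betw (\<lambda>f. \<Oplus>\<omega>\<in>\<Omega>. f \<omega> \<odot> b \<omega>) (\<Omega> \<rightarrow>\<^sub>E carrier R) (carrier M)"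
  shows "bij_betw (\<lambda>f. \<Oplus>x\<in>b ` \<Omega>. f x \<odot> x) (b ` \<Omega> \<rightarrow>\<^sub>E carrier R) (carrier M)"
proof -
  define B where "B = b ` \<Omega>"
  have re: "bij_betw (\<lambda>f. \<lambda>\<omega>\<in>\<Omega>. f (b \<omega>)) (B \<rightarrow>\<^sub>E carrier R) (\<Omega> \<rightarrow>\<^sub>E carrier R)"
  proof (rule bij_betwI[where g = "\<lambda>g. \<lambda>x\<in>B. g (the_inv_into \<Omega> b x)"])
    show "(\<lambda>f. \<lambda>\<omega>\<in>\<Omega>. f (b \<omega>)) \<in> (B \<rightarrow>\<^sub>E carrier R) \<rightarrow> \<Omega> \<rightarrow>\<^sub>E carrier R"
      by (auto simp: B_def)
    show "(\<lambda>g. \<lambda>x\<in>B. g (the_inv_into \<Omega> b x)) \<in> (\<Omega> \<rightarrow>\<^sub>E carrier R) \<rightarrow> B \<rightarrow>\<^sub>E carrier R"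
      using the_inv_into_into[OF inj _ subset_refl] by (auto simp: B_def)
    fix f assume f: "f \<in> B \<rightarrow>\<^sub>E carrier R"
    show "(\<lambda>x\<in>B. (\<lambda>\<omega>\<in>\<Omega>. f (b \<omega>)) (the_inv_into \<Omega> b x)) = f"
      by (rule PiE_ext[OF _ f]) (use f in \<open>auto simp: B_def the_inv_into_f_f[OF inj]\<close>)
  next
    fix g assume g: "g \<in> \<Omega> \<rightarrow>\<^sub>E carrier R"
    show "(\<lambda>\<omega>\<in>\<Omega>. (\<lambda>x\<in>B. g (the_inv_into \<Omega> b x)) (b \<omega>)) = g"
      by (rule PiE_ext[OF _ g]) (use g in \<open>auto simp: B_def the_inv_into_f_f[OF inj]\<close>)
  qed
  from bij_betw_trans[OF re bij]
  have "bij_betw ((\<lambda>f. \<Oplus>\<omega>\<in>\<Omega>. f \<omega> \<odot> b \<omega>) \<circ> (\<lambda>f. \<lambda>\<omega>\<in>\<Omega>. f (b \<omega>))) (B \<rightarrow>\<^sub>E carrier R) (carrier M)" .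
  also have "bij_betw ((\<lambda>f. \<Oplus>\<omega>\<in>\<Omega>. f \<omega> \<odot> b \<omega>) \<circ> (\<lambda>f. \<lambda>\<omega>\<in>\<Omega>. f (b \<omega>))) (B \<rightarrow>\<^sub>E carrier R) (carrier M) =
      bij_betw (\<lambda>f. \<Oplus>x\<in>B. f x \<odot> x) (B \<rightarrow>\<^sub>E carrier R) (carrier M)"
  proof (rule bij_betw_cong)
    fix f assume f: "f \<in> B \<rightarrow>\<^sub>E carrier R"
    have fB: "f (b \<omega>) \<in> carrier R" if "\<omega> \<in> \<Omega>" for \<omega> using f that by (auto simp: B_def)
    have "(\<Oplus>x\<in>B. f x \<odot> x) = (\<Oplus>\<omega>\<in>\<Omega>. f (b \<omega>) \<odot> b \<omega>)"
      unfolding B_def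
    proof (rule M.finsum_reindex[OF _ inj], rule Pi_I, erule imageE)
      fix x y assume "x = b y" "y \<in> \<Omega>"
      thus "f x \<odot> x \<in> carrier M" using fB bM by simp
    qed
    also have "\<dots> = (\<Oplus>\<omega>\<in>\<Omega>. (\<lambda>\<omega>\<in>\<Omega>. f (b \<omega>)) \<omega> \<odot> b \<omega>)"
      by (intro M.finsum_cong') (simp_all add: fB bM Pi_iff)
    finally show "((\<lambda>f. \<Oplus>\<omega>\<in>\<Omega>. f \<omega> \<odot> b \<omega>) \<circ> (\<lambda>f. \<lambda>\<omega>\<in>\<Omega>. f (b \<omega>))) f = (\<Oplus>x\<in>B. f x \<odot> x)" by simp
  qed
  finally show ?thesis unfolding B_def .
qed

context h90_lattice begin

text \<open>
  An element of the kernel can be divided by \<open>p\<close> without leaving the kernel, as \<open>M\<close> is torsion-free;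
  so its coefficients are divisible by every power of \<open>p\<close>.
\<close>

lemma inj_on_of_inj_mod_p:
  assumes comb: "comb \<in> linear_maps R (free_module_on R \<Omega>) M"
    and mod_p: "\<And>f. \<lbrakk>f \<in> carrier (free_module_on R \<Omega>); comb f \<in> pM\<rbrakk> \<Longrightarrow>
        \<exists>z\<in>carrier (free_module_on R \<Omega>). f = [int p] \<cdot>\<^bsub>free_module_on R \<Omega>\<^esub> z"
  shows "inj_on comb (carrier (free_module_on R \<Omega>))"
proof -
  define FM where "FM = free_module_on R \<Omega>"
  have FM: "module R FM" unfolding FM_def by (rule module_free_module_on[OF R.cring_axioms])
  have FMc: "carrier FM = \<Omega> \<rightarrow>\<^sub>E carrier R" by (simp add: FM_def free_module_on_def)
  note comb = comb[folded FM_def] and mod_p = mod_p[folded FM_def]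
  interpret P: abelian_group FM using FM by (simp add: module_def)
  have ker: "f = \<zero>\<^bsub>FM\<^esub>" if f: "f \<in> carrier FM" "comb f = \<zero>" for f
  proof -
    have div: "\<exists>z\<in>carrier FM. f = [(int p ^ k)] \<cdot>\<^bsub>FM\<^esub> z \<and> comb z = \<zero>" for k
    proof (induction k)
      case 0 thus ?case using f by (intro bexI[of _ f]) auto
    next
      case (Suc k)
      then obtain z where z: "z \<in> carrier FM" "f = [(int p ^ k)] \<cdot>\<^bsub>FM\<^esub> z" "comb z = \<zero>" by blast
      have "comb z \<in> pM" using z(3) submodule_zero[OF submodule_pM] by simp
      then obtain y where y: "y \<in> carrier FM" "z = [int p] \<cdot>\<^bsub>FM\<^esub> y" using mod_p[OF z(1)] by blast
      have "[int p] \<cdot> comb y = \<zero>"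
        using z(3) y linear_maps_add_pow[OF FM module_axioms comb, of y "int p"] by simp
      hence "comb y = \<zero>" using linear_mapsD(1)[OF comb y(1)] torsion_free by blast
      moreover have "f = [(int p ^ Suc k)] \<cdot>\<^bsub>FM\<^esub> y"
        unfolding z(2) y(2) using P.zmul_mult[OF y(1), of "int p ^ k" "int p"] by (simp add: mult.commute)
      ultimately show ?case using y(1) by blast
    qed
    show ?thesis
    proof (rule PiE_ext)
      show "f \<in> \<Omega> \<rightarrow>\<^sub>E carrier R" "\<zero>\<^bsub>FM\<^esub> \<in> \<Omega> \<rightarrow>\<^sub>E carrier R"
        using f(1) P.zero_closed unfolding FMc by auto
      fix \<omega> assume w: "\<omega> \<in> \<Omega>"
      have "\<exists>c\<in>carrier R. f \<omega> = [(int p ^ k)] \<cdot>\<^bsub>R\<^esub> c" for k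
      proof -
        obtain z where z: "z \<in> carrier FM" "f = [(int p ^ k)] \<cdot>\<^bsub>FM\<^esub> z" using div[of k] by blast
        hence "f \<omega> = [(int p ^ k)] \<cdot>\<^bsub>R\<^esub> z \<omega>"
          using free_module_on_zmul[OF R.cring_axioms z(1)[unfolded FM_def] w] by (simp add: FM_def)
        moreover have "z \<omega> \<in> carrier R" using z(1) w by (auto simp: FMc)
        ultimately show ?thesis by blast
      qed
      moreover have "f \<omega> \<in> carrier R" using f(1) w by (auto simp: FMc)
      ultimately have "f \<omega> = \<zero>\<^bsub>R\<^esub>" using p_separated by blast
      thus "f \<omega> = \<zero>\<^bsub>FM\<^esub> \<omega>" using w by (simp add: FM_def free_module_on_def)
    qed
  qed
  show ?thesis
    unfolding FM_def[symmetric]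
  proof (rule inj_onI)
    fix f g assume fg: "f \<in> carrier FM" "g \<in> carrier FM" "comb f = comb g"
    have "comb (f \<ominus>\<^bsub>FM\<^esub> g) = \<zero>"
      using fg linear_maps_minus[OF FM module_axioms comb fg(1,2)] linear_mapsD(1)[OF comb fg(2)] by simp
    hence "f \<ominus>\<^bsub>FM\<^esub> g = \<zero>\<^bsub>FM\<^esub>" using fg by (intro ker) auto
    thus "f = g" using fg P.minus_eq_zero_iff by blast
  qed
qed

text \<open>
  The basis consists of the translates \<open>s ^^ c\<close> of the selected generators \<open>(k, v)\<close>, with \<open>c < p ^ k\<close>.
\<close>

theorem stable_basis:
  "\<exists>B. finite B \<and> B \<subseteq> carrier M \<and> s ` B \<subseteq> B \<and>
     bij_betw (\<lambda>f. \<Oplus>b\<in>B. f b \<odot> b) (B \<rightarrow>\<^sub>E carrier R) (carrier M)"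
proof -
  obtain I where I: "finite I" "\<And>k v. (k, v) \<in> I \<Longrightarrow> k \<le> n \<and> v \<in> Fix k" "indep I trace"
    and gen: "\<And>j w N. \<lbrakk>j \<le> n; w \<in> Fix j; stable N; snd ` I \<subseteq> N\<rbrakk> \<Longrightarrow>
        \<exists>y\<in>N. \<X> ^ (p ^ j - 1) \<star> w \<approx> \<X> ^ (p ^ j - 1) \<star> y"
    using select_generators[of 0] by fast
  have vM: "v \<in> carrier M" if "(k, v) \<in> I" for k v using I(2)[OF that] Fix_closed by blast
  have p0: "0 < p ^ k" for k using prime_gt_0_nat[OF prime_p] by simp
  \<comment> \<open>indices of the translates, and the permutation of the indices that corresponds to \<open>s\<close>\<close>
  define \<Omega> where "\<Omega> = Sigma I (\<lambda>i. {..<p ^ fst i})"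
  define b :: "(nat \<times> 'm) \<times> nat \<Rightarrow> 'm" where "b = (\<lambda>(i, c). (s ^^ c) (snd i))"
  define \<tau> :: "(nat \<times> 'm) \<times> nat \<Rightarrow> (nat \<times> 'm) \<times> nat" where "\<tau> = (\<lambda>(i, c). (i, Suc c mod p ^ fst i))"
  have fin: "finite \<Omega>" unfolding \<Omega>_def using I(1) by auto
  have bM: "b \<omega> \<in> carrier M" if "\<omega> \<in> \<Omega>" for \<omega>
    using that vM by (auto simp: \<Omega>_def b_def)
  have \<tau>\<Omega>: "\<tau> \<omega> \<in> \<Omega>" if "\<omega> \<in> \<Omega>" for \<omega>
    using that p0 by (auto simp: \<Omega>_def \<tau>_def)
  have \<tau>_pow: "(\<tau> ^^ m) \<omega> = (fst \<omega>, (snd \<omega> + m) mod p ^ fst (fst \<omega>))" if "\<omega> \<in> \<Omega>" for \<omega> m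
    using that by (induction m) (auto simp: \<Omega>_def \<tau>_def mod_Suc_eq)
  have \<tau>_order: "(\<tau> ^^ (p ^ n)) \<omega> = \<omega>" if "\<omega> \<in> \<Omega>" for \<omega>
  proof -
    obtain k v c where \<omega>: "\<omega> = ((k, v), c)" by (metis prod.exhaust)
    have kv: "(k, v) \<in> I" "c < p ^ k" using that by (auto simp: \<omega> \<Omega>_def)
    hence "p ^ k dvd p ^ n" using I(2)[OF kv(1)] by (simp add: le_imp_power_dvd)
    then obtain q where "p ^ n = p ^ k * q" by (rule dvdE)
    thus ?thesis using kv \<tau>_pow[OF that, of "p ^ n"] by (simp add: \<omega>)
  qed
  have inj\<tau>: "inj_on \<tau> \<Omega>"
  proof (rule inj_onI)
    fix x y assume xy: "x \<in> \<Omega>" "y \<in> \<Omega>" "\<tau> x = \<tau> y"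
    obtain m where "p ^ n = Suc m" using p0[of n] gr0_implies_Suc by blast
    hence "x = (\<tau> ^^ m) (\<tau> x)" "y = (\<tau> ^^ m) (\<tau> y)" using \<tau>_order xy(1,2) by (simp_all add: funpow_swap1)
    thus "x = y" using xy(3) by simp
  qed
  have bij\<tau>: "bij_betw \<tau> \<Omega> \<Omega>"
    using inj\<tau> endo_inj_surj[OF fin image_subsetI[OF \<tau>\<Omega>] inj\<tau>] by (simp add: bij_betw_def)
  have b\<tau>: "b (\<tau> \<omega>) = s (b \<omega>)" if "\<omega> \<in> \<Omega>" for \<omega>
  proof -
    obtain k v c where \<omega>: "\<omega> = ((k, v), c)" by (metis prod.exhaust)
    have kv: "(k, v) \<in> I" "c < p ^ k" using that by (auto simp: \<omega> \<Omega>_def)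
    show ?thesis
    proof (cases "Suc c = p ^ k")
      case True
      have "(s ^^ Suc c) v = v" unfolding True using I(2)[OF kv(1)] Fix_iff by blast
      hence "s ((s ^^ c) v) = v" by (simp only: funpow.simps o_apply)
      thus ?thesis using True by (simp add: \<omega> b_def \<tau>_def)
    next
      case False
      hence "Suc c < p ^ k" using kv by simp
      thus ?thesis by (simp add: \<omega> b_def \<tau>_def)
    qed
  qed
  define FM where "FM = free_module_on R \<Omega>"
  define comb where "comb = (\<lambda>f. \<Oplus>\<omega>\<in>\<Omega>. f \<omega> \<odot> b \<omega>)"
  have FMc: "carrier FM = \<Omega> \<rightarrow>\<^sub>E carrier R" by (simp add: FM_def free_module_on_def)
  have FM: "module R FM" unfolding FM_def by (rule module_free_module_on[OF R.cring_axioms])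
  have comb: "comb \<in> linear_maps R FM M"
    unfolding comb_def FM_def using bM by (intro free_module_on_hom[OF module_axioms fin]) auto
  \<comment> \<open>composition with \<open>\<tau>\<close>, which is the inverse of the action of \<open>s\<close> on coefficients; for stability
      both are equally good\<close>
  define sF :: "((nat \<times> 'm) \<times> nat \<Rightarrow> 'r) \<Rightarrow> (nat \<times> 'm) \<times> nat \<Rightarrow> 'r" where "sF = (\<lambda>f. \<lambda>\<omega>\<in>\<Omega>. f (\<tau> \<omega>))"
  have sF: "sF \<in> linear_maps R FM FM"
    using \<tau>\<Omega> by (auto simp: linear_maps_def sF_def FM_def free_module_on_def PiE_iff intro!: restrict_ext)
  have sF_pow: "(sF ^^ m) f \<omega> = f ((\<tau> ^^ m) \<omega>)" if "f \<in> carrier FM" "\<omega> \<in> \<Omega>" for f m \<omega>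
    using that(2) by (induction m arbitrary: \<omega>) (auto simp: sF_def \<tau>\<Omega> funpow_swap1)
  interpret P: p_endo_module R FM sF p n
  proof (intro p_endo_module.intro endo_module.intro module_over.intro FM endo_module_axioms.intro sF
      p_endo_module_axioms.intro prime_p)
    fix f assume f: "f \<in> carrier FM"
    have cl: "(sF ^^ m) f \<in> carrier FM" for m
      using f by (induction m) (auto intro: linear_mapsD(1)[OF sF])
    have "(sF ^^ (p ^ n)) f \<omega> = f \<omega>" if "\<omega> \<in> \<Omega>" for \<omega>
      by (simp only: sF_pow[OF f that] \<tau>_order[OF that])
    with cl f show "(sF ^^ (p ^ n)) f = f" unfolding FMc by (intro PiE_ext)
  qed
  have comb_sF: "s (comb (sF f)) = comb f" if f: "f \<in> carrier FM" for f
  proof -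
    have fR: "f \<omega> \<in> carrier R" if "\<omega> \<in> \<Omega>" for \<omega> using f that by (auto simp: FMc)
    have "s (comb (sF f)) = (\<Oplus>\<omega>\<in>\<Omega>. s (sF f \<omega> \<odot> b \<omega>))"
      unfolding comb_def using bM fR \<tau>\<Omega>
      by (intro linear_maps_finsum[OF module_axioms module_axioms s_linear fin]) (auto simp: sF_def)
    also have "\<dots> = (\<Oplus>\<omega>\<in>\<Omega>. f (\<tau> \<omega>) \<odot> b (\<tau> \<omega>))"
      using bM fR \<tau>\<Omega> b\<tau> by (intro M.finsum_cong') (auto simp: sF_def s_smult)
    also have "\<dots> = (\<Oplus>\<omega>\<in>\<tau> ` \<Omega>. f \<omega> \<odot> b \<omega>)"
    proof (rule M.finsum_reindex[OF _ inj\<tau>, symmetric], rule Pi_I, erule imageE)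
      fix x y assume "x = \<tau> y" "y \<in> \<Omega>"
      thus "f x \<odot> b x \<in> carrier M" using bM[OF \<tau>\<Omega>] fR[OF \<tau>\<Omega>] by simp
    qed
    finally show ?thesis using bij\<tau> by (simp add: comb_def bij_betw_def)
  qed
  \<comment> \<open>\<open>comb\<close> is injective modulo \<open>p\<close>: a relation modulo \<open>p\<close> whose coefficients are fixed modulo \<open>p\<close> has
      constant coefficients on orbits, so it is a relation between traces\<close>
  define K where "K = {f \<in> carrier FM. comb f \<in> pM}"
  have stK: "P.stable K"
    unfolding P.stable_def
  proof (intro conjI ballI P.submoduleI_closed)
    show "\<zero>\<^bsub>FM\<^esub> \<in> K" using linear_maps_zero[OF FM module_axioms comb] submodule_zero[OF submodule_pM]
      by (simp add: K_def)
  next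
    fix f assume f: "f \<in> K"
    have c: "comb (sF f) \<in> carrier M" 
      using f linear_mapsD(1)[OF comb] linear_mapsD(1)[OF sF] by (auto simp: K_def)
    obtain m where m: "p ^ n = Suc m" using p0[of n] gr0_implies_Suc by blast
    have "comb (sF f) = \<T> ^ m \<star> s (comb (sF f))"
      using c s_order[OF c] by (simp add: m poly_act_T_power funpow_swap1)
    also have "\<dots> \<in> pM" using f comb_sF by (intro stable_poly_act[OF stable_pM]) (auto simp: K_def)
    finally show "sF f \<in> K" using f linear_mapsD(1)[OF sF] by (auto simp: K_def)
  qed (auto simp: K_def linear_mapsD[OF comb] intro: submoduleE(4,5)[OF submodule_pM])
  have pFM: "f \<in> P.pM" if f: "f \<in> carrier FM" "\<And>\<omega>. \<omega> \<in> \<Omega> \<Longrightarrow> f \<omega> \<in> pR" for f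
  proof -
    have "\<forall>\<omega>\<in>\<Omega>. \<exists>c\<in>carrier R. f \<omega> = [int p] \<cdot>\<^bsub>R\<^esub> c"
      using f(2) unfolding pR_def by blast
    then obtain z where z: "\<And>\<omega>. \<omega> \<in> \<Omega> \<Longrightarrow> z \<omega> \<in> carrier R" "\<And>\<omega>. \<omega> \<in> \<Omega> \<Longrightarrow> f \<omega> = [int p] \<cdot>\<^bsub>R\<^esub> z \<omega>" by metis
    have zF: "restrict z \<Omega> \<in> carrier FM" using z by (auto simp: FMc)
    have "f = [int p] \<cdot>\<^bsub>FM\<^esub> (restrict z \<Omega>)"
    proof (rule PiE_ext)
      show "f \<in> \<Omega> \<rightarrow>\<^sub>E carrier R" "[int p] \<cdot>\<^bsub>FM\<^esub> (restrict z \<Omega>) \<in> \<Omega> \<rightarrow>\<^sub>E carrier R"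
        using f(1) P.M.zmul_closed[OF zF] unfolding FMc by auto
      fix \<omega> assume "\<omega> \<in> \<Omega>"
      thus "f \<omega> = ([int p] \<cdot>\<^bsub>FM\<^esub> (restrict z \<Omega>)) \<omega>"
        using z free_module_on_zmul[OF R.cring_axioms zF[unfolded FM_def]] by (simp add: FM_def)
    qed
    thus ?thesis using zF P.pM_I by metis
  qed
  have pFMD: "f \<omega> \<in> pR" if f: "f \<in> P.pM" "\<omega> \<in> \<Omega>" for f \<omega>
  proof -
    obtain z where z: "z \<in> carrier FM" "f = [int p] \<cdot>\<^bsub>FM\<^esub> z" using f(1) by (auto simp: P.pM_def)
    hence "f \<omega> = [int p] \<cdot>\<^bsub>R\<^esub> z \<omega>" "z \<omega> \<in> carrier R"
      using free_module_on_zmul[OF R.cring_axioms, of z \<Omega> \<omega> "int p"] f(2) by (auto simp: FM_def free_module_on_def)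
    thus ?thesis by (auto simp: pR_def)
  qed
  have pR_closed: "r \<in> pR \<Longrightarrow> r \<in> carrier R" for r by (auto simp: pR_def R.zmul_closed)
  have pR_add: "x \<oplus>\<^bsub>R\<^esub> y \<in> pR" if xy: "x \<in> pR" "y \<in> pR" for x y
  proof -
    obtain c d where "c \<in> carrier R" "d \<in> carrier R" "x = [int p] \<cdot>\<^bsub>R\<^esub> c" "y = [int p] \<cdot>\<^bsub>R\<^esub> d"
      using xy by (auto simp: pR_def)
    thus ?thesis by (auto simp: pR_def R.zmul_add[symmetric])
  qed
  have KpM: "K \<subseteq> P.pM"
  proof (rule P.stable_in_pM[OF stK])
    fix f assume f: "f \<in> K" and fs: "P.congp (sF f) f"
    have fF: "f \<in> carrier FM" and fp: "comb f \<in> pM" using f by (auto simp: K_def)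
    have fR: "f \<omega> \<in> carrier R" if "\<omega> \<in> \<Omega>" for \<omega> using fF that by (auto simp: FMc)
    obtain z where z: "z \<in> P.pM" "sF f = f \<oplus>\<^bsub>FM\<^esub> z" using fs P.pM_I by (auto simp: P.congp_iff)
    have step: "\<exists>r\<in>pR. f (\<tau> \<omega>) = f \<omega> \<oplus>\<^bsub>R\<^esub> r" if w: "\<omega> \<in> \<Omega>" for \<omega>
    proof -
      have "sF f \<omega> = f \<omega> \<oplus>\<^bsub>R\<^esub> z \<omega>" unfolding z(2) using w by (simp add: FM_def free_module_on_def)
      thus ?thesis using w pFMD[OF z(1) w] by (auto simp: sF_def)
    qed
    have const: "\<exists>r\<in>pR. f (i, c) = f (i, 0) \<oplus>\<^bsub>R\<^esub> r" if i: "i \<in> I" "c < p ^ fst i" for i c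
      using i(2)
    proof (induction c)
      case 0
      have "\<zero>\<^bsub>R\<^esub> \<in> pR" unfolding pR_def using R.zmul_zero[of "int p"] by (metis R.zero_closed image_eqI)
      moreover have "f (i, 0) \<in> carrier R" using i 0 by (intro fR) (auto simp: \<Omega>_def)
      ultimately show ?case by (intro bexI[of _ "\<zero>\<^bsub>R\<^esub>"]) auto
    next
      case (Suc c)
      then obtain r where r: "r \<in> pR" "f (i, c) = f (i, 0) \<oplus>\<^bsub>R\<^esub> r" by auto
      have "(i, c) \<in> \<Omega>" "(i, 0) \<in> \<Omega>" using Suc.prems i prime_gt_0_nat[OF prime_p] by (auto simp: \<Omega>_def)
      moreover have "\<tau> (i, c) = (i, Suc c)" using Suc.prems by (simp add: \<tau>_def)
      ultimately obtain r' where r': "r' \<in> pR" "f (i, Suc c) = f (i, c) \<oplus>\<^bsub>R\<^esub> r'" using step by metis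
      have "f (i, Suc c) = f (i, 0) \<oplus>\<^bsub>R\<^esub> (r \<oplus>\<^bsub>R\<^esub> r')"
        unfolding r'(2) r(2) using r r' pR_closed fR[OF \<open>(i, 0) \<in> \<Omega>\<close>] by (simp add: R.a_assoc)
      thus ?case using pR_add r r' by blast
    qed
    have "comb f = (\<Oplus>i\<in>I. \<Oplus>c\<in>{..<p ^ fst i}. f (i, c) \<odot> b (i, c))"
      unfolding comb_def \<Omega>_def using fR bM I(1)
      by (intro M.finsum_Sigma) (auto simp: \<Omega>_def)
    also have "\<dots> \<approx> (\<Oplus>i\<in>I. f (i, 0) \<odot> trace i)"
    proof (rule congp_finsum[OF I(1)])
      fix i assume i: "i \<in> I"
      have cl: "b (i, c) \<in> carrier M" "f (i, c) \<in> carrier R" if "c < p ^ fst i" for c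
        using bM fR that i by (auto simp: \<Omega>_def)
      have v: "snd i \<in> carrier M" using vM[of "fst i" "snd i"] i by simp
      have "(\<Oplus>c\<in>{..<p ^ fst i}. f (i, c) \<odot> b (i, c)) \<approx> (\<Oplus>c\<in>{..<p ^ fst i}. f (i, 0) \<odot> b (i, c))"
      proof (rule congp_finsum)
        fix c assume c: "c \<in> {..<p ^ fst i}"
        then obtain r where r: "r \<in> pR" "f (i, c) = f (i, 0) \<oplus>\<^bsub>R\<^esub> r" using const[OF i] by auto
        have "f (i, c) \<odot> b (i, c) = f (i, 0) \<odot> b (i, c) \<oplus> r \<odot> b (i, c)"
          unfolding r(2) using r pR_closed cl c p0 by (simp add: smult_l_distr)
        moreover have "r \<odot> b (i, c) \<in> pM" using r cl c by (intro pR_smult) auto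
        ultimately show "f (i, c) \<odot> b (i, c) \<approx> f (i, 0) \<odot> b (i, c)"
          using cl c p0 unfolding congp_iff pM_def by auto
      qed simp
      also have "\<dots> = f (i, 0) \<odot> (\<Oplus>c\<in>{..<p ^ fst i}. b (i, c))"
        using cl p0 by (intro linear_maps_finsum[OF module_axioms module_axioms smult_linear, symmetric]) auto
      also have "(\<Oplus>c\<in>{..<p ^ fst i}. b (i, c)) = trace i"
        using v by (simp add: trace_def Tr_poly_def poly_act_sum b_def poly_act_T_power)
      finally show "(\<Oplus>c\<in>{..<p ^ fst i}. f (i, c) \<odot> b (i, c)) \<approx> f (i, 0) \<odot> trace i" .
    qed
    finally have "(\<Oplus>i\<in>I. f (i, 0) \<odot> trace i) \<approx> comb f" by (rule congp_sym)
    also have "\<dots> \<approx> \<zero>" using fp by (simp add: congp_zero_iff)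
    finally have "(\<Oplus>i\<in>I. f (i, 0) \<odot> trace i) \<in> pM" by (simp add: congp_zero_iff)
    moreover have "(\<lambda>i. f (i, 0)) \<in> I \<rightarrow> carrier R" using fR p0 by (auto simp: \<Omega>_def)
    ultimately have f0: "(\<lambda>i. f (i, 0)) ` I \<subseteq> pR"
      using I(3)[unfolded indep_def, THEN bspec[of _ _ "\<lambda>i. f (i, 0)"]] by blast
    show "f \<in> P.pM"
    proof (rule pFM[OF fF])
      fix \<omega> assume "\<omega> \<in> \<Omega>"
      then obtain i c where ic: "\<omega> = (i, c)" "i \<in> I" "c < p ^ fst i" by (auto simp: \<Omega>_def)
      then obtain r where "r \<in> pR" "f (i, c) = f (i, 0) \<oplus>\<^bsub>R\<^esub> r" using const by blast
      thus "f \<omega> \<in> pR" using ic f0 pR_add by auto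
    qed
  qed
  have inj: "inj_on comb (carrier FM)"
    unfolding FM_def
  proof (rule inj_on_of_inj_mod_p[OF comb[unfolded FM_def]], fold FM_def)
    fix f assume "f \<in> carrier FM" "comb f \<in> pM"
    hence "f \<in> P.pM" using KpM by (auto simp: K_def)
    thus "\<exists>z\<in>carrier FM. f = [int p] \<cdot>\<^bsub>FM\<^esub> z" by (auto simp: P.pM_def)
  qed
  have b_comb: "(\<lambda>x\<in>\<Omega>. if x = \<omega> then \<one>\<^bsub>R\<^esub> else \<zero>\<^bsub>R\<^esub>) \<in> carrier FM"
     "comb (\<lambda>x\<in>\<Omega>. if x = \<omega> then \<one>\<^bsub>R\<^esub> else \<zero>\<^bsub>R\<^esub>) = b \<omega>" if "\<omega> \<in> \<Omega>" for \<omega>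
  proof -
    show "(\<lambda>x\<in>\<Omega>. if x = \<omega> then \<one>\<^bsub>R\<^esub> else \<zero>\<^bsub>R\<^esub>) \<in> carrier FM" by (auto simp: FMc)
    show "comb (\<lambda>x\<in>\<Omega>. if x = \<omega> then \<one>\<^bsub>R\<^esub> else \<zero>\<^bsub>R\<^esub>) = b \<omega>"
      unfolding comb_def using bM by (intro finsum_delta[OF fin that]) auto
  qed
  have st: "stable (comb ` carrier FM)"
    unfolding stable_def
  proof (intro conjI ballI submoduleI_closed)
      show "comb ` carrier FM \<subseteq> carrier M" using linear_mapsD(1)[OF comb] by auto
      show "\<zero> \<in> comb ` carrier FM" using linear_maps_zero[OF FM module_axioms comb] by (metis P.M.zero_closed image_eqI)
    next
      fix x y assume "x \<in> comb ` carrier FM" "y \<in> comb ` carrier FM"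
      thus "x \<oplus> y \<in> comb ` carrier FM" 
        using linear_mapsD(2)[OF comb, symmetric] by (auto intro!: imageI)
    next
      fix r x assume "r \<in> carrier R" "x \<in> comb ` carrier FM"
      thus "r \<odot> x \<in> comb ` carrier FM" 
        using linear_mapsD(3)[OF comb, symmetric] by (auto intro!: imageI)
    next
      fix x assume "x \<in> comb ` carrier FM"
      then obtain f where f: "f \<in> carrier FM" "x = comb f" by blast
      obtain m where m: "p ^ n = Suc m" using p0[of n] gr0_implies_Suc by blast
      define g where "g = (sF ^^ m) f"
      have g: "g \<in> carrier FM" unfolding g_def using f by auto
      have "sF g = f" using P.s_order[OF f(1)] by (simp add: g_def m)
      hence "s x = comb g" using comb_sF[OF g] f(2) by simp
      thus "s x \<in> comb ` carrier FM" using g by blast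
    qed
  have surj: "comb ` carrier FM = carrier M"
  proof (rule stable_spanning[OF st])
    fix j w assume "j \<le> n" "w \<in> Fix j"
    moreover note st
    moreover have "snd ` I \<subseteq> comb ` carrier FM"
    proof
      fix v assume "v \<in> snd ` I"
      then obtain i where i: "i \<in> I" "v = snd i" by blast
      hence "(i, 0) \<in> \<Omega>" using p0 by (auto simp: \<Omega>_def)
      from b_comb[OF this] have "b (i, 0) \<in> comb ` carrier FM" by (metis image_eqI)
      thus "v \<in> comb ` carrier FM" using i by (simp add: b_def)
    qed
    ultimately show "\<exists>y\<in>comb ` carrier FM. \<X> ^ (p ^ j - 1) \<star> w \<approx> \<X> ^ (p ^ j - 1) \<star> y"
      by (rule gen)
  qed
  have injb: "inj_on b \<Omega>"
  proof (rule inj_onI)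
    fix x y assume xy: "x \<in> \<Omega>" "y \<in> \<Omega>" "b x = b y"
    hence "(\<lambda>z\<in>\<Omega>. if z = x then \<one>\<^bsub>R\<^esub> else \<zero>\<^bsub>R\<^esub>) = (\<lambda>z\<in>\<Omega>. if z = y then \<one>\<^bsub>R\<^esub> else \<zero>\<^bsub>R\<^esub>)"
      using b_comb[of x] b_comb[of y] by (intro inj_onD[OF inj]) auto
    from fun_cong[OF this, of x] show "x = y" using xy nontrivial by (auto split: if_splits)
  qed
  \<comment> \<open>distinct indices give distinct elements, by the injectivity of \<open>comb\<close>; so the basis can be
      indexed by itself\<close>
  define B where "B = b ` \<Omega>"
  have "bij_betw comb (\<Omega> \<rightarrow>\<^sub>E carrier R) (carrier M)" using inj surj by (simp add: bij_betw_def FMc)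
  hence "bij_betw (\<lambda>f. \<Oplus>x\<in>B. f x \<odot> x) (B \<rightarrow>\<^sub>E carrier R) (carrier M)"
    unfolding B_def comb_def by (intro free_basis_reindex injb bM)
  moreover have "s ` B \<subseteq> B"
  proof (intro image_subsetI)
    fix x assume "x \<in> B"
    then obtain \<omega> where w: "\<omega> \<in> \<Omega>" "x = b \<omega>" unfolding B_def by blast
    have "b (\<tau> \<omega>) \<in> B" unfolding B_def using \<tau>\<Omega>[OF w(1)] by (rule imageI)
    thus "s x \<in> B" using b\<tau>[OF w(1)] w(2) by simp
  qed
  moreover have "B \<subseteq> carrier M" "finite B"
    unfolding B_def using bM fin by (blast, simp)
  ultimately show ?thesis by blast
qed

end

section \<open>Discrete valuation domains with uniformizer \<open>p\<close>\<close>

locale unramified_dvr = principal_domain R for R :: "('r, 'a) ring_scheme" (structure) +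
  fixes p :: nat
  assumes local: "\<exists>!I. maximalideal I R"
    and max: "maximalideal (PIdl ([p] \<cdot> \<one>)) R"
    and char0: "char_zero R"
    and prime_p: "Factorial_Ring.prime p"
begin

lemma zmul_one_mult: "x \<in> carrier R \<Longrightarrow> x \<otimes> ([p] \<cdot> \<one>) = [int p] \<cdot> x"
  using add_pow_rdistr_int[of x \<one> "int p"] zmul_int[of p \<one>] by simp

lemma PIdl_p: "PIdl ([p] \<cdot> \<one>) = {[int p] \<cdot> x |x. x \<in> carrier R}"
  unfolding cgenideal_def using zmul_one_mult by metis

lemma one_notin: "\<one> \<notin> PIdl ([p] \<cdot> \<one>)"
  using maximalideal.I_notcarr[OF max] ideal.one_imp_carrier[OF maximalideal.axioms(1)[OF max]] by blast

text \<open>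
  A nonzero non-unit has an irreducible divisor, and that generates the only maximal ideal.
\<close>

lemma unit_or_p: 
  assumes r: "r \<in> carrier R"
  shows "r \<in> Units R \<or> (\<exists>c\<in>carrier R. r = [int p] \<cdot> c)"
proof (cases "r \<in> Units R")
  case nu: False
  have "\<exists>c\<in>carrier R. r = [int p] \<cdot> c"
  proof (cases "r = \<zero>")
    case True thus ?thesis by (intro bexI[of _ \<zero>]) auto
  next
    case False
    hence r0: "r \<in> carrier R - {\<zero>}" using r by simp
    obtain b where b: "b \<in> carrier R" "ring_irreducible b" "b divides r"
      by (rule exists_irreducible_divisor[OF r0 nu])
    have "maximalideal (PIdl b) R" using irreducible_imp_maximalideal b by blast
    hence eq: "PIdl b = PIdl ([p] \<cdot> \<one>)" using local max by blast
    obtain c where "c \<in> carrier R" "r = b \<otimes> c" using b(3) by (auto simp: factor_def)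
    hence "c \<in> carrier R" "r = c \<otimes> b" using m_comm[OF b(1)] by auto
    hence "r \<in> PIdl b" unfolding cgenideal_def by blast
    thus ?thesis unfolding eq PIdl_p by blast
  qed
  thus ?thesis ..
qed simp

lemma one_minus_unit:
  assumes a: "a \<in> carrier R" shows "\<one> \<ominus> [int p] \<cdot> a \<in> Units R"
proof (rule ccontr)
  assume "\<one> \<ominus> [int p] \<cdot> a \<notin> Units R"
  then obtain c where c: "c \<in> carrier R" "\<one> \<ominus> [int p] \<cdot> a = [int p] \<cdot> c"
    using unit_or_p[of "\<one> \<ominus> [int p] \<cdot> a"] a zmul_closed by auto
  hence "\<one> = [int p] \<cdot> (c \<oplus> a)" using a by (simp add: minus_eq_iff zmul_add zmul_closed)
  hence "\<one> \<in> PIdl ([p] \<cdot> \<one>)" unfolding PIdl_p using a c by blast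
  thus False using one_notin by contradiction
qed

lemma p_torsion_free:
  assumes "x \<in> carrier R" "[int p] \<cdot> x = \<zero>" shows "x = \<zero>"
proof -
  have "[p] \<cdot> \<one> \<noteq> \<zero>" using char0 prime_gt_0_nat[OF prime_p] by (auto simp: char_zero_def)
  moreover have "x \<otimes> ([p] \<cdot> \<one>) = \<zero>" using zmul_one_mult assms by simp
  ultimately show ?thesis using integral assms(1) by auto
qed

text \<open>
  Dividing by \<open>p\<close> again and again would give an infinite chain of proper divisors.
\<close>

lemma p_separated:
  assumes r: "r \<in> carrier R" "\<And>k. \<exists>c\<in>carrier R. r = [(int p ^ k)] \<cdot> c"
  shows "r = \<zero>"
proof (rule ccontr)
  assume r0: "r \<noteq> \<zero>"
  define D where "D = {r \<in> carrier R. r \<noteq> \<zero> \<and> (\<forall>k. \<exists>c\<in>carrier R. r = [(int p ^ k)] \<cdot> c)}"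
  have "r \<in> D" using r r0 by (simp add: D_def)
  have "wf {(x, y). x \<in> carrier (mult_of R) \<and> y \<in> carrier (mult_of R) \<and> properfactor (mult_of R) x y}"
    by (rule mult_of.division_wellfounded)
  then obtain x where x: "x \<in> D" and min: "\<And>y. (y, x) \<in> {(x, y). x \<in> carrier (mult_of R) \<and> y \<in> carrier (mult_of R) \<and> properfactor (mult_of R) x y} \<Longrightarrow> y \<notin> D"
    using \<open>r \<in> D\<close> by (rule wfE_min) blast
  have xc: "x \<in> carrier R" "x \<noteq> \<zero>" using x by (auto simp: D_def)
  obtain c where c: "c \<in> carrier R" "x = [int p] \<cdot> c"
  proof -
    have "\<exists>c\<in>carrier R. x = [(int p ^ 1)] \<cdot> c" using x unfolding D_def by blast
    thus ?thesis using that by auto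
  qed
  have c0: "c \<noteq> \<zero>" using c xc by auto
  have P: "[p] \<cdot> \<one> \<in> carrier R" by simp
  have xcP: "x = c \<otimes> ([p] \<cdot> \<one>)" using c zmul_one_mult by simp
  have "properfactor (mult_of R) c x"
    unfolding properfactor_def
  proof
    have "[p] \<cdot> \<one> \<noteq> \<zero>" using xcP xc c by auto
    thus "c divides\<^bsub>mult_of R\<^esub> x" unfolding factor_def using xcP P by auto
    show "\<not> x divides\<^bsub>mult_of R\<^esub> c"
    proof
      assume "x divides\<^bsub>mult_of R\<^esub> c"
      then obtain d where d: "d \<in> carrier R" "c = x \<otimes> d" by (auto simp: factor_def)
      have "c \<otimes> (d \<otimes> ([p] \<cdot> \<one>)) = (c \<otimes> ([p] \<cdot> \<one>)) \<otimes> d"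
        using c(1) d(1) P m_comm[OF d(1) P] by (simp only: m_assoc)
      also have "\<dots> = c" using d(2) xcP by simp
      finally have "c \<otimes> \<one> = c \<otimes> (d \<otimes> ([p] \<cdot> \<one>))" using c(1) by simp
      hence "\<one> = d \<otimes> ([p] \<cdot> \<one>)" 
        by (rule iffD1[OF m_lcancel[OF c0 c(1) one_closed m_closed[OF d(1) P]]])
      hence "\<one> \<in> PIdl ([p] \<cdot> \<one>)" unfolding cgenideal_def using d by blast
      thus False using one_notin by contradiction
    qed
  qed
  moreover have "c \<in> D"
  proof -
    have "\<exists>d\<in>carrier R. c = [(int p ^ k)] \<cdot> d" for k
    proof -
      have "\<exists>d\<in>carrier R. x = [(int p ^ Suc k)] \<cdot> d" using x unfolding D_def by blast
      then obtain d where d: "d \<in> carrier R" "x = [(int p ^ Suc k)] \<cdot> d" by blast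
      have "[int p] \<cdot> c = [int p] \<cdot> ([(int p ^ k)] \<cdot> d)"
        using c d zmul_mult[of d "int p" "int p ^ k"] by simp
      hence "[int p] \<cdot> (c \<ominus> [(int p ^ k)] \<cdot> d) = \<zero>" using c d by (simp add: zmul_minus minus_eq_zero_iff)
      hence "c = [(int p ^ k)] \<cdot> d" using p_torsion_free c d by (metis minus_closed minus_eq_zero_iff zmul_closed)
      thus ?thesis using d by blast
    qed
    thus ?thesis using c c0 by (simp add: D_def)
  qed
  ultimately show False using min[of c] c c0 xc by simp
qed

end

text \<open>
  A projective module embeds into the free module on its generators.
\<close>

lemma R_lattice_torsion_free:
  fixes M :: "('r, 'm) module"
  assumes "unramified_dvr R p" and lat: "R_lattice R M" and x: "x \<in> carrier M" "[int p] \<cdot>\<^bsub>M\<^esub> x = \<zero>\<^bsub>M\<^esub>"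
  shows "x = \<zero>\<^bsub>M\<^esub>"
proof -
  interpret R: unramified_dvr R p by fact
  have M: "module R M" using lat by (auto simp: R_lattice_def projective_module_def)
  interpret M: module R M by fact
  obtain A where A: "finite A" "A \<subseteq> carrier M"
    and gen: "\<And>x. x \<in> carrier M \<Longrightarrow> \<exists>a\<in>A \<rightarrow> carrier R. x = (\<Oplus>\<^bsub>M\<^esub>s\<in>A. a s \<odot>\<^bsub>M\<^esub> s)"
    using lat unfolding R_lattice_def finitely_generated_module_def by blast
  let ?F = "free_module_on R A"
  have F: "module R ?F" by (rule module_free_module_on) (rule R.is_cring)
  interpret F: module R ?F by fact
  define \<pi> where "\<pi> = (\<lambda>a. \<Oplus>\<^bsub>M\<^esub>i\<in>A. a i \<odot>\<^bsub>M\<^esub> i)"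
  have \<pi>: "\<pi> \<in> linear_maps R ?F M" unfolding \<pi>_def using A by (intro free_module_on_hom[OF M]) auto
  have surj: "\<pi> ` carrier ?F = carrier M"
  proof
    show "\<pi> ` carrier ?F \<subseteq> carrier M" using linear_mapsD(1)[OF \<pi>] by auto
    show "carrier M \<subseteq> \<pi> ` carrier ?F"
    proof
      fix y assume "y \<in> carrier M"
      then obtain a where a: "a \<in> A \<rightarrow> carrier R" "y = (\<Oplus>\<^bsub>M\<^esub>s\<in>A. a s \<odot>\<^bsub>M\<^esub> s)" using gen by blast
      have "y = \<pi> (restrict a A)"
        unfolding \<pi>_def a(2) using a(1) A by (intro M.M.finsum_cong') (auto simp: Pi_iff)
      moreover have "restrict a A \<in> carrier ?F" using a(1) by (auto simp: free_module_on_def)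
      ultimately show "y \<in> \<pi> ` carrier ?F" by blast
    qed
  qed
  have "projective_module TYPE('m \<Rightarrow> 'r) TYPE('m) R M" by (rule R_lattice_projective[OF lat])
  moreover have "(\<lambda>x. x) \<in> linear_maps R M M" by (auto simp: linear_maps_def)
  ultimately have "\<exists>s\<in>linear_maps R M ?F. \<forall>x\<in>carrier M. \<pi> (s x) = x"
    using F M \<pi> surj unfolding projective_module_def by blast
  then obtain s where s: "s \<in> linear_maps R M ?F" and \<pi>s: "\<And>x. x \<in> carrier M \<Longrightarrow> \<pi> (s x) = x" by blast
  have sx: "s x \<in> carrier ?F" using linear_mapsD(1)[OF s] x by simp
  have ps: "[int p] \<cdot>\<^bsub>?F\<^esub> s x = \<zero>\<^bsub>?F\<^esub>"
    using linear_maps_add_pow[OF M F s x(1), of "int p"] x(2) linear_maps_zero[OF M F s] by simp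
  have "s x = \<zero>\<^bsub>?F\<^esub>"
  proof (rule PiE_ext)
    show "s x \<in> A \<rightarrow>\<^sub>E carrier R" "\<zero>\<^bsub>?F\<^esub> \<in> A \<rightarrow>\<^sub>E carrier R" using sx by (auto simp: free_module_on_def)
    fix i assume i: "i \<in> A"
    have "[int p] \<cdot>\<^bsub>R\<^esub> (s x i) = \<zero>\<^bsub>R\<^esub>"
      using free_module_on_zmul[OF R.is_cring sx i, of "int p"] ps i by (simp add: free_module_on_def)
    moreover have "s x i \<in> carrier R" using sx i by (auto simp: free_module_on_def)
    ultimately show "s x i = \<zero>\<^bsub>?F\<^esub> i" using R.p_torsion_free[of "s x i"] i by (simp add: free_module_on_def)
  qed
  thus ?thesis using \<pi>s[OF x(1)] linear_maps_zero[OF F M \<pi>] by simp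
qed

section \<open>From Mackey functors to lattices with an automorphism\<close>

locale abelian_mackey = cohomological_mackey_functor R G F
  for R :: "('r, 'a) ring_scheme" and G :: "('g, 'b) monoid_scheme" (structure)
    and F :: "('r, 'm, 'g) mackey_functor" +
  assumes comm_G: "comm_group G"
begin

sublocale G: comm_group G by (rule comm_G)

text \<open>
  Over an abelian group conjugation maps every \<open>F\<^sub>U\<close> to itself, and subgroups of the form \<open>\<^sup>gU\<close>
  disappear from the axioms.
\<close>

lemma conj_set_comm: 
  assumes "U \<subseteq> carrier G" "g \<in> carrier G" shows "conj_set G g U = U"
proof -
  have "g \<otimes> u \<otimes> inv g = u" if "u \<in> U" for u
    using assms that by (metis G.inv_solve_right' G.m_comm G.m_closed G.inv_closed subsetD)
  thus ?thesis by (force simp: conj_set_def l_coset_def r_coset_def)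
qed

lemma conj_subgroup [simp]: "\<lbrakk>subgroup U G; g \<in> carrier G\<rbrakk> \<Longrightarrow> conj_set G g U = U"
  by (intro conj_set_comm) (simp add: subgroup.subset)

lemmas triv = G.triv_subgroup

abbreviation "M \<equiv> mf_obj F {\<one>}"
abbreviation "act g \<equiv> mf_con F g {\<one>}"

lemma module_M: "module R M" by (rule obj_module[OF triv])

lemma con_lin: "\<lbrakk>subgroup U G; g \<in> carrier G\<rbrakk> \<Longrightarrow> mf_con F g U \<in> linear_maps R (mf_obj F U) (mf_obj F U)"
  using con_hom[of U g] by simp

lemma con_mult: "\<lbrakk>subgroup U G; g \<in> carrier G; h \<in> carrier G; x \<in> carrier (mf_obj F U)\<rbrakk> \<Longrightarrow>
    mf_con F (h \<otimes> g) U x = mf_con F h U (mf_con F g U x)"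
  using con_con[of U g h x] by simp

lemma con_one: "\<lbrakk>subgroup U G; x \<in> carrier (mf_obj F U)\<rbrakk> \<Longrightarrow> mf_con F \<one> U x = x"
  using con_id[of U "\<one>" x] by (simp add: subgroup.one_closed)

lemma act_lin: "g \<in> carrier G \<Longrightarrow> act g \<in> linear_maps R M M" by (rule con_lin[OF triv])

lemma act_closed: "\<lbrakk>g \<in> carrier G; x \<in> carrier M\<rbrakk> \<Longrightarrow> act g x \<in> carrier M"
  using linear_mapsD(1)[OF act_lin] .

lemma act_pow: "\<lbrakk>g \<in> carrier G; x \<in> carrier M\<rbrakk> \<Longrightarrow> act (g [^] (k::nat)) x = (act g ^^ k) x"
proof (induction k)
  case 0 thus ?case using con_one[OF triv] by simp
next
  case (Suc k)
  have "act (g [^] Suc k) x = act (g \<otimes> g [^] k) x" using Suc.prems G.nat_pow_Suc2 by simp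
  also have "\<dots> = act g (act (g [^] k) x)" using Suc.prems by (intro con_mult[OF triv]) auto
  finally show ?case using Suc by simp
qed

lemma res_bij:
  assumes "type_H0 R G F" "subgroup U G"
  shows "mf_res F U {\<one>} \<in> linear_maps R (mf_obj F U) M"
    "bij_betw (mf_res F U {\<one>}) (carrier (mf_obj F U)) (fixed_points M act U)"
proof -
  show "mf_res F U {\<one>} \<in> linear_maps R (mf_obj F U) M"
    using assms(2) triv by (intro res_hom) (auto simp: subgroup.one_closed)
  show "bij_betw (mf_res F U {\<one>}) (carrier (mf_obj F U)) (fixed_points M act U)"
    using assms unfolding type_H0_def mackey_iso_def h0_def by simp
qed

lemma fixed_points_generated:
  assumes H0: "type_H0 R G F" and U: "subgroup U G" and fg: "finitely_generated_module R (mf_obj F U)"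
  shows "\<exists>A. generated_by R M (fixed_points M act U) A"
proof -
  let ?r = "mf_res F U {\<one>}"
  note r = res_bij[OF H0 U]
  interpret MM: module R M by (rule module_M)
  interpret N: module R "mf_obj F U" by (rule obj_module[OF U])
  obtain A where A: "finite A" "A \<subseteq> carrier (mf_obj F U)"
    and gen: "\<And>x. x \<in> carrier (mf_obj F U) \<Longrightarrow> \<exists>a\<in>A \<rightarrow> carrier R. x = (\<Oplus>\<^bsub>mf_obj F U\<^esub>i\<in>A. a i \<odot>\<^bsub>mf_obj F U\<^esub> i)"
    using fg unfolding finitely_generated_module_def by blast
  have inj: "inj_on ?r A" using r(2) A(2) by (meson bij_betw_imp_inj_on inj_on_subset)
  have img: "?r ` carrier (mf_obj F U) = fixed_points M act U" using r(2) by (simp add: bij_betw_def)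
  have "generated_by R M (fixed_points M act U) (?r ` A)"
    unfolding generated_by_def
  proof (intro conjI ballI)
    show "finite (?r ` A)" using A by simp
    show "?r ` A \<subseteq> fixed_points M act U" using A img by blast
    fix x assume "x \<in> fixed_points M act U"
    then obtain y where y: "y \<in> carrier (mf_obj F U)" "x = ?r y" using img by blast
    obtain a where a: "a \<in> A \<rightarrow> carrier R" "y = (\<Oplus>\<^bsub>mf_obj F U\<^esub>i\<in>A. a i \<odot>\<^bsub>mf_obj F U\<^esub> i)" using gen[OF y(1)] by blast
    define a' where "a' = (\<lambda>z. a (the_inv_into A ?r z))"
    have a'r: "a' (?r i) = a i" if "i \<in> A" for i using the_inv_into_f_f[OF inj that] by (simp add: a'_def)
    have rA: "?r i \<in> carrier M" "i \<in> carrier (mf_obj F U)" "a i \<in> carrier R" if "i \<in> A" for i 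
      using A that linear_mapsD(1)[OF r(1)] a(1) by auto
    have "x = (\<Oplus>\<^bsub>M\<^esub>i\<in>A. ?r (a i \<odot>\<^bsub>mf_obj F U\<^esub> i))"
      unfolding y(2) a(2) using rA
      by (intro linear_maps_finsum[OF obj_module[OF U] module_M r(1) A(1)]) simp
    also have "\<dots> = (\<Oplus>\<^bsub>M\<^esub>i\<in>A. a' (?r i) \<odot>\<^bsub>M\<^esub> ?r i)"
      using rA linear_mapsD(3)[OF r(1)] by (intro MM.M.finsum_cong') (auto simp: a'r)
    also have "\<dots> = (\<Oplus>\<^bsub>M\<^esub>z\<in>?r ` A. a' z \<odot>\<^bsub>M\<^esub> z)"
      using rA a'r by (intro MM.M.finsum_reindex[symmetric] inj) auto
    finally show "\<exists>a\<in>?r ` A \<rightarrow> carrier R. x = (\<Oplus>\<^bsub>M\<^esub>i\<in>?r ` A. a i \<odot>\<^bsub>M\<^esub> i)"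
      using rA a'r by (intro bexI[of _ a']) auto
  qed
  thus ?thesis by blast
qed

text \<open>
  The coset of \<open>f\<close> equals that of \<open>0\<close>, and it contains \<open>f = 0 + f\<close>.
\<close>

lemma H1_trivial_principal:
  assumes "trivial_group (H1 G M act U)" and f: "f \<in> carrier (crossed_homs G M act U)" and U: "subgroup U G"
  shows "\<exists>m\<in>carrier M. \<forall>u\<in>U. f u = act u m \<ominus>\<^bsub>M\<^esub> m"
proof -
  interpret MM: module R M by (rule module_M)
  let ?Z = "crossed_homs G M act U" and ?B = "principal_crossed_homs M act U"
  have "carrier (?Z Mod ?B) = {\<one>\<^bsub>?Z Mod ?B\<^esub>}" using assms(1) by (simp add: trivial_group_def H1_def)
  hence eq: "?B #>\<^bsub>?Z\<^esub> f = ?B" using f by (auto simp: FactGroup_def RCOSETS_def)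
  have fU: "f \<in> U \<rightarrow>\<^sub>E carrier M" using f by (simp add: crossed_homs_def)
  define z where "z = (\<lambda>u\<in>U. act u \<zero>\<^bsub>M\<^esub> \<ominus>\<^bsub>M\<^esub> \<zero>\<^bsub>M\<^esub>)"
  have zB: "z \<in> ?B" unfolding z_def principal_crossed_homs_def by (rule imageI) simp
  have "z \<otimes>\<^bsub>?Z\<^esub> f = f"
  proof (rule PiE_ext[OF _ fU])
    have z0: "z u = \<zero>\<^bsub>M\<^esub>" if "u \<in> U" for u
    proof -
      have "u \<in> carrier G" using that U subgroup.subset by blast
      hence "act u \<zero>\<^bsub>M\<^esub> = \<zero>\<^bsub>M\<^esub>" using linear_maps_zero[OF module_M module_M act_lin] by blast
      thus ?thesis using that by (simp add: z_def)
    qed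
    show "z \<otimes>\<^bsub>?Z\<^esub> f \<in> U \<rightarrow>\<^sub>E carrier M" using fU z0 by (auto simp: crossed_homs_def)
    fix u assume u: "u \<in> U"
    have "f u \<in> carrier M" using fU u by auto
    thus "(z \<otimes>\<^bsub>?Z\<^esub> f) u = f u" using u z0 by (simp add: crossed_homs_def)
  qed
  hence "f \<in> ?B #>\<^bsub>?Z\<^esub> f" unfolding r_coset_def using zB by force
  hence "f \<in> ?B" using eq by simp
  thus ?thesis unfolding principal_crossed_homs_def by auto
qed

text \<open>
  The subgroup \<open>U j\<close> generated by \<open>\<gamma> ^ (p ^ j)\<close> has \<open>Fix j\<close> as its fixed points. An element \<open>m\<close> of norm
  zero defines a crossed homomorphism on \<open>U j\<close> with value \<open>m\<close> at the generator, which is principal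
  because \<open>H\<^sup>1 = 0\<close>.
\<close>

theorem h90_lattice_of_mackey:
  assumes dvr: "unramified_dvr R p" and \<gamma>: "\<gamma> \<in> carrier G" "carrier G = range (\<lambda>k::int. \<gamma> [^] k)"
    and ord: "order G = p ^ n"
    and lat: "\<And>U. subgroup U G \<Longrightarrow> R_lattice R (mf_obj F U)"
    and h90: "hilbert90 R G F"
  shows "h90_lattice R M (act \<gamma>) p n" and "\<And>g. g \<in> carrier G \<Longrightarrow> \<exists>k::nat. g = \<gamma> [^] k"
proof -
  interpret unramified_dvr R p by (rule dvr)
  interpret MM: module R M by (rule module_M)
  have H0: "type_H0 R G F" using h90 by (simp add: hilbert90_def)
  have p0: "0 < p ^ k" for k using prime_gt_0_nat[OF prime_p] by simp
  have \<gamma>_ord: "\<gamma> [^] (p ^ n) = \<one>" using G.pow_order_eq_1[OF \<gamma>(1)] ord by simp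
  have \<gamma>_mod: "\<gamma> [^] k = \<gamma> [^] (k mod p ^ n)" for k :: nat
  proof -
    have "\<gamma> [^] k = \<gamma> [^] (p ^ n * (k div p ^ n) + k mod p ^ n)"
      by (simp only: mult_div_mod_eq)
    also have "\<dots> = (\<gamma> [^] (p ^ n)) [^] (k div p ^ n) \<otimes> \<gamma> [^] (k mod p ^ n)"
      using \<gamma>(1) by (simp only: G.nat_pow_mult G.nat_pow_pow G.nat_pow_closed)
    also have "\<dots> = \<gamma> [^] (k mod p ^ n)"
      using \<gamma>(1) by (simp only: \<gamma>_ord G.nat_pow_one G.l_one G.nat_pow_closed)
    finally show ?thesis .
  qed
  have \<gamma>_nat: "\<exists>k::nat. g = \<gamma> [^] k" if g: "g \<in> carrier G" for g
  proof -
    obtain k :: int where k: "g = \<gamma> [^] k" using g unfolding \<gamma>(2) by blast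
    \<comment> \<open>add a multiple of the order of \<open>\<gamma>\<close> to make the exponent nonnegative\<close>
    define l where "l = k + int (p ^ n) * \<bar>k\<bar>"
    have "1 * \<bar>k\<bar> \<le> int (p ^ n) * \<bar>k\<bar>" using p0[of n] by (intro mult_right_mono) auto
    hence l: "0 \<le> l" unfolding l_def by linarith
    have "\<gamma> [^] l = \<gamma> [^] k \<otimes> (\<gamma> [^] int (p ^ n)) [^] \<bar>k\<bar>"
      unfolding l_def using \<gamma>(1) by (simp only: G.int_pow_mult G.int_pow_pow)
    hence "\<gamma> [^] l = g" using \<gamma>(1) \<gamma>_ord k by (simp only: int_pow_int G.int_pow_one G.r_one G.int_pow_closed)
    hence "g = \<gamma> [^] nat l" using l int_pow_int[of G \<gamma> "nat l"] by simp
    thus ?thesis by blast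
  qed
  thus "\<And>g. g \<in> carrier G \<Longrightarrow> \<exists>k::nat. g = \<gamma> [^] k" .
  have \<gamma>_img: "carrier G = (\<lambda>k. \<gamma> [^] k) ` {..<p ^ n}"
  proof
    show "carrier G \<subseteq> (\<lambda>k. \<gamma> [^] k) ` {..<p ^ n}"
    proof
      fix g assume "g \<in> carrier G"
      then obtain k :: nat where "g = \<gamma> [^] (k mod p ^ n)" using \<gamma>_nat \<gamma>_mod by metis
      thus "g \<in> (\<lambda>k. \<gamma> [^] k) ` {..<p ^ n}" using p0[of n] by auto
    qed
  qed (use \<gamma>(1) in auto)
  have \<gamma>_inj: "inj_on (\<lambda>k. \<gamma> [^] k) {..<p ^ n}"
    using ord \<gamma>_img by (intro eq_card_imp_inj_on) (auto simp: order_def)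
  interpret E: p_endo_module R M "act \<gamma>" p n
  proof (intro p_endo_module.intro endo_module.intro module_over.intro module_M endo_module_axioms.intro 
      p_endo_module_axioms.intro prime_p act_lin \<gamma>(1))
    fix m assume "m \<in> carrier M"
    thus "(act \<gamma> ^^ (p ^ n)) m = m" using act_pow[OF \<gamma>(1), of m "p ^ n"] \<gamma>_ord con_one[OF triv] by simp
  qed
  define U where "U j = range (\<lambda>k::nat. \<gamma> [^] (p ^ j * k))" for j
  have subU: "subgroup (U j) G" for j
  proof (rule G.subgroupI)
    show "U j \<subseteq> carrier G" "U j \<noteq> {}" using \<gamma>(1) by (auto simp: U_def)
    fix u assume "u \<in> U j"
    then obtain k where k: "u = \<gamma> [^] (p ^ j * k)" by (auto simp: U_def)
    \<comment> \<open>the inverse of \<open>u\<close> is its power \<open>u ^ (p ^ n - 1)\<close>\<close>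
    have "\<gamma> [^] (p ^ j * (k * (p ^ n - 1))) \<otimes> u = \<gamma> [^] (p ^ n * (p ^ j * k))"
    proof -
      obtain m where "p ^ n = Suc m" using p0[of n] gr0_implies_Suc by blast
      hence "p ^ j * (k * (p ^ n - 1)) + p ^ j * k = p ^ n * (p ^ j * k)" by simp
      thus ?thesis unfolding k using \<gamma>(1) by (simp only: G.nat_pow_mult)
    qed
    also have "\<dots> = \<one>" using \<gamma>(1) \<gamma>_ord by (simp flip: G.nat_pow_pow)
    finally have "inv u = \<gamma> [^] (p ^ j * (k * (p ^ n - 1)))"
      using \<gamma>(1) k by (intro G.inv_equality) auto
    thus "inv u \<in> U j" unfolding U_def by blast
  next
    fix u v assume "u \<in> U j" "v \<in> U j"
    then obtain k l where "u = \<gamma> [^] (p ^ j * k)" "v = \<gamma> [^] (p ^ j * l)" by (auto simp: U_def)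
    hence "u \<otimes> v = \<gamma> [^] (p ^ j * (k + l))"
      using \<gamma>(1) by (simp only: G.nat_pow_mult distrib_left)
    thus "u \<otimes> v \<in> U j" unfolding U_def by blast
  qed
  have FixU: "E.Fix j = fixed_points M act (U j)" for j
  proof -
    have "act (\<gamma> [^] (p ^ j * k)) m = m" if "(act \<gamma> ^^ (p ^ j)) m = m" "m \<in> carrier M" for m k
    proof -
      have "((act \<gamma> ^^ (p ^ j)) ^^ k) m = m" using that(1) by (induction k) auto
      thus ?thesis using that \<gamma>(1) by (simp add: act_pow funpow_mult mult.commute)
    qed
    moreover have "(act \<gamma> ^^ (p ^ j)) m = m" if "\<And>u. u \<in> U j \<Longrightarrow> act u m = m" "m \<in> carrier M" for m
    proof -
      have "\<gamma> [^] (p ^ j * 1) \<in> U j" unfolding U_def by (rule rangeI)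
      hence "act (\<gamma> [^] (p ^ j)) m = m" using that(1) by simp
      thus ?thesis using that(2) \<gamma>(1) by (simp add: act_pow)
    qed
    ultimately have "m \<in> E.Fix j \<longleftrightarrow> m \<in> fixed_points M act (U j)" for m
      unfolding E.Fix_iff fixed_points_def U_def by blast
    thus ?thesis by blast
  qed
  have H90: "\<exists>m'\<in>carrier M. m = E.poly_act (E.tau j) m'"
    if j: "j \<le> n" and m: "m \<in> carrier M" and N0: "E.poly_act (norm_poly (p ^ j) (p ^ (n - j))) m = \<zero>\<^bsub>M\<^esub>" for j m
  proof -
    define q where "q = p ^ (n - j)"
    have pq: "p ^ j * q = p ^ n" using j by (simp add: q_def flip: power_add)
    have q0: "0 < q" unfolding q_def by (rule p0)
    let ?N = "\<lambda>k. norm_poly (p ^ j) k"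
    have N_add: "E.poly_act (?N (k + l)) m = E.poly_act (?N k) m \<oplus>\<^bsub>M\<^esub> act (\<gamma> [^] (p ^ j * k)) (E.poly_act (?N l) m)" for k l
    proof -
      have "?N (k + l) = ?N k + \<T> ^ (p ^ j * k) * ?N l"
        by (rule norm_poly_add)
      thus ?thesis using m \<gamma>(1) by (simp add: E.poly_act_plus E.poly_act_mult E.poly_act_T_power act_pow)
    qed
    have N_q: "E.poly_act (?N (k + q * l)) m = E.poly_act (?N k) m" for k l
    proof (induction l)
      case (Suc l)
      have "E.poly_act (?N (q + (k + q * l))) m = \<zero>\<^bsub>M\<^esub> \<oplus>\<^bsub>M\<^esub> act (\<gamma> [^] (p ^ j * q)) (E.poly_act (?N (k + q * l)) m)"
        unfolding N_add[of q "k + q * l"] using N0 by (simp add: q_def)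
      also have "\<dots> = E.poly_act (?N (k + q * l)) m" using m \<gamma>_ord con_one[OF triv] by (simp add: pq)
      finally show ?case using Suc by (simp add: algebra_simps)
    qed simp
    \<comment> \<open>the crossed homomorphism has the value \<open>m + u m + \<dots> + u ^ (k - 1) m\<close> at \<open>u ^ k\<close> for
        \<open>u = \<gamma> ^ (p ^ j)\<close>; it is well defined as the norm of \<open>m\<close> is zero\<close>
    define idx where "idx u = (SOME k. u = \<gamma> [^] (p ^ j * k))" for u
    define f where "f = (\<lambda>u\<in>U j. E.poly_act (?N (idx u)) m)"
    have fU: "f (\<gamma> [^] (p ^ j * k)) = E.poly_act (?N k) m" for k
    proof -
      define u where "u = \<gamma> [^] (p ^ j * k)"
      have "u = \<gamma> [^] (p ^ j * idx u)" unfolding idx_def by (rule someI[of _ k]) (simp add: u_def)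
      hence "\<gamma> [^] ((p ^ j * k) mod p ^ n) = \<gamma> [^] ((p ^ j * idx u) mod p ^ n)"
        using \<gamma>_mod u_def by metis
      hence "(p ^ j * k) mod p ^ n = (p ^ j * idx u) mod p ^ n" using p0[of n] by (intro inj_onD[OF \<gamma>_inj]) auto
      hence "p ^ j * (k mod q) = p ^ j * (idx u mod q)" by (simp only: pq[symmetric] mult_mod_right)
      hence "k mod q = idx u mod q" using prime_gt_0_nat[OF prime_p] by simp
      moreover have "E.poly_act (?N l) m = E.poly_act (?N (l mod q)) m" for l
        using N_q[of "l mod q" "l div q"] by (simp add: mult.commute)
      ultimately have "E.poly_act (?N (idx u)) m = E.poly_act (?N k) m" by metis
      moreover have "u \<in> U j" unfolding U_def u_def by (rule rangeI)
      ultimately show ?thesis by (simp add: f_def u_def)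
    qed
    have fZ: "f \<in> carrier (crossed_homs G M act (U j))"
    proof -
      have "f \<in> U j \<rightarrow>\<^sub>E carrier M" using m by (auto simp: f_def)
      moreover have "f (u \<otimes> v) = f u \<oplus>\<^bsub>M\<^esub> act u (f v)" if uv: "u \<in> U j" "v \<in> U j" for u v
      proof -
        obtain k l where kl: "u = \<gamma> [^] (p ^ j * k)" "v = \<gamma> [^] (p ^ j * l)" using uv by (auto simp: U_def)
        have "u \<otimes> v = \<gamma> [^] (p ^ j * (k + l))"
          unfolding kl using \<gamma>(1) by (simp only: G.nat_pow_mult distrib_left)
        thus ?thesis unfolding kl by (simp only: fU N_add)
      qed
      ultimately show ?thesis by (simp add: crossed_homs_def)
    qed
    have "trivial_group (H1 G M act (U j))" using h90 subU[of j] by (simp add: hilbert90_def)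
    then obtain m' where m': "m' \<in> carrier M" "\<And>u. u \<in> U j \<Longrightarrow> f u = act u m' \<ominus>\<^bsub>M\<^esub> m'"
      using H1_trivial_principal[OF _ fZ subU] by blast
    have "\<gamma> [^] (p ^ j * 1) \<in> U j" unfolding U_def by (rule rangeI)
    from m'(2)[OF this] have "E.poly_act (?N 1) m = act (\<gamma> [^] (p ^ j)) m' \<ominus>\<^bsub>M\<^esub> m'" unfolding fU by simp
    moreover have "E.poly_act (?N 1) m = m" using m by (simp add: norm_poly_def)
    moreover have "E.poly_act (E.tau j) m' = act (\<gamma> [^] (p ^ j)) m' \<ominus>\<^bsub>M\<^esub> m'"
      using m'(1) \<gamma>(1) by (simp add: E.tau_def E.poly_act_diff E.poly_act_T_power act_pow)
    ultimately have "m = E.poly_act (E.tau j) m'" by (simp only:)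
    thus ?thesis using m'(1) by blast
  qed
  show "h90_lattice R M (act \<gamma>) p n"
  proof (unfold_locales)
    show "x = \<zero>\<^bsub>M\<^esub>" if "x \<in> carrier M" "[int p] \<cdot>\<^bsub>M\<^esub> x = \<zero>\<^bsub>M\<^esub>" for x
      using R_lattice_torsion_free[OF dvr lat[OF triv] that] .
    show "\<exists>A. generated_by R M (E.Fix j) A" for j
      unfolding FixU using lat[OF subU] by (intro fixed_points_generated[OF H0 subU]) (simp add: R_lattice_def)
  qed (use one_minus_unit H90 unit_or_p p_separated in auto)
qed

end

section \<open>Restriction followed by transfer\<close>

lemma class_representatives:
  assumes "\<And>x. x \<in> A \<Longrightarrow> x \<in> K x" "\<And>x. x \<in> A \<Longrightarrow> K x \<subseteq> A"
    "\<And>x y. \<lbrakk>x \<in> A; y \<in> K x\<rbrakk> \<Longrightarrow> K y = K x"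
  shows "\<exists>D\<subseteq>A. \<forall>a\<in>A. \<exists>!d. d \<in> D \<and> a \<in> K d"
proof -
  define r where "r x = (SOME y. y \<in> K x)" for x
  have r: "r x \<in> K x" if "x \<in> A" for x unfolding r_def using assms(1)[OF that] by (rule someI)
  have Kr: "K (r x) = K x" if "x \<in> A" for x by (rule assms(3)[OF that r[OF that]])
  have "\<exists>!d. d \<in> r ` A \<and> a \<in> K d" if a: "a \<in> A" for a
  proof (rule ex1I[of _ "r a"])
    show "r a \<in> r ` A \<and> a \<in> K (r a)" using a assms(1)[OF a] Kr[OF a] by simp
    fix d assume d: "d \<in> r ` A \<and> a \<in> K d"
    then obtain x where x: "x \<in> A" "d = r x" by blast
    hence "a \<in> K x" using d Kr[OF x(1)] by simp
    hence "K a = K x" by (rule assms(3)[OF x(1)])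
    thus "d = r a" unfolding x(2) r_def by simp
  qed
  moreover have "r ` A \<subseteq> A" using r assms(2) by blast
  ultimately show ?thesis by (intro exI[of _ "r ` A"]) simp
qed

lemma linear_maps_compose:
  "\<lbrakk>f \<in> linear_maps R M N; g \<in> linear_maps R N L\<rbrakk> \<Longrightarrow> (\<lambda>x. g (f x)) \<in> linear_maps R M L"
  by (auto simp: linear_maps_def Pi_iff)

lemma subgroup_mem: "subgroup (H :: 'g set) G \<Longrightarrow> x \<in> H \<Longrightarrow> x \<in> carrier G"
  using subgroup.subset by blast

lemma (in comm_group) double_coset_reps_exist:
  assumes "subgroup W G" "subgroup V G" "W \<subseteq> U" "V \<subseteq> U" "subgroup U G"
  shows "\<exists>D. double_coset_reps G W U V D"
proof -
  define K where "K u = W <#> (u <# V)" for u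
  have K: "x \<in> K u \<longleftrightarrow> (\<exists>w\<in>W. \<exists>v\<in>V. x = u \<otimes> (w \<otimes> v))" if "u \<in> carrier G" for u x
  proof -
    have "w \<otimes> (u \<otimes> v) = u \<otimes> (w \<otimes> v)" if "w \<in> W" "v \<in> V" for w v
      using that \<open>u \<in> carrier G\<close> assms(1,2) by (simp add: m_lcomm subgroup_mem)
    thus ?thesis by (auto simp: K_def set_mult_def l_coset_def)
  qed
  have KI: "u \<otimes> (w \<otimes> v) \<in> K u" if "u \<in> carrier G" "w \<in> W" "v \<in> V" for u w v
    unfolding K[OF that(1)] using that(2,3) by (intro bexI) simp_all
  note WG = subgroup_mem[OF assms(1)] and VG = subgroup_mem[OF assms(2)] and UG = subgroup_mem[OF assms(5)]
  have sub: "K y \<subseteq> K x" if xy: "x \<in> carrier G" "y \<in> K x" for x y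
  proof
    obtain w v where wv: "w \<in> W" "v \<in> V" "y = x \<otimes> (w \<otimes> v)" using xy K[OF xy(1)] by blast
    have yG: "y \<in> carrier G" using wv WG VG xy by simp
    fix z assume "z \<in> K y"
    then obtain w' v' where wv': "w' \<in> W" "v' \<in> V" "z = y \<otimes> (w' \<otimes> v')" using K[OF yG] by blast
    have "z = x \<otimes> ((w \<otimes> w') \<otimes> (v \<otimes> v'))"
      unfolding wv'(3) wv(3) using wv wv' WG VG xy by (simp add: m_ac)
    thus "z \<in> K x"
      using KI[OF xy(1) subgroup.m_closed[OF assms(1) wv(1) wv'(1)] subgroup.m_closed[OF assms(2) wv(2) wv'(2)]] by (simp only:)
  qed
  have symm: "x \<in> K y" if xy: "x \<in> carrier G" "y \<in> K x" for x y
  proof -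
    obtain w v where wv: "w \<in> W" "v \<in> V" "y = x \<otimes> (w \<otimes> v)" using xy K[OF xy(1)] by blast
    have yG: "y \<in> carrier G" using wv WG VG xy by simp
    have "(w \<otimes> v) \<otimes> (inv w \<otimes> inv v) = \<one>"
      using wv WG VG by (simp add: inv_mult[symmetric])
    hence "x = y \<otimes> (inv w \<otimes> inv v)"
      unfolding wv(3) using wv WG VG xy(1) by (simp add: m_assoc)
    thus ?thesis
      using KI[OF yG subgroup.m_inv_closed[OF assms(1) wv(1)] subgroup.m_inv_closed[OF assms(2) wv(2)]] by (simp only:)
  qed
  have KU: "K x \<subseteq> U" if xU: "x \<in> U" for x
  proof
    fix y assume "y \<in> K x"
    then obtain w v where "w \<in> W" "v \<in> V" "y = x \<otimes> (w \<otimes> v)" using K[OF UG[OF xU]] by blast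
    thus "y \<in> U" using xU assms(3,4) subgroup.m_closed[OF assms(5)] by blast
  qed
  have "\<exists>D\<subseteq>U. \<forall>a\<in>U. \<exists>!d. d \<in> D \<and> a \<in> K d"
  proof (rule class_representatives)
    fix x assume x: "x \<in> U"
    show "x \<in> K x" using KI[OF UG[OF x] subgroup.one_closed[OF assms(1)] subgroup.one_closed[OF assms(2)]] UG[OF x] by simp
    show "K x \<subseteq> U" by (rule KU[OF x])
    fix y assume y: "y \<in> K x"
    have "y \<in> carrier G" using KU[OF x] y UG by blast
    thus "K y = K x" using sub[OF UG[OF x] y] sub[OF _ symm[OF UG[OF x] y]] by blast
  qed
  then obtain D where "D \<subseteq> U" "\<forall>a\<in>U. \<exists>!d. d \<in> D \<and> a \<in> K d" by (elim exE conjE)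
  thus ?thesis unfolding double_coset_reps_def K_def by (intro exI[of _ D] conjI)
qed

text \<open>
  The element \<open>t i y\<close> of \<open>F\<^sub>V\<close> for \<open>y\<close> in \<open>F\<^sub>S\<close>. In \<open>h\<^sup>0(R[\<Omega>])\<close>, with \<open>y\<close> a point of \<open>\<Omega>\<close> and \<open>S\<close> its stabilizer, this
  is the sum over the \<open>V\<close>-orbit of \<open>y\<close>.
\<close>

definition spread :: "('r, 'm, 'g) mackey_functor \<Rightarrow> 'g set \<Rightarrow> 'g set \<Rightarrow> 'm \<Rightarrow> 'm" where
  "spread F V S y = mf_tr F (V \<inter> S) V (mf_res F S (V \<inter> S) y)"

lemma spread_hom:
  assumes \<phi>: "\<phi> \<in> mackey_hom R G F Z" and F: "abelian_mackey R G F" and sub: "subgroup V G" "subgroup S G"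
    and y: "y \<in> carrier (mf_obj F S)"
  shows "\<phi> V (spread F V S y) = spread Z V S (\<phi> S y)"
proof -
  interpret F: abelian_mackey R G F by (rule F)
  have VS: "subgroup (V \<inter> S) G" using sub by (rule F.G.subgroups_Inter_pair)
  have "mf_res F S (V \<inter> S) y \<in> carrier (mf_obj F (V \<inter> S))"
    using F.res_hom[OF sub(2) VS] y by (auto simp: linear_maps_def)
  thus ?thesis using \<phi> sub VS y unfolding spread_def mackey_hom_def by simp
qed

context abelian_mackey begin

lemma sub_Int: "\<lbrakk>subgroup V G; subgroup S G\<rbrakk> \<Longrightarrow> subgroup (V \<inter> S) G"
  by (rule G.subgroups_Inter_pair)

lemma res_closed: "\<lbrakk>subgroup U G; subgroup V G; V \<subseteq> U; x \<in> carrier (mf_obj F U)\<rbrakk> \<Longrightarrow>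
    mf_res F U V x \<in> carrier (mf_obj F V)"
  using linear_mapsD(1)[OF res_hom] .

lemma con_closed: "\<lbrakk>subgroup U G; g \<in> carrier G; x \<in> carrier (mf_obj F U)\<rbrakk> \<Longrightarrow>
    mf_con F g U x \<in> carrier (mf_obj F U)"
  using linear_mapsD(1)[OF con_lin] .

lemma con_res: "\<lbrakk>subgroup U G; subgroup V G; V \<subseteq> U; g \<in> carrier G; x \<in> carrier (mf_obj F U)\<rbrakk> \<Longrightarrow>
    mf_con F g V (mf_res F U V x) = mf_res F U V (mf_con F g U x)"
  using res_con[of U V g x] by simp

lemma con_tr: "\<lbrakk>subgroup U G; subgroup V G; V \<subseteq> U; g \<in> carrier G; x \<in> carrier (mf_obj F V)\<rbrakk> \<Longrightarrow>
    mf_con F g U (mf_tr F V U x) = mf_tr F V U (mf_con F g V x)"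
  using tr_con[of U V g x] by simp

lemma spread_linear: "\<lbrakk>subgroup V G; subgroup S G\<rbrakk> \<Longrightarrow> spread F V S \<in> linear_maps R (mf_obj F S) (mf_obj F V)"
  unfolding spread_def by (intro linear_maps_compose[OF res_hom tr_hom] sub_Int) auto

lemma spread_closed: "\<lbrakk>subgroup V G; subgroup S G; y \<in> carrier (mf_obj F S)\<rbrakk> \<Longrightarrow> spread F V S y \<in> carrier (mf_obj F V)"
  using linear_mapsD(1)[OF spread_linear] .

lemma con_spread:
  assumes "subgroup V G" "subgroup S G" "y \<in> carrier (mf_obj F S)" "g \<in> carrier G"
  shows "mf_con F g V (spread F V S y) = spread F V S (mf_con F g S y)"
  using assms sub_Int[OF assms(1,2)] unfolding spread_def
  by (simp add: con_tr con_res res_closed)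

lemma spread_con_id:
  assumes "subgroup V G" "subgroup S G" "y \<in> carrier (mf_obj F S)" "v \<in> V"
  shows "spread F V S (mf_con F v S y) = spread F V S y"
  using assms con_spread[of V S y v] con_id[of V v "spread F V S y"] spread_closed[of V S y]
  by (simp add: subgroup_mem)

text \<open>
  The double coset formula. In a permutation module it says how a \<open>V\<close>-orbit decomposes into
  \<open>W\<close>-orbits.
\<close>

lemma res_spread:
  assumes V: "subgroup V G" and S: "subgroup S G" and W: "subgroup W G" "W \<subseteq> V" and y: "y \<in> carrier (mf_obj F S)"
    and D: "double_coset_reps G W V (V \<inter> S) D"
  shows "mf_res F V W (spread F V S y) = (\<Oplus>\<^bsub>mf_obj F W\<^esub>g\<in>D. spread F W S (mf_con F g S y))"
proof -
  have VS: "subgroup (V \<inter> S) G" and WS: "subgroup (W \<inter> S) G" using V S W by (auto intro: sub_Int)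
  have DG: "g \<in> carrier G" if "g \<in> D" for g using D that V by (auto simp: double_coset_reps_def subgroup_mem)
  interpret MW: module R "mf_obj F W" by (rule obj_module[OF W(1)])
  define x where "x = mf_res F S (V \<inter> S) y"
  have x: "x \<in> carrier (mf_obj F (V \<inter> S))" unfolding x_def using res_closed[OF S VS _ y] by simp
  have "mf_res F V W (spread F V S y) = (\<Oplus>\<^bsub>mf_obj F W\<^esub>g\<in>D.
         mf_tr F (conj_set G g (V \<inter> S) \<inter> W) W
           (mf_con F g ((V \<inter> S) \<inter> conj_set G (inv g) W)
             (mf_res F (V \<inter> S) ((V \<inter> S) \<inter> conj_set G (inv g) W) x)))"
    unfolding spread_def x_def[symmetric] by (rule res_tr[OF V VS W(1) _ W(2) D x]) simp
  also have "\<dots> = (\<Oplus>\<^bsub>mf_obj F W\<^esub>g\<in>D. spread F W S (mf_con F g S y))"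
  proof (rule MW.M.finsum_cong')
    show "(\<lambda>g. spread F W S (mf_con F g S y)) \<in> D \<rightarrow> carrier (mf_obj F W)"
      using DG by (auto intro!: spread_closed con_closed W S y)
    fix g assume g: "g \<in> D"
    have e: "V \<inter> S \<inter> W = W \<inter> S" and sub: "W \<inter> S \<subseteq> V \<inter> S" using W(2) by auto
    show "mf_tr F (conj_set G g (V \<inter> S) \<inter> W) W
           (mf_con F g ((V \<inter> S) \<inter> conj_set G (inv g) W)
             (mf_res F (V \<inter> S) ((V \<inter> S) \<inter> conj_set G (inv g) W) x)) = spread F W S (mf_con F g S y)"
      unfolding conj_subgroup[OF VS DG[OF g]] conj_subgroup[OF W(1) G.inv_closed[OF DG[OF g]]] e spread_def x_def
      using res_res[OF S VS WS sub _ y] con_res[OF S WS _ DG[OF g] y] by simp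
  qed simp
  finally show ?thesis .
qed

text \<open>
  Transitivity of transfers, and axiom \<open>tr_res\<close> for the step from \<open>W \<inter> S\<close> to \<open>V \<inter> S\<close>.
\<close>

lemma tr_spread:
  assumes V: "subgroup V G" and S: "subgroup S G" and W: "subgroup W G" "W \<subseteq> V" and y: "y \<in> carrier (mf_obj F S)"
  shows "mf_tr F W V (spread F W S y) = [card (lcosets\<^bsub>G\<lparr>carrier := V \<inter> S\<rparr>\<^esub> (W \<inter> S))] \<cdot>\<^bsub>mf_obj F V\<^esub> spread F V S y"
proof -
  have VS: "subgroup (V \<inter> S) G" and WS: "subgroup (W \<inter> S) G" using V S W by (auto intro: sub_Int)
  have sub: "W \<inter> S \<subseteq> V \<inter> S" using W(2) by auto
  let ?k = "card (lcosets\<^bsub>G\<lparr>carrier := V \<inter> S\<rparr>\<^esub> (W \<inter> S))"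
  define x where "x = mf_res F S (V \<inter> S) y"
  have x: "x \<in> carrier (mf_obj F (V \<inter> S))" unfolding x_def using res_closed[OF S VS _ y] by simp
  have z: "mf_res F S (W \<inter> S) y = mf_res F (V \<inter> S) (W \<inter> S) x"
    unfolding x_def using res_res[OF S VS WS sub _ y] by simp
  have zc: "mf_res F (V \<inter> S) (W \<inter> S) x \<in> carrier (mf_obj F (W \<inter> S))" by (rule res_closed[OF VS WS sub x])
  have "mf_tr F W V (spread F W S y) = mf_tr F (W \<inter> S) V (mf_res F (V \<inter> S) (W \<inter> S) x)"
    unfolding spread_def z using tr_tr[OF V W(1) WS _ W(2) zc] by simp
  also have "\<dots> = mf_tr F (V \<inter> S) V (mf_tr F (W \<inter> S) (V \<inter> S) (mf_res F (V \<inter> S) (W \<inter> S) x))"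
    using tr_tr[OF V VS WS sub _ zc] by simp
  also have "mf_tr F (W \<inter> S) (V \<inter> S) (mf_res F (V \<inter> S) (W \<inter> S) x) = [?k] \<cdot>\<^bsub>mf_obj F (V \<inter> S)\<^esub> x"
    by (rule tr_res[OF VS WS sub x])
  also have "mf_tr F (V \<inter> S) V ([?k] \<cdot>\<^bsub>mf_obj F (V \<inter> S)\<^esub> x) = [?k] \<cdot>\<^bsub>mf_obj F V\<^esub> mf_tr F (V \<inter> S) V x"
  proof -
    interpret A: module R "mf_obj F V" by (rule obj_module[OF V])
    interpret B: module R "mf_obj F (V \<inter> S)" by (rule obj_module[OF VS])
    show ?thesis
      using linear_maps_add_pow[OF obj_module[OF VS] obj_module[OF V] tr_hom[OF V VS] x, of "int ?k"]
      by (simp add: A.M.zmul_int B.M.zmul_int)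
  qed
  finally show ?thesis by (simp add: spread_def x_def)
qed

end

section \<open>Functors of type \<open>H\<^sup>0\<close> with a permuted basis\<close>

locale permutation_basis = abelian_mackey R G F
  for R :: "('r, 'a) ring_scheme" and G :: "('g, 'b) monoid_scheme" (structure)
    and F :: "('r, 'm, 'g) mackey_functor" +
  fixes B :: "'m set"
  assumes H0: "type_H0 R G F"
    and finite_B: "finite B" and B_M: "B \<subseteq> carrier M"
    and act_B: "\<lbrakk>g \<in> carrier G; b \<in> B\<rbrakk> \<Longrightarrow> act g b \<in> B"
    and basis: "bij_betw (\<lambda>f. \<Oplus>\<^bsub>M\<^esub>b\<in>B. f b \<odot>\<^bsub>M\<^esub> b) (B \<rightarrow>\<^sub>E carrier R) (carrier M)"
    and one_not_zero: "\<one>\<^bsub>R\<^esub> \<noteq> \<zero>\<^bsub>R\<^esub>"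
begin

sublocale M: module R M by (rule module_M)

lemma B_closed: "b \<in> B \<Longrightarrow> b \<in> carrier M" using B_M by blast

definition FM where "FM = free_module_on R B"
definition comb :: "('m \<Rightarrow> 'r) \<Rightarrow> 'm" where "comb f = (\<Oplus>\<^bsub>M\<^esub>b\<in>B. f b \<odot>\<^bsub>M\<^esub> b)"
definition coord :: "'m \<Rightarrow> 'm \<Rightarrow> 'r" where "coord = the_inv_into (B \<rightarrow>\<^sub>E carrier R) comb"

lemma carrier_FM: "carrier FM = B \<rightarrow>\<^sub>E carrier R" by (simp add: FM_def free_module_on_def)
lemma comb_linear: "comb \<in> linear_maps R FM M"
  unfolding comb_def FM_def using finite_B B_M by (intro free_module_on_hom module_M) auto

lemma bij_comb: "bij_betw comb (B \<rightarrow>\<^sub>E carrier R) (carrier M)"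
  using basis unfolding comb_def .

lemma coord_comb: "f \<in> B \<rightarrow>\<^sub>E carrier R \<Longrightarrow> coord (comb f) = f"
  unfolding coord_def by (rule the_inv_into_f_f[OF bij_betw_imp_inj_on[OF bij_comb]])

lemma comb_coord: "m \<in> carrier M \<Longrightarrow> comb (coord m) = m"
  unfolding coord_def by (rule f_the_inv_into_f_bij_betw[OF bij_comb]) 

lemma coord_FM: "m \<in> carrier M \<Longrightarrow> coord m \<in> B \<rightarrow>\<^sub>E carrier R"
  unfolding coord_def using bij_betw_the_inv_into[OF bij_comb] by (auto simp: bij_betw_def)

lemma coord_R: "\<lbrakk>m \<in> carrier M; b \<in> B\<rbrakk> \<Longrightarrow> coord m b \<in> carrier R"
  using coord_FM by blast

lemma coord_eqI: "\<lbrakk>m \<in> carrier M; m' \<in> carrier M; \<And>b. b \<in> B \<Longrightarrow> coord m b = coord m' b\<rbrakk> \<Longrightarrow> m = m'"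
  using comb_coord PiE_ext[OF coord_FM coord_FM] by metis

lemma coord_unique: 
  assumes "f \<in> B \<rightarrow> carrier R" "m = (\<Oplus>\<^bsub>M\<^esub>b\<in>B. f b \<odot>\<^bsub>M\<^esub> b)" "b \<in> B"
  shows "coord m b = f b"
proof -
  have "m = comb (restrict f B)"
    unfolding comb_def assms(2) using assms(1) B_closed by (intro M.M.finsum_cong') (auto simp: Pi_iff)
  moreover have "restrict f B \<in> B \<rightarrow>\<^sub>E carrier R" using assms(1) by auto
  ultimately show ?thesis using coord_comb assms(3) by simp
qed

lemma coord_add: 
  assumes "x \<in> carrier M" "y \<in> carrier M" "b \<in> B"
  shows "coord (x \<oplus>\<^bsub>M\<^esub> y) b = coord x b \<oplus>\<^bsub>R\<^esub> coord y b"
proof -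
  define f where "f = (\<lambda>b\<in>B. coord x b \<oplus>\<^bsub>R\<^esub> coord y b)"
  have f: "f = coord x \<oplus>\<^bsub>FM\<^esub> coord y" by (simp add: f_def FM_def free_module_on_def)
  have fB: "f \<in> B \<rightarrow>\<^sub>E carrier R" using assms coord_R by (auto simp: f_def)
  have "comb f = x \<oplus>\<^bsub>M\<^esub> y"
    unfolding f using linear_mapsD(2)[OF comb_linear] assms coord_FM comb_coord by (simp add: carrier_FM)
  hence "coord (x \<oplus>\<^bsub>M\<^esub> y) = f" using coord_comb[OF fB] by simp
  thus ?thesis using assms(3) by (simp add: f_def)
qed

lemma coord_smult: 
  assumes "r \<in> carrier R" "x \<in> carrier M" "b \<in> B"
  shows "coord (r \<odot>\<^bsub>M\<^esub> x) b = r \<otimes>\<^bsub>R\<^esub> coord x b"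
proof -
  define f where "f = (\<lambda>b\<in>B. r \<otimes>\<^bsub>R\<^esub> coord x b)"
  have f: "f = r \<odot>\<^bsub>FM\<^esub> coord x" by (simp add: f_def FM_def free_module_on_def)
  have fB: "f \<in> B \<rightarrow>\<^sub>E carrier R" using assms coord_R by (auto simp: f_def)
  have "comb f = r \<odot>\<^bsub>M\<^esub> x"
    unfolding f using linear_mapsD(3)[OF comb_linear] assms coord_FM comb_coord by (simp add: carrier_FM)
  hence "coord (r \<odot>\<^bsub>M\<^esub> x) = f" using coord_comb[OF fB] by simp
  thus ?thesis using assms(3) by (simp add: f_def)
qed

lemma coord_B: 
  assumes "c \<in> B" "b \<in> B" shows "coord c b = (if b = c then \<one>\<^bsub>R\<^esub> else \<zero>\<^bsub>R\<^esub>)"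
proof -
  interpret MO: module_over R M by unfold_locales
  have "(\<lambda>x. x) \<in> B \<rightarrow> carrier M" using B_M by blast
  hence "c = (\<Oplus>\<^bsub>M\<^esub>j\<in>B. (\<lambda>j\<in>B. if j = c then \<one>\<^bsub>R\<^esub> else \<zero>\<^bsub>R\<^esub>) j \<odot>\<^bsub>M\<^esub> j)"
    by (rule MO.finsum_delta[OF finite_B assms(1), symmetric])
  from coord_unique[OF _ this assms(2)] show ?thesis using assms(2) by auto
qed

lemma coord_sum:
  assumes "finite O'" "O' \<subseteq> B" "b \<in> B"
  shows "coord (\<Oplus>\<^bsub>M\<^esub>x\<in>O'. x) b = (if b \<in> O' then \<one>\<^bsub>R\<^esub> else \<zero>\<^bsub>R\<^esub>)"
  using assms(1,2)
proof (induction O' rule: finite_induct)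
  case empty
  have "coord \<zero>\<^bsub>M\<^esub> b \<oplus>\<^bsub>R\<^esub> coord \<zero>\<^bsub>M\<^esub> b = coord \<zero>\<^bsub>M\<^esub> b" using coord_add[of "\<zero>\<^bsub>M\<^esub>" "\<zero>\<^bsub>M\<^esub>" b] assms(3) by simp
  hence "coord \<zero>\<^bsub>M\<^esub> b = \<zero>\<^bsub>R\<^esub>" using coord_R[of "\<zero>\<^bsub>M\<^esub>" b] assms(3) by (metis M.M.zero_closed R.add.l_cancel_one)
  thus ?case by simp
next
  case (insert c O')
  have c: "(\<lambda>x. x) \<in> O' \<rightarrow> carrier M" "c \<in> carrier M" using insert.prems B_M by auto
  have "coord (\<Oplus>\<^bsub>M\<^esub>x\<in>insert c O'. x) b = coord c b \<oplus>\<^bsub>R\<^esub> coord (\<Oplus>\<^bsub>M\<^esub>x\<in>O'. x) b"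
    using c insert.hyps assms(3) by (simp add: M.M.finsum_insert coord_add M.M.finsum_closed)
  also have "\<dots> = (if b \<in> insert c O' then \<one>\<^bsub>R\<^esub> else \<zero>\<^bsub>R\<^esub>)"
    using insert coord_B[of c b] assms(3) by auto
  finally show ?case .
qed

lemma act_inv: "\<lbrakk>g \<in> carrier G; x \<in> carrier M\<rbrakk> \<Longrightarrow> act (inv g) (act g x) = x"
  using con_mult[OF triv, of g "inv g" x] con_one[OF triv, of x] by simp

lemma act_inv2: "\<lbrakk>g \<in> carrier G; x \<in> carrier M\<rbrakk> \<Longrightarrow> act g (act (inv g) x) = x"
  using con_mult[OF triv, of "inv g" g x] con_one[OF triv, of x] by simp

lemma act_bij: "g \<in> carrier G \<Longrightarrow> bij_betw (act g) B B"
  by (rule bij_betwI[where g = "act (inv g)"]) (auto simp: act_B act_inv act_inv2 B_closed)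

lemma coord_act:
  assumes g: "g \<in> carrier G" and m: "m \<in> carrier M" and b: "b \<in> B"
  shows "coord (act g m) (act g b) = coord m b"
proof -
  let ?h = "act (inv g)"
  have h: "inv g \<in> carrier G" using g by simp
  have hB: "?h b \<in> B" if "b \<in> B" for b by (rule act_B[OF h that])
  have "act g m = act g (comb (coord m))" using comb_coord[OF m] by simp
  also have "\<dots> = (\<Oplus>\<^bsub>M\<^esub>b\<in>B. act g (coord m b \<odot>\<^bsub>M\<^esub> b))"
    unfolding comb_def using coord_R[OF m] B_closed
    by (intro linear_maps_finsum[OF module_M module_M act_lin[OF g] finite_B]) auto
  also have "\<dots> = (\<Oplus>\<^bsub>M\<^esub>b\<in>B. coord m (?h (act g b)) \<odot>\<^bsub>M\<^esub> act g b)"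
    using coord_R[OF m] B_closed act_closed[OF g] linear_mapsD(3)[OF act_lin[OF g]]
    by (intro M.M.finsum_cong') (auto simp: act_inv[OF g])
  also have "\<dots> = (\<Oplus>\<^bsub>M\<^esub>b\<in>act g ` B. coord m (?h b) \<odot>\<^bsub>M\<^esub> b)"
    using act_bij[OF g] coord_R[OF m] B_closed act_B[OF g] hB
    by (intro M.M.finsum_reindex[symmetric]) (auto simp: bij_betw_def)
  also have "act g ` B = B" using act_bij[OF g] by (simp add: bij_betw_def)
  finally have "coord (act g m) (act g b) = coord m (?h (act g b))"
    by (intro coord_unique) (use coord_R[OF m] hB act_B[OF g b] in auto)
  thus ?thesis using act_inv[OF g B_closed[OF b]] by simp
qed

text \<open>
  Over an abelian group all points of an orbit have the same stabilizer (\<open>stab_act\<close>), so an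
  equivariant family of elements \<open>y b\<close> of \<open>Y\<close> at \<open>stab b\<close> can be moved around by conjugation without
  changing the subgroup.
\<close>

definition stab :: "'m \<Rightarrow> 'g set" where "stab b = {g \<in> carrier G. act g b = b}"

lemma stab_subgroup: assumes "b \<in> B" shows "subgroup (stab b) G"
proof (rule G.subgroupI)
  have b: "b \<in> carrier M" using assms by (rule B_closed)
  show "stab b \<noteq> {}" using con_one[OF triv b] by (auto simp: stab_def)
  fix g assume g: "g \<in> stab b"
  thus "inv g \<in> stab b" using act_inv[of g b] b by (auto simp: stab_def)
  fix h assume "h \<in> stab b"
  thus "g \<otimes> h \<in> stab b" using g con_mult[OF triv _ _ b, of h g] by (simp add: stab_def)
qed (auto simp: stab_def)

lemma stab_act: assumes "b \<in> B" "g \<in> carrier G" shows "stab (act g b) = stab b"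
proof -
  have "act h (act g b) = act g b \<longleftrightarrow> act h b = b" if h: "h \<in> carrier G" for h
  proof -
    have b: "b \<in> carrier M" using assms B_closed by blast
    have "act h (act g b) = act g (act h b)"
      using con_mult[OF triv, of g h b] con_mult[OF triv, of h g b] G.m_comm[OF h assms(2)] h assms b by simp
    moreover have "act g (act h b) = act g b \<longleftrightarrow> act h b = b"
      using act_inv[OF assms(2) b] act_inv[OF assms(2) act_closed[OF h b]] by metis
    ultimately show ?thesis by simp
  qed
  thus ?thesis by (auto simp: stab_def)
qed

abbreviation "res1 U \<equiv> mf_res F U {\<one>}"

lemma res1_lin: "subgroup U G \<Longrightarrow> res1 U \<in> linear_maps R (mf_obj F U) M"
  by (rule res_bij(1)[OF H0])

lemma res1_closed: "subgroup U G \<Longrightarrow> x \<in> carrier (mf_obj F U) \<Longrightarrow> res1 U x \<in> carrier M"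
  using linear_mapsD(1)[OF res1_lin] .

lemma res1_inj: "\<lbrakk>subgroup U G; x \<in> carrier (mf_obj F U); y \<in> carrier (mf_obj F U); res1 U x = res1 U y\<rbrakk> \<Longrightarrow> x = y"
  using res_bij(2)[OF H0] by (auto simp: bij_betw_def inj_on_def)

lemma one_sub: "subgroup U G \<Longrightarrow> {\<one>} \<subseteq> U" using subgroup.one_closed by blast

lemma res1_con: "\<lbrakk>subgroup U G; g \<in> carrier G; x \<in> carrier (mf_obj F U)\<rbrakk> \<Longrightarrow> res1 U (mf_con F g U x) = act g (res1 U x)"
  using con_res[OF _ triv one_sub, of U g x] by simp

lemma res1_fixed: "\<lbrakk>subgroup U G; x \<in> carrier (mf_obj F U); u \<in> U\<rbrakk> \<Longrightarrow> act u (res1 U x) = res1 U x"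
  using res1_con[of U u x] con_id[of U u x] by (simp add: subgroup_mem)

text \<open>
  The preimage of \<open>b\<close> under the injective restriction map; in other words \<open>b\<close> as a fixed point of its
  stabilizer.
\<close>

definition stab_gen :: "'m \<Rightarrow> 'm" where "stab_gen b = the_inv_into (carrier (mf_obj F (stab b))) (res1 (stab b)) b"

lemma stab_gen: assumes "b \<in> B" shows "stab_gen b \<in> carrier (mf_obj F (stab b))" "res1 (stab b) (stab_gen b) = b"
proof -
  have "b \<in> fixed_points M act (stab b)" using B_closed[OF assms] by (simp add: fixed_points_def stab_def)
  note b = this and bij = res_bij(2)[OF H0 stab_subgroup[OF assms]]
  show "stab_gen b \<in> carrier (mf_obj F (stab b))"
    unfolding stab_gen_def using bij_betw_apply[OF bij_betw_the_inv_into[OF bij] b] .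
  show "res1 (stab b) (stab_gen b) = b"
    unfolding stab_gen_def by (rule f_the_inv_into_f_bij_betw[OF bij b])
qed

lemma con_stab_gen: assumes "b \<in> B" "g \<in> carrier G" shows "mf_con F g (stab b) (stab_gen b) = stab_gen (act g b)"
proof (rule res1_inj[OF stab_subgroup[OF assms(1)]])
  show "mf_con F g (stab b) (stab_gen b) \<in> carrier (mf_obj F (stab b))"
    using assms stab_gen stab_subgroup by (intro con_closed) auto
  show "stab_gen (act g b) \<in> carrier (mf_obj F (stab b))" using stab_gen(1)[OF act_B[OF assms(2,1)]] stab_act[OF assms] by simp
  show "res1 (stab b) (mf_con F g (stab b) (stab_gen b)) = res1 (stab b) (stab_gen (act g b))"
    using stab_gen(2)[OF act_B[OF assms(2,1)]] stab_act[OF assms] res1_con[OF stab_subgroup[OF assms(1)] assms(2) stab_gen(1)[OF assms(1)]]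
      stab_gen(2)[OF assms(1)] by simp
qed

definition orbit_gen :: "'g set \<Rightarrow> 'm \<Rightarrow> 'm" where "orbit_gen V b = spread F V (stab b) (stab_gen b)"

lemma orbit_gen_closed: "\<lbrakk>subgroup V G; b \<in> B\<rbrakk> \<Longrightarrow> orbit_gen V b \<in> carrier (mf_obj F V)"
  unfolding orbit_gen_def by (intro spread_closed stab_subgroup stab_gen)

definition orb :: "'g set \<Rightarrow> 'm \<Rightarrow> 'm set" where "orb V b = (\<lambda>v. act v b) ` V"

lemma orb_B: "\<lbrakk>subgroup V G; b \<in> B\<rbrakk> \<Longrightarrow> orb V b \<subseteq> B"
  unfolding orb_def by (intro image_subsetI act_B) (rule subgroup_mem)

lemma orb_eq: assumes "subgroup V G" "b \<in> B" "c \<in> orb V b" shows "orb V c = orb V b"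
proof -
  have sub: "orb V (act v b) \<subseteq> orb V b" if "v \<in> V" "b \<in> B" for v b
  proof
    fix x assume "x \<in> orb V (act v b)"
    then obtain w where w: "w \<in> V" "x = act w (act v b)" by (auto simp: orb_def)
    have G: "v \<in> carrier G" "w \<in> carrier G" using that(1) w(1) by (simp_all add: subgroup_mem[OF assms(1)])
    have "x = act (w \<otimes> v) b" using con_mult[OF triv G B_closed[OF that(2)]] w(2) by simp
    thus "x \<in> orb V b" unfolding orb_def using subgroup.m_closed[OF assms(1) w(1) that(1)] by (rule image_eqI)
  qed
  obtain v where v: "v \<in> V" "c = act v b" using assms(3) by (auto simp: orb_def)
  have vG: "v \<in> carrier G" using v(1) by (rule subgroup_mem[OF assms(1)])
  have "b = act (inv v) c" using act_inv[OF vG B_closed[OF assms(2)]] v by simp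
  hence "orb V b \<subseteq> orb V c"
    using sub[OF subgroup.m_inv_closed[OF assms(1) v(1)], of c] act_B[OF vG assms(2)] v(2) by simp
  thus ?thesis using sub[OF v(1) assms(2)] v(2) by auto
qed

lemma orb_self: "\<lbrakk>subgroup V G; b \<in> B\<rbrakk> \<Longrightarrow> b \<in> orb V b"
  unfolding orb_def using con_one[OF triv B_closed, of b] subgroup.one_closed by (metis image_eqI)

text \<open>
  The double coset formula for the trivial subgroup: representatives of \<open>V\<close> modulo the stabilizer
  correspond to the points of the orbit.
\<close>

lemma res1_orbit_gen:
  assumes V: "subgroup V G" and b: "b \<in> B"
  shows "res1 V (orbit_gen V b) = (\<Oplus>\<^bsub>M\<^esub>x\<in>orb V b. x)"
proof -
  let ?S = "stab b"
  have S: "subgroup ?S G" by (rule stab_subgroup[OF b])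
  have VS: "subgroup (V \<inter> ?S) G" by (rule sub_Int[OF V S])
  have bM: "b \<in> carrier M" by (rule B_closed[OF b])
  obtain D where D: "double_coset_reps G {\<one>} V (V \<inter> ?S) D"
    using G.double_coset_reps_exist[OF triv VS one_sub[OF V] _ V] by auto
  have DV: "D \<subseteq> V" using D by (simp add: double_coset_reps_def)
  have VG: "v \<in> carrier G" if "v \<in> V" for v using V that by (rule subgroup_mem)
  have ex: "\<exists>!d. d \<in> D \<and> (\<exists>k\<in>V \<inter> ?S. u = d \<otimes> k)" if "u \<in> V" for u
  proof -
    have "u \<in> {\<one>} <#> (d <# (V \<inter> ?S)) \<longleftrightarrow> (\<exists>k\<in>V \<inter> ?S. u = d \<otimes> k)" if "d \<in> D" for d
      using VG DV that by (auto simp: set_mult_def l_coset_def)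
    moreover have "\<exists>!d. d \<in> D \<and> u \<in> {\<one>} <#> (d <# (V \<inter> ?S))"
      using D \<open>u \<in> V\<close> by (simp add: double_coset_reps_def)
    ultimately show ?thesis by (smt (verit, del_insts))
  qed
  have "res1 V (orbit_gen V b) = (\<Oplus>\<^bsub>M\<^esub>g\<in>D. spread F {\<one>} ?S (mf_con F g ?S (stab_gen b)))"
    unfolding orbit_gen_def by (rule res_spread[OF V S triv one_sub[OF V] stab_gen(1)[OF b] D])
  also have "\<dots> = (\<Oplus>\<^bsub>M\<^esub>g\<in>D. act g b)"
  proof (rule M.M.finsum_cong')
    show "(\<lambda>g. act g b) \<in> D \<rightarrow> carrier M" using DV VG act_closed bM by blast
    fix g assume "g \<in> D"
    hence g: "g \<in> carrier G" using DV VG by blast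
    have e: "{\<one>} \<inter> ?S = {\<one>}" using one_sub[OF S] by auto
    have c: "mf_con F g ?S (stab_gen b) \<in> carrier (mf_obj F ?S)" by (rule con_closed[OF S g stab_gen(1)[OF b]])
    have "spread F {\<one>} ?S (mf_con F g ?S (stab_gen b)) = res1 ?S (mf_con F g ?S (stab_gen b))"
      unfolding spread_def e by (rule tr_id[OF triv res1_closed[OF S c]])
    also have "\<dots> = act g b" using res1_con[OF S g stab_gen(1)[OF b]] stab_gen(2)[OF b] by simp
    finally show "spread F {\<one>} ?S (mf_con F g ?S (stab_gen b)) = act g b" .
  qed simp
  also have "\<dots> = (\<Oplus>\<^bsub>M\<^esub>x\<in>(\<lambda>g. act g b) ` D. x)"
  proof (rule M.M.finsum_reindex[symmetric])
    show "(\<lambda>x. x) \<in> (\<lambda>g. act g b) ` D \<rightarrow> carrier M" using DV VG act_closed bM by blast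
    show "inj_on (\<lambda>g. act g b) D"
    proof (rule inj_onI)
      fix g h assume gh: "g \<in> D" "h \<in> D" "act g b = act h b"
      have V2: "g \<in> V" "h \<in> V" using gh DV by auto
      have G2: "g \<in> carrier G" "h \<in> carrier G" using V2 VG by auto
      define k where "k = inv g \<otimes> h"
      have "act k b = b"
        unfolding k_def using con_mult[OF triv G2(2) G.inv_closed[OF G2(1)] bM] gh(3) act_inv[OF G2(1) bM] by simp
      hence k: "k \<in> V \<inter> ?S" using G2 V2 subgroup.m_closed[OF V] subgroup.m_inv_closed[OF V] by (simp add: k_def stab_def)
      have "h = g \<otimes> k" using G2 by (simp add: k_def G.m_assoc[symmetric])
      moreover have "h = h \<otimes> \<one>" "\<one> \<in> V \<inter> ?S" using G2 one_sub[OF VS] by auto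
      ultimately show "g = h" using ex[OF V2(2)] gh(1,2) k by blast
    qed
  qed
  also have "(\<lambda>g. act g b) ` D = orb V b"
  proof
    show "(\<lambda>g. act g b) ` D \<subseteq> orb V b" using DV by (auto simp: orb_def)
    show "orb V b \<subseteq> (\<lambda>g. act g b) ` D"
    proof
      fix x assume "x \<in> orb V b"
      then obtain v where v: "v \<in> V" "x = act v b" by (auto simp: orb_def)
      obtain d k where dk: "d \<in> D" "k \<in> V \<inter> ?S" "v = d \<otimes> k" using ex1_implies_ex[OF ex[OF v(1)]] by blast
      have G2: "d \<in> carrier G" "k \<in> carrier G" using dk DV VG by auto
      have "x = act d (act k b)" using con_mult[OF triv G2(2,1) bM] dk v by simp
      also have "act k b = b" using dk by (simp add: stab_def)
      finally show "x \<in> (\<lambda>g. act g b) ` D" using dk by blast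
    qed
  qed
  finally show ?thesis .
qed

lemma coord_orbit_gen:
  assumes "subgroup V G" "b \<in> B" "c \<in> B"
  shows "coord (res1 V (orbit_gen V b)) c = (if c \<in> orb V b then \<one>\<^bsub>R\<^esub> else \<zero>\<^bsub>R\<^esub>)"
  unfolding res1_orbit_gen[OF assms(1,2)]
  using assms orb_B[OF assms(1,2)] finite_subset[OF orb_B finite_B] by (intro coord_sum) auto


section \<open>Orbit sums as a basis, and projectivity\<close>

lemma coord_zero: "b \<in> B \<Longrightarrow> coord \<zero>\<^bsub>M\<^esub> b = \<zero>\<^bsub>R\<^esub>"
  using coord_sum[of "{}" b] by simp

lemma coord_finsum:
  assumes "finite A" "a \<in> A \<rightarrow> carrier R" "m \<in> A \<rightarrow> carrier M" "b \<in> B"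
  shows "coord (\<Oplus>\<^bsub>M\<^esub>i\<in>A. a i \<odot>\<^bsub>M\<^esub> m i) b = (\<Oplus>\<^bsub>R\<^esub>i\<in>A. a i \<otimes>\<^bsub>R\<^esub> coord (m i) b)"
  using assms(1-3)
proof (induction A rule: finite_induct)
  case empty thus ?case by (simp add: coord_zero[OF assms(4)])
next
  case (insert i A)
  have cl: "a i \<in> carrier R" "m i \<in> carrier M" "a \<in> A \<rightarrow> carrier R" "m \<in> A \<rightarrow> carrier M" using insert.prems by auto
  have s: "(\<lambda>i. a i \<odot>\<^bsub>M\<^esub> m i) \<in> A \<rightarrow> carrier M" using cl by (auto simp: Pi_iff)
  have t: "(\<lambda>i. a i \<otimes>\<^bsub>R\<^esub> coord (m i) b) \<in> A \<rightarrow> carrier R" using cl coord_R assms(4) by (auto simp: Pi_iff)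
  have ti: "a i \<otimes>\<^bsub>R\<^esub> coord (m i) b \<in> carrier R" using cl coord_R assms(4) by auto
  have "coord (\<Oplus>\<^bsub>M\<^esub>i\<in>insert i A. a i \<odot>\<^bsub>M\<^esub> m i) b
      = coord (a i \<odot>\<^bsub>M\<^esub> m i) b \<oplus>\<^bsub>R\<^esub> coord (\<Oplus>\<^bsub>M\<^esub>i\<in>A. a i \<odot>\<^bsub>M\<^esub> m i) b"
    using M.M.finsum_insert[OF insert.hyps s] cl M.M.finsum_closed[OF s] assms(4) by (simp add: coord_add)
  also have "\<dots> = a i \<otimes>\<^bsub>R\<^esub> coord (m i) b \<oplus>\<^bsub>R\<^esub> (\<Oplus>\<^bsub>R\<^esub>i\<in>A. a i \<otimes>\<^bsub>R\<^esub> coord (m i) b)"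
    using insert.IH[OF cl(3,4)] cl assms(4) by (simp add: coord_smult)
  also have "\<dots> = (\<Oplus>\<^bsub>R\<^esub>i\<in>insert i A. a i \<otimes>\<^bsub>R\<^esub> coord (m i) b)"
    using R.finsum_insert[OF insert.hyps t ti] by simp
  finally show ?case .
qed

definition reps :: "'g set \<Rightarrow> 'm set" where
  "reps V = (SOME D. D \<subseteq> B \<and> (\<forall>b\<in>B. \<exists>!r. r \<in> D \<and> b \<in> orb V r))"

lemma reps:
  assumes V: "subgroup V G"
  shows "reps V \<subseteq> B" "b \<in> B \<Longrightarrow> \<exists>!r. r \<in> reps V \<and> b \<in> orb V r"
proof -
  have "\<exists>D\<subseteq>B. \<forall>b\<in>B. \<exists>!r. r \<in> D \<and> b \<in> orb V r"
    by (rule class_representatives) (fact orb_self[OF V] orb_B[OF V] orb_eq[OF V])+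
  then obtain D where "D \<subseteq> B \<and> (\<forall>b\<in>B. \<exists>!r. r \<in> D \<and> b \<in> orb V r)" by (elim exE)
  hence "reps V \<subseteq> B \<and> (\<forall>b\<in>B. \<exists>!r. r \<in> reps V \<and> b \<in> orb V r)" unfolding reps_def by (rule someI)
  thus "reps V \<subseteq> B" "b \<in> B \<Longrightarrow> \<exists>!r. r \<in> reps V \<and> b \<in> orb V r" by auto
qed

lemma finite_reps: "subgroup V G \<Longrightarrow> finite (reps V)"
  using reps(1) finite_B by (rule finite_subset)

lemma orb_sym: assumes "subgroup V G" "b \<in> B" "c \<in> orb V b" shows "b \<in> orb V c"
  using orb_eq[OF assms] orb_self[OF assms(1,2)] by simp

text \<open>
  Conjugation by an element of \<open>V\<close> is the identity on the value at \<open>V\<close>.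
\<close>

lemma orbit_gen_orb:
  assumes V: "subgroup V G" and b: "b \<in> B" "c \<in> orb V b"
    and Y: "abelian_mackey R G Y" and y: "\<And>b. b \<in> B \<Longrightarrow> y b \<in> carrier (mf_obj Y (stab b))"
    and con_y: "\<And>b g. \<lbrakk>b \<in> B; g \<in> carrier G\<rbrakk> \<Longrightarrow> mf_con Y g (stab b) (y b) = y (act g b)"
  shows "spread Y V (stab c) (y c) = spread Y V (stab b) (y b)"
proof -
  interpret Y: abelian_mackey R G Y by (rule Y)
  obtain v where v: "v \<in> V" "c = act v b" using b(2) by (auto simp: orb_def)
  have vG: "v \<in> carrier G" using v(1) by (rule subgroup_mem[OF V])
  have "spread Y V (stab c) (y c) = spread Y V (stab b) (mf_con Y v (stab b) (y b))"
    using con_y[OF b(1) vG] stab_act[OF b(1) vG] v(2) by simp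
  thus ?thesis using Y.spread_con_id[OF V stab_subgroup[OF b(1)] y[OF b(1)] v(1)] by simp
qed

lemma coord_res1_orb:
  assumes V: "subgroup V G" and x: "x \<in> carrier (mf_obj F V)" and b: "b \<in> B" "c \<in> orb V b"
  shows "coord (res1 V x) c = coord (res1 V x) b"
proof -
  obtain v where v: "v \<in> V" "c = act v b" using b(2) by (auto simp: orb_def)
  have vG: "v \<in> carrier G" using v(1) by (rule subgroup_mem[OF V])
  show ?thesis using coord_act[OF vG res1_closed[OF V x] b(1)] res1_fixed[OF V x v(1)] v(2) by simp
qed

text \<open>
  The elements \<open>orbit_gen V r\<close> restrict to the orbit sums, and the coordinates of a \<open>V\<close>-fixed element
  are constant on \<open>V\<close>-orbits.
\<close>

lemma expand:
  assumes V: "subgroup V G" and x: "x \<in> carrier (mf_obj F V)"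
  shows "x = (\<Oplus>\<^bsub>mf_obj F V\<^esub>r\<in>reps V. coord (res1 V x) r \<odot>\<^bsub>mf_obj F V\<^esub> orbit_gen V r)" (is "x = ?s")
proof -
  interpret N: module R "mf_obj F V" by (rule obj_module[OF V])
  have rB: "r \<in> B" if "r \<in> reps V" for r using reps(1)[OF V] that by blast
  have c: "coord (res1 V x) r \<in> carrier R" "orbit_gen V r \<in> carrier (mf_obj F V)" if "r \<in> reps V" for r
    using coord_R[OF res1_closed[OF V x] rB[OF that]] orbit_gen_closed[OF V rB[OF that]] by auto
  have s: "?s \<in> carrier (mf_obj F V)" using c by (intro N.M.finsum_closed) auto
  have e: "res1 V ?s = (\<Oplus>\<^bsub>M\<^esub>r\<in>reps V. coord (res1 V x) r \<odot>\<^bsub>M\<^esub> res1 V (orbit_gen V r))"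
  proof -
    have "res1 V ?s = (\<Oplus>\<^bsub>M\<^esub>r\<in>reps V. res1 V (coord (res1 V x) r \<odot>\<^bsub>mf_obj F V\<^esub> orbit_gen V r))"
      using c by (intro linear_maps_finsum[OF obj_module[OF V] module_M res1_lin[OF V] finite_reps[OF V]]) auto
    also have "\<dots> = (\<Oplus>\<^bsub>M\<^esub>r\<in>reps V. coord (res1 V x) r \<odot>\<^bsub>M\<^esub> res1 V (orbit_gen V r))"
      using c linear_mapsD[OF res1_lin[OF V]] by (intro M.M.finsum_cong') auto
    finally show ?thesis .
  qed
  show ?thesis
  proof (rule res1_inj[OF V x s], rule coord_eqI[OF res1_closed[OF V x] res1_closed[OF V s]])
    fix b assume b: "b \<in> B"
    obtain r where r: "r \<in> reps V" "b \<in> orb V r" and un: "\<And>r'. \<lbrakk>r' \<in> reps V; b \<in> orb V r'\<rbrakk> \<Longrightarrow> r' = r"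
      using reps(2)[OF V b] by blast
    have "coord (res1 V ?s) b = (\<Oplus>\<^bsub>R\<^esub>r\<in>reps V. coord (res1 V x) r \<otimes>\<^bsub>R\<^esub> coord (res1 V (orbit_gen V r)) b)"
      unfolding e using c res1_closed[OF V] by (intro coord_finsum[OF finite_reps[OF V] _ _ b]) auto
    also have "\<dots> = (\<Oplus>\<^bsub>R\<^esub>r'\<in>reps V. if r = r' then coord (res1 V x) r' else \<zero>\<^bsub>R\<^esub>)"
    proof (rule R.finsum_cong')
      show "(\<lambda>r'. if r = r' then coord (res1 V x) r' else \<zero>\<^bsub>R\<^esub>) \<in> reps V \<rightarrow> carrier R" using c by auto
      fix r' assume r': "r' \<in> reps V"
      have "b \<in> orb V r' \<longleftrightarrow> r = r'" using un[OF r'] r(2) by blast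
      thus "coord (res1 V x) r' \<otimes>\<^bsub>R\<^esub> coord (res1 V (orbit_gen V r')) b = (if r = r' then coord (res1 V x) r' else \<zero>\<^bsub>R\<^esub>)"
        using coord_orbit_gen[OF V rB[OF r'] b] c(1)[OF r'] by simp
    qed simp
    also have "\<dots> = coord (res1 V x) r"
      using c by (intro R.finsum_singleton[OF r(1) finite_reps[OF V]]) auto
    finally show "coord (res1 V x) b = coord (res1 V ?s) b"
      using coord_res1_orb[OF V x rB[OF r(1)] r(2)] by simp
  qed
qed

lemma linear_ext:
  assumes V: "subgroup V G" and N: "module R N"
    and L: "L1 \<in> linear_maps R (mf_obj F V) N" "L2 \<in> linear_maps R (mf_obj F V) N"
    and eq: "\<And>b. b \<in> B \<Longrightarrow> L1 (orbit_gen V b) = L2 (orbit_gen V b)"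
    and x: "x \<in> carrier (mf_obj F V)"
  shows "L1 x = L2 x"
proof -
  interpret N: module R N by (rule N)
  have rB: "r \<in> B" if "r \<in> reps V" for r using reps(1)[OF V] that by blast
  have c: "coord (res1 V x) r \<in> carrier R" "orbit_gen V r \<in> carrier (mf_obj F V)" if "r \<in> reps V" for r
    using coord_R[OF res1_closed[OF V x] rB[OF that]] orbit_gen_closed[OF V rB[OF that]] by auto
  have *: "L x = (\<Oplus>\<^bsub>N\<^esub>r\<in>reps V. coord (res1 V x) r \<odot>\<^bsub>N\<^esub> L (orbit_gen V r))" if L: "L \<in> linear_maps R (mf_obj F V) N" for L
  proof -
    have "L x = L (\<Oplus>\<^bsub>mf_obj F V\<^esub>r\<in>reps V. coord (res1 V x) r \<odot>\<^bsub>mf_obj F V\<^esub> orbit_gen V r)"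
      using expand[OF V x] by simp
    also have "\<dots> = (\<Oplus>\<^bsub>N\<^esub>r\<in>reps V. L (coord (res1 V x) r \<odot>\<^bsub>mf_obj F V\<^esub> orbit_gen V r))"
      using c by (intro linear_maps_finsum[OF obj_module[OF V] N L finite_reps[OF V]])
         (auto intro!: module.smult_closed[OF obj_module[OF V]])
    also have "\<dots> = (\<Oplus>\<^bsub>N\<^esub>r\<in>reps V. coord (res1 V x) r \<odot>\<^bsub>N\<^esub> L (orbit_gen V r))"
      using c linear_mapsD[OF L] by (intro N.M.finsum_cong') auto
    finally show ?thesis .
  qed
  have "L1 x = (\<Oplus>\<^bsub>N\<^esub>r\<in>reps V. coord (res1 V x) r \<odot>\<^bsub>N\<^esub> L1 (orbit_gen V r))" by (rule *[OF L(1)])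
  also have "\<dots> = (\<Oplus>\<^bsub>N\<^esub>r\<in>reps V. coord (res1 V x) r \<odot>\<^bsub>N\<^esub> L2 (orbit_gen V r))"
    using c eq rB linear_mapsD(1)[OF L(2)] by (intro N.M.finsum_cong') auto
  also have "\<dots> = L2 x" by (rule *[OF L(2), symmetric])
  finally show ?thesis .
qed

text \<open>
  The linear map with \<open>orbit_gen V r \<mapsto> spread Y V (stab r) (y r)\<close> for the chosen orbit
  representatives \<open>r\<close>. By \<open>lift_orbit_gen\<close> the same formula holds for all points of \<open>B\<close> if \<open>y\<close> is
  equivariant, so the choice does not matter.
\<close>

definition lift :: "('r, 'y, 'g) mackey_functor \<Rightarrow> ('m \<Rightarrow> 'y) \<Rightarrow> 'g set \<Rightarrow> 'm \<Rightarrow> 'y" where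
  "lift Y y V x = (\<Oplus>\<^bsub>mf_obj Y V\<^esub>r\<in>reps V. coord (res1 V x) r \<odot>\<^bsub>mf_obj Y V\<^esub> spread Y V (stab r) (y r))"

context
  fixes Y :: "('r, 'y, 'g) mackey_functor" and y :: "'m \<Rightarrow> 'y"
  assumes Y: "abelian_mackey R G Y" and y: "\<And>b. b \<in> B \<Longrightarrow> y b \<in> carrier (mf_obj Y (stab b))"
    and con_y: "\<And>b g. \<lbrakk>b \<in> B; g \<in> carrier G\<rbrakk> \<Longrightarrow> mf_con Y g (stab b) (y b) = y (act g b)"
begin

interpretation Y: abelian_mackey R G Y by (rule Y)

lemma lift_linear: assumes V: "subgroup V G" shows "lift Y y V \<in> linear_maps R (mf_obj F V) (mf_obj Y V)"
proof -
  have rB: "r \<in> B" if "r \<in> reps V" for r using reps(1)[OF V] that by blast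
  have f: "(\<lambda>x. \<lambda>r\<in>reps V. coord (res1 V x) r) \<in> linear_maps R (mf_obj F V) (free_module_on R (reps V))"
    using linear_mapsD[OF res1_lin[OF V]] rB coord_R coord_add coord_smult
    by (auto simp: linear_maps_def free_module_on_def intro!: restrict_ext)
  have g: "(\<lambda>a. \<Oplus>\<^bsub>mf_obj Y V\<^esub>r\<in>reps V. a r \<odot>\<^bsub>mf_obj Y V\<^esub> spread Y V (stab r) (y r)) \<in> linear_maps R (free_module_on R (reps V)) (mf_obj Y V)"
    using rB y stab_subgroup V by (intro free_module_on_hom Y.obj_module V finite_reps) (auto intro!: Y.spread_closed)
  interpret N: module R "mf_obj Y V" by (rule Y.obj_module[OF V])
  have "lift Y y V x = (\<Oplus>\<^bsub>mf_obj Y V\<^esub>r\<in>reps V. (\<lambda>r\<in>reps V. coord (res1 V x) r) r \<odot>\<^bsub>mf_obj Y V\<^esub> spread Y V (stab r) (y r))"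
    if "x \<in> carrier (mf_obj F V)" for x
    unfolding lift_def using coord_R[OF res1_closed[OF V that]] rB y stab_subgroup V
    by (intro N.M.finsum_cong') (auto intro!: Y.spread_closed N.smult_closed)
  with linear_maps_compose[OF f g] show ?thesis
    using module.axioms(2)[OF obj_module[OF V]]
    by (auto simp: linear_maps_def abelian_group.axioms Pi_iff abelian_monoid.a_closed[OF abelian_group.axioms(1)]
        module.smult_closed[OF obj_module[OF V]])
qed

lemma lift_orbit_gen:
  assumes V: "subgroup V G" and b: "b \<in> B"
  shows "lift Y y V (orbit_gen V b) = spread Y V (stab b) (y b)"
proof -
  interpret N: module R "mf_obj Y V" by (rule Y.obj_module[OF V])
  have rB: "r \<in> B" if "r \<in> reps V" for r using reps(1)[OF V] that by blast
  have cl: "spread Y V (stab r) (y r) \<in> carrier (mf_obj Y V)" if "r \<in> B" for r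
    using that y stab_subgroup V by (intro Y.spread_closed) auto
  obtain r where r: "r \<in> reps V" "b \<in> orb V r" and un: "\<And>r'. \<lbrakk>r' \<in> reps V; b \<in> orb V r'\<rbrakk> \<Longrightarrow> r' = r"
    using reps(2)[OF V b] by blast
  have iff: "r' \<in> orb V b \<longleftrightarrow> r = r'" if "r' \<in> reps V" for r'
    using orb_sym[OF V b, of r'] orb_sym[OF V rB[OF that], of b] orb_sym[OF V rB[OF r(1)] r(2)] un[OF that] by blast
  have "lift Y y V (orbit_gen V b) = (\<Oplus>\<^bsub>mf_obj Y V\<^esub>r'\<in>reps V. if r = r' then spread Y V (stab r') (y r') else \<zero>\<^bsub>mf_obj Y V\<^esub>)"
    unfolding lift_def using cl rB coord_orbit_gen[OF V b rB] iff by (intro N.M.finsum_cong') auto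
  also have "\<dots> = spread Y V (stab r) (y r)"
    using cl rB by (intro N.M.finsum_singleton[OF r(1) finite_reps[OF V]]) auto
  also have "\<dots> = spread Y V (stab b) (y b)"
    by (rule orbit_gen_orb[OF V rB[OF r(1)] r(2) Y y con_y, symmetric])
  finally show ?thesis .
qed

text \<open>
  Both sides of each identity are linear, so it suffices to compare them at the elements
  \<open>orbit_gen V b\<close> (\<open>linear_ext\<close>). There the source and the target obey the same formulas \<open>res_spread\<close>,
  \<open>tr_spread\<close> and \<open>con_spread\<close>.
\<close>

lemma lift_mackey_hom: "lift Y y \<in> mackey_hom R G F Y"
  unfolding mackey_hom_def
proof (intro CollectI conjI allI impI ballI)
  fix U assume "subgroup U G" thus "lift Y y U \<in> linear_maps R (mf_obj F U) (mf_obj Y U)" by (rule lift_linear)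
next
  fix U V x assume UV: "subgroup U G \<and> subgroup V G \<and> V \<subseteq> U" and x: "x \<in> carrier (mf_obj F U)"
  hence U: "subgroup U G" and V: "subgroup V G" and sub: "V \<subseteq> U" by auto
  interpret FV: module R "mf_obj F V" by (rule obj_module[OF V])
  interpret YV: module R "mf_obj Y V" by (rule Y.obj_module[OF V])
  show "lift Y y V (mf_res F U V x) = mf_res Y U V (lift Y y U x)"
  proof (rule linear_ext[OF U Y.obj_module[OF V] linear_maps_compose[OF res_hom[OF U V sub] lift_linear[OF V]]
        linear_maps_compose[OF lift_linear[OF U] Y.res_hom[OF U V sub]] _ x])
    fix b assume b: "b \<in> B"
    note S = stab_subgroup[OF b]
    obtain D where D: "double_coset_reps G V U (U \<inter> stab b) D"
      using G.double_coset_reps_exist[OF V sub_Int[OF U S] sub _ U] by auto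
    have DU: "D \<subseteq> U" using D by (simp add: double_coset_reps_def)
    have DG: "g \<in> carrier G" if "g \<in> D" for g using DU that by (auto intro: subgroup_mem[OF U])
    have finD: "finite D" by (rule finite_subset[OF subset_trans[OF DU subgroup.subset[OF U]] finite_G])
    have gB: "act g b \<in> B" if "g \<in> D" for g by (rule act_B[OF DG[OF that] b])
    have "mf_res F U V (orbit_gen U b) = (\<Oplus>\<^bsub>mf_obj F V\<^esub>g\<in>D. spread F V (stab b) (mf_con F g (stab b) (stab_gen b)))"
      unfolding orbit_gen_def by (rule res_spread[OF U S V sub stab_gen(1)[OF b] D])
    also have "\<dots> = (\<Oplus>\<^bsub>mf_obj F V\<^esub>g\<in>D. orbit_gen V (act g b))"
      using orbit_gen_closed[OF V gB] con_stab_gen[OF b DG] stab_act[OF b DG]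
      by (intro FV.M.finsum_cong') (auto simp: orbit_gen_def)
    finally have "lift Y y V (mf_res F U V (orbit_gen U b)) = lift Y y V (\<Oplus>\<^bsub>mf_obj F V\<^esub>g\<in>D. orbit_gen V (act g b))" by simp
    also have "\<dots> = (\<Oplus>\<^bsub>mf_obj Y V\<^esub>g\<in>D. lift Y y V (orbit_gen V (act g b)))"
      using orbit_gen_closed[OF V gB] 
      by (intro linear_maps_finsum[OF obj_module[OF V] Y.obj_module[OF V] lift_linear[OF V] finD]) auto
    also have "\<dots> = (\<Oplus>\<^bsub>mf_obj Y V\<^esub>g\<in>D. spread Y V (stab b) (mf_con Y g (stab b) (y b)))"
    proof (rule YV.M.finsum_cong')
      show "(\<lambda>g. spread Y V (stab b) (mf_con Y g (stab b) (y b))) \<in> D \<rightarrow> carrier (mf_obj Y V)"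
        using DG by (intro Pi_I Y.spread_closed V S Y.con_closed y b) auto
      fix g assume g: "g \<in> D"
      show "lift Y y V (orbit_gen V (act g b)) = spread Y V (stab b) (mf_con Y g (stab b) (y b))"
        using lift_orbit_gen[OF V gB[OF g]] con_y[OF b DG[OF g]] stab_act[OF b DG[OF g]] by simp
    qed simp
    also have "\<dots> = mf_res Y U V (spread Y U (stab b) (y b))"
      by (rule Y.res_spread[OF U S V sub y[OF b] D, symmetric])
    also have "\<dots> = mf_res Y U V (lift Y y U (orbit_gen U b))" using lift_orbit_gen[OF U b] by simp
    finally show "lift Y y V (mf_res F U V (orbit_gen U b)) = mf_res Y U V (lift Y y U (orbit_gen U b))" .
  qed
next
  fix U V x assume UV: "subgroup U G \<and> subgroup V G \<and> V \<subseteq> U" and x: "x \<in> carrier (mf_obj F V)"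
  hence U: "subgroup U G" and V: "subgroup V G" and sub: "V \<subseteq> U" by auto
  interpret FU: module R "mf_obj F U" by (rule obj_module[OF U])
  interpret YU: module R "mf_obj Y U" by (rule Y.obj_module[OF U])
  show "lift Y y U (mf_tr F V U x) = mf_tr Y V U (lift Y y V x)"
  proof (rule linear_ext[OF V Y.obj_module[OF U] linear_maps_compose[OF tr_hom[OF U V sub] lift_linear[OF U]]
        linear_maps_compose[OF lift_linear[OF V] Y.tr_hom[OF U V sub]] _ x])
    fix b assume b: "b \<in> B"
    note S = stab_subgroup[OF b]
    let ?k = "card (lcosets\<^bsub>G\<lparr>carrier := U \<inter> stab b\<rparr>\<^esub> (V \<inter> stab b))"
    have "lift Y y U (mf_tr F V U (orbit_gen V b)) = lift Y y U ([?k] \<cdot>\<^bsub>mf_obj F U\<^esub> orbit_gen U b)"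
      unfolding orbit_gen_def using tr_spread[OF U S V sub stab_gen(1)[OF b]] by simp
    also have "\<dots> = [?k] \<cdot>\<^bsub>mf_obj Y U\<^esub> lift Y y U (orbit_gen U b)"
      using linear_maps_add_pow[OF obj_module[OF U] Y.obj_module[OF U] lift_linear[OF U] orbit_gen_closed[OF U b], of "int ?k"]
      by (simp add: FU.M.zmul_int YU.M.zmul_int)
    also have "\<dots> = mf_tr Y V U (spread Y V (stab b) (y b))"
      using Y.tr_spread[OF U S V sub y[OF b]] lift_orbit_gen[OF U b] by simp
    finally show "lift Y y U (mf_tr F V U (orbit_gen V b)) = mf_tr Y V U (lift Y y V (orbit_gen V b))"
      using lift_orbit_gen[OF V b] by simp
  qed
next
  fix U g x assume Ug: "subgroup U G \<and> g \<in> carrier G" and x: "x \<in> carrier (mf_obj F U)"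
  hence U: "subgroup U G" and g: "g \<in> carrier G" by auto
  have "lift Y y U (mf_con F g U x) = mf_con Y g U (lift Y y U x)"
  proof (rule linear_ext[OF U Y.obj_module[OF U] linear_maps_compose[OF con_lin[OF U g] lift_linear[OF U]]
        linear_maps_compose[OF lift_linear[OF U] Y.con_lin[OF U g]] _ x])
    fix b assume b: "b \<in> B"
    note S = stab_subgroup[OF b] and gb = act_B[OF g b]
    have "mf_con F g U (orbit_gen U b) = orbit_gen U (act g b)"
      unfolding orbit_gen_def using con_spread[OF U S stab_gen(1)[OF b] g] con_stab_gen[OF b g] stab_act[OF b g] by simp
    hence "lift Y y U (mf_con F g U (orbit_gen U b)) = spread Y U (stab (act g b)) (y (act g b))"
      using lift_orbit_gen[OF U gb] by simp
    also have "\<dots> = mf_con Y g U (spread Y U (stab b) (y b))"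
      using Y.con_spread[OF U S y[OF b] g] con_y[OF b g] stab_act[OF b g] by simp
    finally show "lift Y y U (mf_con F g U (orbit_gen U b)) = mf_con Y g U (lift Y y U (orbit_gen U b))"
      using lift_orbit_gen[OF U b] by simp
  qed
  thus "lift Y y (conj_set G g U) (mf_con F g U x) = mf_con Y g U (lift Y y U x)" using U g by simp
qed

end

text \<open>
  Choose at representatives of the \<open>G\<close>-orbits and transport by conjugation. Two group elements that
  move the representative to the same point differ by an element of its stabilizer, and
  conjugation by that is the identity.
\<close>

lemma equivariant_choice:
  assumes Y: "abelian_mackey R G Y"
    and ex: "\<And>b. b \<in> B \<Longrightarrow> \<exists>z\<in>carrier (mf_obj Y (stab b)). Q b z"
    and Q_con: "\<And>b g z. \<lbrakk>b \<in> B; g \<in> carrier G; z \<in> carrier (mf_obj Y (stab b)); Q b z\<rbrakk> \<Longrightarrow>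
        Q (act g b) (mf_con Y g (stab b) z)"
  shows "\<exists>y. (\<forall>b\<in>B. y b \<in> carrier (mf_obj Y (stab b)) \<and> Q b (y b)) \<and>
    (\<forall>b\<in>B. \<forall>g\<in>carrier G. mf_con Y g (stab b) (y b) = y (act g b))"
proof -
  interpret Y: abelian_mackey R G Y by (rule Y)
  have GG: "subgroup (carrier G) G" by (rule G.subgroup_self)
  obtain y0 where y0: "\<And>b. b \<in> B \<Longrightarrow> y0 b \<in> carrier (mf_obj Y (stab b))" "\<And>b. b \<in> B \<Longrightarrow> Q b (y0 b)"
    using ex by metis
  have "\<exists>r t. r \<in> reps (carrier G) \<and> t \<in> carrier G \<and> b = act t r" if "b \<in> B" for b
    using reps(2)[OF GG that] by (auto simp: orb_def)
  then obtain r t where rt: "\<And>b. b \<in> B \<Longrightarrow> r b \<in> reps (carrier G)" "\<And>b. b \<in> B \<Longrightarrow> t b \<in> carrier G"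
    "\<And>b. b \<in> B \<Longrightarrow> b = act (t b) (r b)" by metis
  have rB: "r b \<in> B" if "b \<in> B" for b using reps(1)[OF GG] rt(1)[OF that] by blast
  have stab_r: "stab (r b) = stab b" if "b \<in> B" for b
    using stab_act[OF rB[OF that] rt(2)[OF that]] rt(3)[OF that] by simp
  have r_act: "r (act g b) = r b" if b: "b \<in> B" and g: "g \<in> carrier G" for g b
  proof -
    have gb: "act g b \<in> B" by (rule act_B[OF g b])
    have "act g b = act (g \<otimes> t b) (r b)"
      using con_mult[OF triv rt(2)[OF b] g B_closed[OF rB[OF b]]] rt(3)[OF b] by simp
    hence "act g b \<in> orb (carrier G) (r b)" unfolding orb_def using rt(2)[OF b] g by blast
    moreover have "act g b \<in> orb (carrier G) (r (act g b))" unfolding orb_def using rt(2,3)[OF gb] by blast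
    ultimately show ?thesis using reps(2)[OF GG gb] rt(1)[OF b] rt(1)[OF gb] by blast
  qed
  define y where "y b = mf_con Y (t b) (stab b) (y0 (r b))" for b
  have y: "y b \<in> carrier (mf_obj Y (stab b)) \<and> Q b (y b)" if b: "b \<in> B" for b
    unfolding y_def
    using y0[OF rB[OF b]] stab_r[OF b] rt(2,3)[OF b] stab_subgroup[OF b] Q_con[OF rB[OF b] rt(2)[OF b] y0[OF rB[OF b]]]
    by (auto intro: Y.con_closed)
  have con_y: "mf_con Y g (stab b) (y b) = y (act g b)" if b: "b \<in> B" and g: "g \<in> carrier G" for b g
  proof -
    note S = stab_subgroup[OF b]
    have gb: "act g b \<in> B" by (rule act_B[OF g b])
    define z where "z = y0 (r b)"
    have z: "z \<in> carrier (mf_obj Y (stab b))" using y0(1)[OF rB[OF b]] stab_r[OF b] by (simp add: z_def)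
    \<comment> \<open>both \<open>a\<close> and \<open>c\<close> move the representative \<open>r b\<close> to \<open>act g b\<close>\<close>
    define a where "a = g \<otimes> t b"
    define c where "c = t (act g b)"
    have ac: "a \<in> carrier G" "c \<in> carrier G" using g rt(2)[OF b] rt(2)[OF gb] by (auto simp: a_def c_def)
    have rM: "r b \<in> carrier M" by (rule B_closed[OF rB[OF b]])
    have "act a (r b) = act g b"
      unfolding a_def using con_mult[OF triv rt(2)[OF b] g rM] rt(3)[OF b] by simp
    also have "\<dots> = act c (r b)" unfolding c_def using rt(3)[OF gb] r_act[OF b g] by simp
    finally have "act (inv c \<otimes> a) (r b) = r b"
      using con_mult[OF triv ac(1) G.inv_closed[OF ac(2)] rM] act_inv[OF ac(2) rM] by simp
    hence k: "inv c \<otimes> a \<in> stab b" using ac stab_r[OF b] by (auto simp: stab_def)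
    have "mf_con Y g (stab b) (y b) = mf_con Y a (stab b) z"
      unfolding y_def a_def z_def[symmetric] using Y.con_mult[OF S rt(2)[OF b] g z] by simp
    also have "a = c \<otimes> (inv c \<otimes> a)" using ac by (simp add: G.m_assoc[symmetric])
    also have "mf_con Y (c \<otimes> (inv c \<otimes> a)) (stab b) z = mf_con Y c (stab b) (mf_con Y (inv c \<otimes> a) (stab b) z)"
      using ac by (intro Y.con_mult[OF S _ _ z]) auto
    also have "mf_con Y (inv c \<otimes> a) (stab b) z = z" by (rule Y.con_id[OF S k z])
    also have "mf_con Y c (stab b) z = y (act g b)"
      unfolding y_def c_def z_def using r_act[OF b g] stab_act[OF b g] by simp
    finally show ?thesis .
  qed
  show ?thesis using y con_y by blast
qed

theorem projective: "mackey_projective TYPE('y) TYPE('z) R G F"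
  unfolding mackey_projective_def
proof (intro conjI allI impI)
  show "cohomological_mackey_functor R G F" by unfold_locales
next
  fix Y :: "('r, 'y, 'g) mackey_functor" and Z :: "('r, 'z, 'g) mackey_functor" and q f
  assume as: "cohomological_mackey_functor R G Y \<and> cohomological_mackey_functor R G Z \<and>
        q \<in> mackey_hom R G Y Z \<and>
        (\<forall>U. subgroup U G \<longrightarrow> q U ` carrier (mf_obj Y U) = carrier (mf_obj Z U)) \<and>
        f \<in> mackey_hom R G F Z"
  hence Y: "abelian_mackey R G Y" and Z: "abelian_mackey R G Z" and q: "q \<in> mackey_hom R G Y Z"
    and f: "f \<in> mackey_hom R G F Z" using comm_G by (auto simp: abelian_mackey_def abelian_mackey_axioms_def)
  have qs: "q U ` carrier (mf_obj Y U) = carrier (mf_obj Z U)" if "subgroup U G" for U using as that by blast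
  interpret Y: abelian_mackey R G Y by (rule Y)
  interpret Z: abelian_mackey R G Z by (rule Z)
  have F: "abelian_mackey R G F" by unfold_locales
  have q_lin: "q U \<in> linear_maps R (mf_obj Y U) (mf_obj Z U)" and f_lin: "f U \<in> linear_maps R (mf_obj F U) (mf_obj Z U)"
    if "subgroup U G" for U using q f that by (auto simp: mackey_hom_def)
  have q_con: "q U (mf_con Y g U x) = mf_con Z g U (q U x)" if "subgroup U G" "g \<in> carrier G" "x \<in> carrier (mf_obj Y U)" for U g x
    using q that conj_subgroup[OF that(1,2)] by (auto simp: mackey_hom_def)
  have f_con: "f U (mf_con F g U x) = mf_con Z g U (f U x)" if "subgroup U G" "g \<in> carrier G" "x \<in> carrier (mf_obj F U)" for U g x
    using f that conj_subgroup[OF that(1,2)] by (auto simp: mackey_hom_def)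
  obtain y where y: "\<And>b. b \<in> B \<Longrightarrow> y b \<in> carrier (mf_obj Y (stab b))"
    and qy: "\<And>b. b \<in> B \<Longrightarrow> q (stab b) (y b) = f (stab b) (stab_gen b)"
    and con_y: "\<And>b g. \<lbrakk>b \<in> B; g \<in> carrier G\<rbrakk> \<Longrightarrow> mf_con Y g (stab b) (y b) = y (act g b)"
  proof -
    have ex: "\<exists>z\<in>carrier (mf_obj Y (stab b)). q (stab b) z = f (stab b) (stab_gen b)" if b: "b \<in> B" for b
    proof -
      have "f (stab b) (stab_gen b) \<in> q (stab b) ` carrier (mf_obj Y (stab b))"
        using qs[OF stab_subgroup[OF b]] linear_mapsD(1)[OF f_lin[OF stab_subgroup[OF b]] stab_gen(1)[OF b]] by simp
      thus ?thesis by force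
    qed
    have Q_con: "q (stab (act g b)) (mf_con Y g (stab b) z) = f (stab (act g b)) (stab_gen (act g b))"
      if "b \<in> B" "g \<in> carrier G" "z \<in> carrier (mf_obj Y (stab b))" "q (stab b) z = f (stab b) (stab_gen b)" for b g z
      unfolding stab_act[OF that(1,2)] con_stab_gen[OF that(1,2), symmetric]
      using q_con[OF stab_subgroup[OF that(1)] that(2,3)] f_con[OF stab_subgroup[OF that(1)] that(2) stab_gen(1)[OF that(1)]] that(4)
      by simp
    show ?thesis
      using equivariant_choice[OF Y, of "\<lambda>b z. q (stab b) z = f (stab b) (stab_gen b)", OF ex Q_con] that by blast
  qed
  show "\<exists>h\<in>mackey_hom R G F Y. \<forall>U. subgroup U G \<longrightarrow> (\<forall>x\<in>carrier (mf_obj F U). q U (h U x) = f U x)"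
  proof (intro bexI[of _ "lift Y y"] allI impI ballI)
    show "lift Y y \<in> mackey_hom R G F Y" by (rule lift_mackey_hom[OF Y y con_y])
    fix U x assume U: "subgroup U G" and x: "x \<in> carrier (mf_obj F U)"
    show "q U (lift Y y U x) = f U x"
    proof (rule linear_ext[OF U Z.obj_module[OF U] linear_maps_compose[OF lift_linear[OF Y y con_y U] q_lin[OF U]] f_lin[OF U] _ x])
      fix b assume b: "b \<in> B"
      note S = stab_subgroup[OF b]
      have "q U (lift Y y U (orbit_gen U b)) = q U (spread Y U (stab b) (y b))" using lift_orbit_gen[OF Y y con_y U b] by simp
      also have "\<dots> = spread Z U (stab b) (f (stab b) (stab_gen b))" using spread_hom[OF q Y U S y[OF b]] qy[OF b] by simp
      also have "\<dots> = f U (orbit_gen U b)" unfolding orbit_gen_def by (rule spread_hom[OF f F U S stab_gen(1)[OF b], symmetric])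
      finally show "q U (lift Y y U (orbit_gen U b)) = f U (orbit_gen U b)" .
    qed
  qed
qed


section \<open>The isomorphism with a permutation functor\<close>

text \<open>
  Restriction identifies \<open>F\<close> with \<open>h\<^sup>0(M)\<close>; the coordinates with respect to the basis identify \<open>M\<close> with
  \<open>R[\<Omega>]\<close>, where \<open>\<Omega>\<close> enumerates the basis.
\<close>

theorem iso_permutation:
  "\<exists>(\<Omega> :: nat set) \<phi>. finite \<Omega> \<and> group_action G \<Omega> \<phi> \<and>
     mackey_iso R G F (h0 G (free_module_on R \<Omega>) (permutation_action G \<Omega> \<phi>)) \<noteq> {}"
proof -
  define \<Omega> where "\<Omega> = {..<card B}"
  obtain e where e: "bij_betw e \<Omega> B"
    using ex_bij_betw_nat_finite[OF finite_B] by (auto simp: \<Omega>_def atLeast0LessThan)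
  define d where "d = the_inv_into \<Omega> e"
  have eB: "e \<omega> \<in> B" if "\<omega> \<in> \<Omega>" for \<omega> using bij_betw_apply[OF e that] .
  have d\<Omega>: "d b \<in> \<Omega>" if "b \<in> B" for b unfolding d_def using bij_betw_apply[OF bij_betw_the_inv_into[OF e] that] .
  have ed: "e (d b) = b" if "b \<in> B" for b unfolding d_def by (rule f_the_inv_into_f_bij_betw[OF e that])
  have de: "d (e \<omega>) = \<omega>" if "\<omega> \<in> \<Omega>" for \<omega> unfolding d_def by (rule the_inv_into_f_f[OF bij_betw_imp_inj_on[OF e] that])
  define \<phi> where "\<phi> g = (\<lambda>\<omega>\<in>\<Omega>. d (act g (e \<omega>)))" for g
  have \<phi>\<Omega>: "\<phi> g \<omega> \<in> \<Omega>" and e\<phi>: "e (\<phi> g \<omega>) = act g (e \<omega>)" if "g \<in> carrier G" "\<omega> \<in> \<Omega>" for g \<omega>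
    using d\<Omega>[OF act_B[OF that(1) eB[OF that(2)]]] ed[OF act_B[OF that(1) eB[OF that(2)]]] that(2) by (simp_all add: \<phi>_def)
  have \<phi>_Bij: "\<phi> g \<in> Bij \<Omega>" if g: "g \<in> carrier G" for g
  proof -
    have "bij_betw (\<phi> g) \<Omega> \<Omega>"
    proof (rule bij_betwI[where g = "\<phi> (inv g)"])
      show "\<phi> g \<in> \<Omega> \<rightarrow> \<Omega>" "\<phi> (inv g) \<in> \<Omega> \<rightarrow> \<Omega>" using \<phi>\<Omega> g by auto
      fix \<omega> assume w: "\<omega> \<in> \<Omega>"
      show "\<phi> (inv g) (\<phi> g \<omega>) = \<omega>"
        using \<phi>\<Omega>[OF g w] e\<phi>[OF g w] act_inv[OF g B_closed[OF eB[OF w]]] de[OF w] by (simp add: \<phi>_def[of "inv g"])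
      have h: "inv g \<in> carrier G" using g by simp
      show "\<phi> g (\<phi> (inv g) \<omega>) = \<omega>"
        using \<phi>\<Omega>[OF h w] e\<phi>[OF h w] act_inv2[OF g B_closed[OF eB[OF w]]] de[OF w] by (simp add: \<phi>_def[of g])
    qed
    thus ?thesis by (simp add: Bij_def \<phi>_def)
  qed
  have action: "group_action G \<Omega> \<phi>"
  proof (intro group_action.intro group_hom.intro group_hom_axioms.intro G.is_group group_BijGroup homI)
    fix g assume g: "g \<in> carrier G" thus "\<phi> g \<in> carrier (BijGroup \<Omega>)" using \<phi>_Bij by (simp add: BijGroup_def)
    fix h assume h: "h \<in> carrier G"
    have "\<phi> (g \<otimes> h) = compose \<Omega> (\<phi> g) (\<phi> h)"
    proof
      fix \<omega>
      show "\<phi> (g \<otimes> h) \<omega> = compose \<Omega> (\<phi> g) (\<phi> h) \<omega>"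
      proof (cases "\<omega> \<in> \<Omega>")
        case True
        have "\<phi> g (\<phi> h \<omega>) = d (act g (act h (e \<omega>)))"
          using \<phi>\<Omega>[OF h True] e\<phi>[OF h True] by (simp add: \<phi>_def[of g])
        thus ?thesis using True con_mult[OF triv h g B_closed[OF eB[OF True]]]
          by (simp add: compose_def \<phi>_def[of "g \<otimes> h"])
      qed (simp add: compose_def \<phi>_def)
    qed
    thus "\<phi> (g \<otimes> h) = \<phi> g \<otimes>\<^bsub>BijGroup \<Omega>\<^esub> \<phi> h" using \<phi>_Bij g h by (simp add: BijGroup_def)
  qed
  define P where "P = free_module_on R \<Omega>"
  define pa :: "'g \<Rightarrow> (nat \<Rightarrow> 'r) \<Rightarrow> nat \<Rightarrow> 'r" where "pa = permutation_action G \<Omega> \<phi>"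
  have Pc: "carrier P = \<Omega> \<rightarrow>\<^sub>E carrier R" by (simp add: P_def free_module_on_def)
  have modP: "module R P" unfolding P_def by (rule module_free_module_on[OF R.is_cring])
  define C where "C m = (\<lambda>\<omega>\<in>\<Omega>. coord m (e \<omega>))" for m
  have C_lin: "C \<in> linear_maps R M P"
    using coord_R coord_add coord_smult eB
    by (auto simp: linear_maps_def C_def P_def free_module_on_def intro!: restrict_ext)
  have C_bij: "bij_betw C (carrier M) (carrier P)"
  proof (rule bij_betwI')
    fix x y assume xy: "x \<in> carrier M" "y \<in> carrier M"
    show "C x = C y \<longleftrightarrow> x = y"
    proof
      assume C: "C x = C y"
      show "x = y"
      proof (rule coord_eqI[OF xy])
        fix b assume b: "b \<in> B"
        show "coord x b = coord y b" using fun_cong[OF C, of "d b"] d\<Omega>[OF b] ed[OF b] by (simp add: C_def)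
      qed
    qed simp
  next
    fix x assume "x \<in> carrier M" thus "C x \<in> carrier P" by (rule linear_mapsD(1)[OF C_lin])
  next
    fix f assume f: "f \<in> carrier P"
    define f' where "f' = (\<lambda>b\<in>B. f (d b))"
    have f': "f' \<in> B \<rightarrow>\<^sub>E carrier R" using f d\<Omega> by (auto simp: f'_def Pc)
    have "C (comb f') = f"
    proof (rule PiE_ext)
      have "comb f' \<in> carrier M" using f' linear_mapsD(1)[OF comb_linear] by (simp add: carrier_FM)
      thus "C (comb f') \<in> \<Omega> \<rightarrow>\<^sub>E carrier R" using linear_mapsD(1)[OF C_lin] by (simp add: Pc)
      show "f \<in> \<Omega> \<rightarrow>\<^sub>E carrier R" using f by (simp add: Pc)
      fix \<omega> assume w: "\<omega> \<in> \<Omega>"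
      have "C (comb f') \<omega> = f' (e \<omega>)" using w by (simp add: C_def coord_comb[OF f'])
      thus "C (comb f') \<omega> = f \<omega>" using eB[OF w] de[OF w] by (simp add: f'_def)
    qed
    moreover have "comb f' \<in> carrier M" using f' linear_mapsD(1)[OF comb_linear] by (simp add: carrier_FM)
    ultimately show "\<exists>x\<in>carrier M. f = C x" by metis
  qed
  have C_act: "C (act g m) = pa g (C m)" if g: "g \<in> carrier G" and m: "m \<in> carrier M" for g m
  proof
    fix \<omega>
    show "C (act g m) \<omega> = pa g (C m) \<omega>"
    proof (cases "\<omega> \<in> \<Omega>")
      case True
      have h: "inv g \<in> carrier G" using g by simp
      have "coord (act g m) (e \<omega>) = coord m (act (inv g) (e \<omega>))"
        using coord_act[OF g m act_B[OF h eB[OF True]]] act_inv2[OF g B_closed[OF eB[OF True]]] by simp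
      thus ?thesis using True \<phi>\<Omega>[OF h True] e\<phi>[OF h True] by (simp add: C_def pa_def permutation_action_def)
    qed (simp add: C_def pa_def permutation_action_def)
  qed
  have C_fixed: "bij_betw C (fixed_points M act U) (fixed_points P pa U)" if U: "subgroup U G" for U
  proof -
    have UG: "u \<in> carrier G" if "u \<in> U" for u using U that by (rule subgroup_mem)
    have iff: "C m \<in> fixed_points P pa U \<longleftrightarrow> m \<in> fixed_points M act U" if m: "m \<in> carrier M" for m
    proof -
      have "pa u (C m) = C m \<longleftrightarrow> act u m = m" if "u \<in> U" for u
        using C_act[OF UG[OF that] m] bij_betw_imp_inj_on[OF C_bij] act_closed[OF UG[OF that] m] m
        by (metis inj_on_eq_iff)
      thus ?thesis using m linear_mapsD(1)[OF C_lin m] by (auto simp: fixed_points_def)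
    qed
    have sub: "fixed_points M act U \<subseteq> carrier M" "fixed_points P pa U \<subseteq> carrier P"
      by (auto simp: fixed_points_def)
    have "C ` fixed_points M act U = fixed_points P pa U"
    proof (intro equalityI subsetI)
      fix f assume "f \<in> C ` fixed_points M act U"
      then obtain m where "m \<in> fixed_points M act U" "f = C m" by blast
      thus "f \<in> fixed_points P pa U" using iff sub(1) by blast
    next
      fix f assume f: "f \<in> fixed_points P pa U"
      hence "f \<in> C ` carrier M" using sub(2) C_bij by (auto simp: bij_betw_def)
      then obtain m where "m \<in> carrier M" "f = C m" by blast
      thus "f \<in> C ` fixed_points M act U" using iff f by blast
    qed
    moreover have "inj_on C (fixed_points M act U)"
      using bij_betw_imp_inj_on[OF C_bij] sub(1) by (rule inj_on_subset)
    ultimately show ?thesis by (simp add: bij_betw_def)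
  qed
  define \<psi> where "\<psi> U x = C (res1 U x)" for U x
  have "\<psi> \<in> mackey_iso R G F (h0 G P pa)"
    unfolding mackey_iso_def mackey_hom_def
  proof (intro CollectI conjI allI impI ballI)
    fix U assume U: "subgroup U G"
    have "bij_betw (\<psi> U) (carrier (mf_obj F U)) (fixed_points P pa U)"
      using bij_betw_trans[OF res_bij(2)[OF H0 U] C_fixed[OF U]] by (simp add: \<psi>_def[abs_def] comp_def)
    thus bij: "bij_betw (\<psi> U) (carrier (mf_obj F U)) (carrier (mf_obj (h0 G P pa) U))" by (simp add: h0_def)
    have "\<psi> U \<in> linear_maps R (mf_obj F U) P"
      using linear_maps_compose[OF res1_lin[OF U] C_lin] by (simp add: \<psi>_def[abs_def])
    thus "\<psi> U \<in> linear_maps R (mf_obj F U) (mf_obj (h0 G P pa) U)"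
      using bij_betw_apply[OF bij] by (auto simp: linear_maps_def h0_def)
  next
    fix U V x assume UV: "subgroup U G \<and> subgroup V G \<and> V \<subseteq> U" and x: "x \<in> carrier (mf_obj F U)"
    show "\<psi> V (mf_res F U V x) = mf_res (h0 G P pa) U V (\<psi> U x)"
      using UV x res_res[of U V "{\<one>}" x] triv one_sub by (simp add: \<psi>_def h0_def)
  next
    fix U V x assume UV: "subgroup U G \<and> subgroup V G \<and> V \<subseteq> U" and x: "x \<in> carrier (mf_obj F V)"
    hence U: "subgroup U G" and V: "subgroup V G" and sub: "V \<subseteq> U" by auto
    let ?L = "lcosets\<^bsub>G\<lparr>carrier := U\<rparr>\<^esub> V"
    define m where "m = res1 V x"
    have m: "m \<in> carrier M" unfolding m_def by (rule res1_closed[OF V x])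
    have finU: "finite U" using subgroup.subset[OF U] finite_G by (rule finite_subset)
    have finL: "finite ?L" using finU by (auto simp: LCOSETS_def)
    have rep: "(SOME r. r \<in> K) \<in> carrier G" if K: "K \<in> ?L" for K
    proof -
      obtain u where u: "u \<in> U" "K = u <#\<^bsub>G\<lparr>carrier := U\<rparr>\<^esub> V" using K by (auto simp: LCOSETS_def)
      have "K \<subseteq> U" using u sub subgroup.m_closed[OF U u(1)] by (auto simp: l_coset_def)
      moreover have "u \<otimes> \<one> \<in> K" using u subgroup.one_closed[OF V] by (auto simp: l_coset_def)
      ultimately have "(SOME r. r \<in> K) \<in> U" using someI[of "\<lambda>r. r \<in> K"] by blast
      thus ?thesis by (rule subgroup_mem[OF U])
    qed
    have "res1 U (mf_tr F V U x) = mf_tr (h0 G M act) V U m"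
      using H0 UV x unfolding type_H0_def mackey_iso_def mackey_hom_def m_def by blast
    also have "\<dots> = (\<Oplus>\<^bsub>M\<^esub>K\<in>?L. act (SOME r. r \<in> K) m)" by (simp add: h0_def)
    finally have "\<psi> U (mf_tr F V U x) = C (\<Oplus>\<^bsub>M\<^esub>K\<in>?L. act (SOME r. r \<in> K) m)" by (simp add: \<psi>_def)
    also have "\<dots> = (\<Oplus>\<^bsub>P\<^esub>K\<in>?L. C (act (SOME r. r \<in> K) m))"
      using rep act_closed m by (intro linear_maps_finsum[OF module_M modP C_lin finL]) auto
    also have "\<dots> = (\<Oplus>\<^bsub>P\<^esub>K\<in>?L. pa (SOME r. r \<in> K) (C m))"
    proof -
      interpret P: module R P by (rule modP)
      have "pa (SOME r. r \<in> K) (C m) \<in> carrier P" if "K \<in> ?L" for K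
        using C_act[OF rep[OF that] m] linear_mapsD(1)[OF C_lin act_closed[OF rep[OF that] m]] by simp
      thus ?thesis using C_act rep m by (intro P.M.finsum_cong') auto
    qed
    finally show "\<psi> U (mf_tr F V U x) = mf_tr (h0 G P pa) V U (\<psi> V x)" by (simp add: h0_def \<psi>_def m_def)
  next
    fix U g x assume Ug: "subgroup U G \<and> g \<in> carrier G" and x: "x \<in> carrier (mf_obj F U)"
    thus "\<psi> (conj_set G g U) (mf_con F g U x) = mf_con (h0 G P pa) g U (\<psi> U x)"
      using res1_con[of U g x] C_act[of g "res1 U x"] res1_closed[of U x] by (simp add: \<psi>_def h0_def)
  qed
  thus ?thesis using action unfolding P_def pa_def by (intro exI[of _ \<Omega>] exI[of _ \<phi>]) (auto simp: \<Omega>_def)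
qed

end

section \<open>Hilbert 90 functors are permutation functors\<close>

theorem theorem6p5:
  fixes R :: "('r, 'a) ring_scheme" and G :: "('g, 'b) monoid_scheme"
    and F :: "('r, 'm, 'g) mackey_functor" and p :: nat
  assumes "discrete_valuation_domain R" and "char_zero R"
    and "Factorial_Ring.prime p"
    and "maximalideal (PIdl\<^bsub>R\<^esub> ([p] \<cdot>\<^bsub>R\<^esub> \<one>\<^bsub>R\<^esub>)) R"
    and "group G" and "finite (carrier G)" and "cyclic_group G"
    and "\<exists>n::nat. order G = p ^ n"
    and "cohomological_mackey_functor R G F"
    and "\<And>U. subgroup U G \<Longrightarrow> R_lattice R (mf_obj F U)"
    and "hilbert90 R G F"
  shows "(\<exists>(\<Omega> :: nat set) \<phi>. finite \<Omega> \<and> group_action G \<Omega> \<phi> \<and>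
            mackey_iso R G F (h0 G (free_module_on R \<Omega>) (permutation_action G \<Omega> \<phi>)) \<noteq> {})
         \<and> mackey_projective TYPE('y) TYPE('z) R G F"
proof -
  obtain n where n: "order G = p ^ n" using assms(8) by blast
  have dvr: "unramified_dvr R p"
    using assms(1-4) by (simp add: unramified_dvr_def unramified_dvr_axioms_def discrete_valuation_domain_def)
  interpret unramified_dvr R p by (rule dvr)
  interpret F: abelian_mackey R G F
    using assms(9) group.cyclic_imp_abelian_group[OF assms(5,7)]
    by (simp add: abelian_mackey_def abelian_mackey_axioms_def)
  obtain \<gamma> where \<gamma>: "\<gamma> \<in> carrier G" "carrier G = range (\<lambda>k::int. \<gamma> [^]\<^bsub>G\<^esub> k)"
    using assms(7) group.cyclic_group[OF assms(5)] by blast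
  note h = F.h90_lattice_of_mackey[OF dvr \<gamma> n assms(10,11)]
  interpret L: h90_lattice R F.M "F.act \<gamma>" p n by (rule h(1))
  obtain B where B: "finite B" "B \<subseteq> carrier F.M" "F.act \<gamma> ` B \<subseteq> B"
     "bij_betw (\<lambda>f. \<Oplus>\<^bsub>F.M\<^esub>b\<in>B. f b \<odot>\<^bsub>F.M\<^esub> b) (B \<rightarrow>\<^sub>E carrier R) (carrier F.M)"
    using L.stable_basis by blast
  interpret permutation_basis R G F B
  proof
    show "type_H0 R G F" using assms(11) by (simp add: hilbert90_def)
    fix g b assume g: "g \<in> carrier G" and b: "b \<in> B"
    obtain k :: nat where k: "g = \<gamma> [^]\<^bsub>G\<^esub> k" using h(2)[OF _ g] by blast
    have "(F.act \<gamma> ^^ k) b \<in> B" using b B(3) by (induction k) auto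
    thus "F.act g b \<in> B" using F.act_pow[OF \<gamma>(1), of b k] b B(2) k by auto
  qed (use B L.nontrivial in auto)
  show ?thesis using iso_permutation projective by blast
qed

end
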